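(* Let $p$ be fixed, let $\mu\in\mathbb{R}^p$ and let $\Sigma$ be a fixed symmetric positive definite $p\times p$ matrix with finest block decomposition $B^*=B(\Sigma)$. Let $X^{(1)},\dots,X^{(n)}$ be i.i.d. $\mathcal{N}(\mu,\Sigma)$ ($\mu$ and $\Sigma$ unknown), let $\delta\in\,]0,1/2[$ and $\kappa=\frac{1}{pn^\delta}$. Let $\widehat B$ be either $\widehat B_{tot}$ or $\widehat B_{\widehat C}$. Then, as $n\to+\infty$, $$\sqrt n\left(\mathrm{vec}(S_{\widehat B})-\mathrm{vec}(\Sigma)\right)\ \xrightarrow{\ \mathcal L\ }\ \mathcal N\left(0,\mathrm{CR}(\Sigma,B^* )\right),$$ where $\mathrm{CR}(\Sigma,B^* )$ is the (constrained, one-observation) Cramér–Rao bound of $\mathrm{vec}(\Sigma)$ in the model $\{\mathcal N(0,\Sigma):\ \Sigma \text{ symmetric positive definite with } B(\Sigma)=B^*\}$.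
   Context: Partitions: $[1:p]=\{1,\dots,p\}$, $\mathcal{P}_p$ is the set of partitions of $[1:p]$. $(i,j)\in B$ means $i,j$ belong to the same element of $B$. For a symmetric matrix $\Gamma=(\gamma_{ij})$, $\Gamma_B$ has entries $\gamma_{ij}$ if $(i,j)\in B$ and $0$ otherwise; $B(\Gamma)$ is the unique finest partition $B$ with $\Gamma=\Gamma_B$. $\overline{X}=\frac1n\sum_{l=1}^nX^{(l)}$, $S=(s_{ij})=\frac1n\sum_{l=1}^n(X^{(l)}-\overline X)(X^{(l)}-\overline X)^T$, $\widehat C_{ij}=s_{ij}/\sqrt{s_{ii}s_{jj}}$. For $\Gamma$ symmetric positive definite, $l_\Gamma=\frac1p(\log|\Gamma|+\mathrm{Tr}(\Gamma^{-1}S))$, where $|\Gamma|$ is the determinant; $\mathrm{pen}(\Gamma)=\sum_{k=1}^Kp_k^2$ if $B(\Gamma)=\{B_1,\dots,B_K\}$, $|B_k|=p_k$; $\Phi(\Gamma)=l_\Gamma+\kappa\,\mathrm{pen}(\Gamma)$; $\Psi(B)=\Phi(S_B)$. $\widehat B_{tot}=\operatorname{argmin}_{B\in\mathcal P_p}\Psi(B)$. For $\lambda\in[0,1]$, $B_\lambda=B((\widehat C_{ij}\mathbf 1_{|\widehat C_{ij}|>\lambda})_{i,j\le p})$, and $\widehat B_{\widehat C}=\operatorname{argmin}\{\Psi(B):B=B_\lambda,\ \lambda\in A_{\widehat C}\}$ with $A_{\widehat C}=\{|\widehat C_{ij}|:1\le i<j\le p\}$. Cramér–Rao bound: $\mathrm{vec}:\mathbb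 R^{p\times p}\to\mathbb R^{p^2}$ is column vectorization, $(\mathrm{vec}(M))_{p(j-1)+i}=M_{ij}$; rows and columns of $p^2\times p^2$ matrices are indexed by pairs $ij$ corresponding to $(j-1)p+i$. When a parameter $\theta\in\mathbb R^d$ is restricted to a linear subspace $V$ of dimension $q$, the Cramér–Rao bound is $U(U^TJU)^{-1}U^T$, where the columns of $U\in\mathbb R^{d\times q}$ form an orthonormal basis of $V$ and $J$ is the unconstrained Fisher information matrix. Here $\theta=\mathrm{vec}(\Sigma)$, $d=p^2$, $V=\{\mathrm{vec}(\Gamma):\Gamma=\Gamma^T,\ \Gamma_{B^*}=\Gamma\}$, and for one observation $J_{ij,kl}=\frac12\gamma_{li}\gamma_{jk}$, where here $(\gamma_{ij})$ denotes the entries of $\Sigma^{-1}$. $\mathrm{CR}(\Sigma,B^* )$ is this $p^2\times p^2$ matrix.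
   Formalization: For B̂_Ĉ the case p=2 with B*={{1,2}} is excluded: strict thresholding then leaves only the candidate {{1},{2}}, so S_B̂ is diagonal while σ_12≠0 and the claim fails; for p=1 the set A_Ĉ is empty and B̂_Ĉ is undefined, so only B̂_tot is covered. *)

theory Defs
  imports "HOL-Probability.Probability" "HOL-Library.Disjoint_Sets"
begin

section \<open>Partitions and block-diagonal matrices\<close>

definition same_block :: "'p set set \<Rightarrow> 'p \<Rightarrow> 'p \<Rightarrow> bool" where
  "same_block B i j \<longleftrightarrow> (\<exists>b\<in>B. i \<in> b \<and> j \<in> b)"

definition block_restrict :: "'p set set \<Rightarrow> real^'p^'p \<Rightarrow> real^'p^'p" where
  "block_restrict B \<Gamma> = (\<chi> i j. if same_block B i j then \<Gamma> $ i $ j else 0)"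

(* The finest partition exists and is unique for symmetric \<Gamma>: its blocks are the connected
   components of the graph with edges {(i, j). \<Gamma> $ i $ j \<noteq> 0}. *)
definition finest_partition :: "real^'p^'p \<Rightarrow> 'p::finite set set" where
  "finest_partition \<Gamma> =
     (THE B. partition_on UNIV B \<and> block_restrict B \<Gamma> = \<Gamma> \<and>
        (\<forall>B'. partition_on UNIV B' \<and> block_restrict B' \<Gamma> = \<Gamma> \<longrightarrow> refines UNIV B B'))"

definition sym_pos_def :: "real^'p^'p \<Rightarrow> bool" where
  "sym_pos_def \<Gamma> \<longleftrightarrow> transpose \<Gamma> = \<Gamma> \<and> (\<forall>x. x \<noteq> 0 \<longrightarrow> x \<bullet> (\<Gamma> *v x) > 0)"

section \<open>Penalised likelihood\<close>

definition sample_mean :: "(nat \<Rightarrow> real^'p) \<Rightarrow> nat \<Rightarrow> real^'p" where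
  "sample_mean x n = (1 / real n) *\<^sub>R (\<Sum>l=1..n. x l)"

definition sample_cov :: "(nat \<Rightarrow> real^'p) \<Rightarrow> nat \<Rightarrow> real^'p^'p" where
  "sample_cov x n =
     (\<chi> i j. (1 / real n) *
        (\<Sum>l=1..n. (x l - sample_mean x n) $ i * (x l - sample_mean x n) $ j))"

definition neg_loglik :: "real^'p^'p \<Rightarrow> real^'p^'p \<Rightarrow> real" where
  "neg_loglik S \<Gamma> = (1 / real CARD('p)) * (ln (det \<Gamma>) + trace (matrix_inv \<Gamma> ** S))"

definition pen :: "real^'p^'p \<Rightarrow> real" where
  "pen \<Gamma> = (\<Sum>b\<in>finest_partition \<Gamma>. (real (card b))\<^sup>2)"

definition penalised :: "real \<Rightarrow> real^'p^'p \<Rightarrow> real^'p^'p \<Rightarrow> real" where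
  "penalised \<kappa> S \<Gamma> = neg_loglik S \<Gamma> + \<kappa> * pen \<Gamma>"

definition criterion :: "real \<Rightarrow> real^'p^'p \<Rightarrow> 'p set set \<Rightarrow> real" where
  "criterion \<kappa> S B = penalised \<kappa> S (block_restrict B S)"

section \<open>The two estimators of the block structure\<close>

(* The estimators are stated as "B is a minimiser", so nothing depends on how ties are broken. *)
definition is_B_tot :: "real \<Rightarrow> real^'p^'p \<Rightarrow> 'p set set \<Rightarrow> bool" where
  "is_B_tot \<kappa> S B \<longleftrightarrow> is_arg_min (criterion \<kappa> S) (partition_on UNIV) B"

definition corr_matrix :: "real^'p^'p \<Rightarrow> real^'p^'p" where
  "corr_matrix S = (\<chi> i j. S $ i $ j / sqrt (S $ i $ i * S $ j $ j))"

definition threshold_partition :: "real^'p^'p \<Rightarrow> real \<Rightarrow> 'p set set" where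
  "threshold_partition C t = finest_partition (\<chi> i j. if \<bar>C $ i $ j\<bar> > t then C $ i $ j else 0)"

(* Pairs i \<noteq> j instead of i < j (no order on the index type): the same set, as C is symmetric. *)
definition corr_levels :: "real^'p^'p \<Rightarrow> real set" where
  "corr_levels C = {\<bar>C $ i $ j\<bar> | i j. i \<noteq> j}"

(* Pitfall: thresholding is strict, so for CARD('p) = 2 the only candidate is the partition into
   singletons (if S is positive definite), and for CARD('p) = 1 there is no candidate at all. *)
definition is_B_corr :: "real \<Rightarrow> real^'p^'p \<Rightarrow> 'p set set \<Rightarrow> bool" where
  "is_B_corr \<kappa> S B \<longleftrightarrow>
     is_arg_min (criterion \<kappa> S)
       (\<lambda>B'. B' \<in> threshold_partition (corr_matrix S) ` corr_levels (corr_matrix S)) B"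

section \<open>Gaussian laws and convergence in law on \<open>real^'d\<close>\<close>

definition std_normal_vec :: "(real^'d) measure" where
  "std_normal_vec = density lborel (\<lambda>z. ennreal (\<Prod>i\<in>UNIV. std_normal_density (z $ i)))"

(* The law of m + A Z with Z standard normal and A A^T = Q; it depends on m and Q only.
   A may be singular, so degenerate Gaussian laws are covered. *)
definition is_normal_law :: "real^'d \<Rightarrow> real^'d^'d \<Rightarrow> (real^'d) measure \<Rightarrow> bool" where
  "is_normal_law m Q N \<longleftrightarrow>
     (\<exists>A :: real^'d^'d. A ** transpose A = Q \<and>
        N = distr std_normal_vec borel (\<lambda>z. m + A *v z))"

definition converges_in_law :: "(nat \<Rightarrow> (real^'d) measure) \<Rightarrow> (real^'d) measure \<Rightarrow> bool" where
  "converges_in_law L N \<longleftrightarrow>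
     (\<forall>f :: real^'d \<Rightarrow> real. continuous_on UNIV f \<and> bounded (range f) \<longrightarrow>
        (\<lambda>n. integral\<^sup>L (L n) f) \<longlonglongrightarrow> integral\<^sup>L N f)"

section \<open>Constrained Cramer-Rao bound\<close>

(* The pair (i, j) plays the role of the position p (j - 1) + i in R^(p^2). *)
definition vectorize :: "real^'p^'p \<Rightarrow> real^('p \<times> 'p)" where
  "vectorize M = (\<chi> ij. M $ fst ij $ snd ij)"

definition is_orthonormal_basis :: "(nat \<Rightarrow> real^'d) \<Rightarrow> (real^'d) set \<Rightarrow> bool" where
  "is_orthonormal_basis u V \<longleftrightarrow>
     (\<forall>a<dim V. \<forall>b<dim V. u a \<bullet> u b = (if a = b then 1 else 0)) \<and>
     span (u ` {..<dim V}) = V"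

definition is_matrix_inverse :: "nat \<Rightarrow> (nat \<Rightarrow> nat \<Rightarrow> real) \<Rightarrow> (nat \<Rightarrow> nat \<Rightarrow> real) \<Rightarrow> bool" where
  "is_matrix_inverse q G W \<longleftrightarrow>
     (\<forall>a<q. \<forall>b<q. (\<Sum>c<q. G a c * W c b) = (if a = b then 1 else 0) \<and>
                  (\<Sum>c<q. W a c * G c b) = (if a = b then 1 else 0))"

(* U (U^T J U)^(-1) U^T, where U has the columns u 0, ..., u (q - 1), an orthonormal basis of V.
   As q = dim V depends on V, q-indexed objects are functions on {..<q}; the (a, b) entry of
   U^T J U is u a \<bullet> (J *v u b). The result does not depend on the choice of u. *)
definition cramer_rao_bound :: "real^'d^'d \<Rightarrow> (real^'d) set \<Rightarrow> real^'d^'d" where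
  "cramer_rao_bound J V =
     (let q = dim V;
          u = (SOME u. is_orthonormal_basis u V);
          W = (SOME W. is_matrix_inverse q (\<lambda>a b. u a \<bullet> (J *v u b)) W)
      in \<chi> i j. \<Sum>a<q. \<Sum>b<q. u a $ i * W a b * u b $ j)"

(* J_(ij,kl) = (1/2) \<gamma>_(li) \<gamma>_(jk), where (\<gamma>_(ij)) is the inverse of Sig. *)
definition fisher_information :: "real^'p^'p \<Rightarrow> real^('p \<times> 'p)^('p \<times> 'p)" where
  "fisher_information Sig =
     (let \<gamma> = matrix_inv Sig
      in \<chi> ij kl. 1 / 2 * \<gamma> $ snd kl $ fst ij * \<gamma> $ snd ij $ fst kl)"

definition block_space :: "'p::finite set set \<Rightarrow> (real^('p \<times> 'p)) set" where
  "block_space B = {vectorize \<Gamma> | \<Gamma>. transpose \<Gamma> = \<Gamma> \<and> block_restrict B \<Gamma> = \<Gamma>}"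

definition CR :: "real^'p^'p \<Rightarrow> 'p::finite set set \<Rightarrow> real^('p \<times> 'p)^('p \<times> 'p)" where
  "CR Sig B = cramer_rao_bound (fisher_information Sig) (block_space B)"

end

theory Submission
  imports Defs
begin

text \<open>
The limit law is that of the estimator which knows the true blocks, because, with probability
tending to one, the selected partition restricts the empirical covariance \<open>S\<close> in the same way as the true one. Three facts carry the proof.

\<^item> \<^bold>\<open>Selection.\<close> For a partition \<open>B\<close> the likelihood part of the criterion is \<open>ln det S\<^sub>B\<close> up to a constant:
  the inverse of \<open>S\<^sub>B\<close> lives on the blocks of \<open>B\<close>, so the trace term equals the dimension
  (\<open>trace_inverse_block_restrict\<close>). If \<open>B\<close> cuts a block of the covariance \<open>Sig\<close>, then
  \<open>ln det Sig\<^sub>B > ln det Sig\<close> by Gibbs' inequality (\<open>log_det_gibbs\<close>), a gap that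
  neither the vanishing penalty nor the sampling error can close. If \<open>B\<close> strictly coarsens the true
  partition, the likelihood gains at most a multiple of \<open>\<bar>S - Sig\<bar>\<close>, which is of order
  \<open>n\<^sup>-\<^sup>1\<^sup>/\<^sup>2\<close>, while the penalty grows by at least \<open>\<kappa>\<close>, of order \<open>n\<^sup>-\<^sup>\<delta>\<close> with \<open>\<delta> < 1/2\<close>
  (\<open>criterion_selects_blocks\<close>).

\<^item> \<^bold>\<open>Candidates.\<close> For the correlation-based estimator the true partition must also be among
  the thresholded graphs. If some entry of \<open>Sig\<close> vanishes, the largest spurious correlation is a suitable
  threshold. If none vanishes, the smallest level deletes the edges of least correlation; this is harmless
  when there are at least three indices and only one such edge. Ties are excluded with
  probability tending to one, because a polynomial in \<open>S\<close> that vanishes at ties either stays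
  away from 0 or has, after normalisation, a non-degenerate Gaussian limit (\<open>tie_event_tendsto_0\<close>).

\<^item> \<^bold>\<open>Limit law.\<close> \<open>sqrt n (S - Sig)\<close>, restricted to the true blocks, is a normalised sum of independent
  centred products plus a remainder of order \<open>n\<^sup>-\<^sup>1\<^sup>/\<^sup>2\<close>. The one-dimensional central limit theorem
  gives the limits of the characteristic functions, a multivariate continuity theorem turns them into
  convergence in law (\<open>converges_in_law_of_char\<close>), and Isserlis' formula gives the covariance. That
  covariance maps into the space of block-diagonal symmetric matrices and inverts the Fisher information
  there, which characterises the constrained Cramer--Rao bound (\<open>cramer_rao_bound_eqI\<close>).
\<close>

section \<open>Partitions and supports of matrices\<close>

lemma same_block_refl: "partition_on UNIV B \<Longrightarrow> same_block B i i"
  unfolding same_block_def partition_on_def by blast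

lemma same_block_sym: "same_block B i j \<longleftrightarrow> same_block B j i"
  unfolding same_block_def by blast

lemma same_block_trans:
  "partition_on UNIV B \<Longrightarrow> same_block B i j \<Longrightarrow> same_block B j k \<Longrightarrow> same_block B i k"
  unfolding same_block_def partition_on_def disjoint_def by blast

lemma same_block_iff_mem:
  "partition_on UNIV B \<Longrightarrow> b \<in> B \<Longrightarrow> i \<in> b \<Longrightarrow> same_block B i j \<longleftrightarrow> j \<in> b"
  unfolding same_block_def partition_on_def disjoint_def by blast

lemma refines_iff_same_block:
  assumes "partition_on UNIV B" "partition_on UNIV B'"
  shows "refines UNIV B B' \<longleftrightarrow> (\<forall>i j. same_block B i j \<longrightarrow> same_block B' i j)"
proof
  assume "refines UNIV B B'"
  then show "\<forall>i j. same_block B i j \<longrightarrow> same_block B' i j"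
    unfolding refines_def same_block_def by (meson subsetD)
next
  assume r: "\<forall>i j. same_block B i j \<longrightarrow> same_block B' i j"
  have "\<exists>Y\<in>B'. X \<subseteq> Y" if X: "X \<in> B" for X
  proof -
    obtain i where i: "i \<in> X"
      using X assms(1) unfolding partition_on_def by (metis all_not_in_conv)
    obtain Y where Y: "Y \<in> B'" "i \<in> Y"
      using assms(2) unfolding partition_on_def by blast
    have "X \<subseteq> Y"
      using r same_block_iff_mem[OF assms(1) X i] same_block_iff_mem[OF assms(2) Y] by blast
    then show ?thesis using Y by blast
  qed
  then show "refines UNIV B B'" using assms unfolding refines_def by blast
qed

lemma block_restrict_nth [simp]:
  "block_restrict B \<Gamma> $ i $ j = (if same_block B i j then \<Gamma> $ i $ j else 0)"
  by (simp add: block_restrict_def)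

lemma block_restrict_eq_iff:
  "block_restrict B \<Gamma> = \<Gamma> \<longleftrightarrow> (\<forall>i j. \<Gamma> $ i $ j \<noteq> 0 \<longrightarrow> same_block B i j)"
  by (auto simp: vec_eq_iff)

lemma transpose_block_restrict:
  "transpose \<Gamma> = \<Gamma> \<Longrightarrow> transpose (block_restrict B \<Gamma>) = block_restrict B \<Gamma>"
  by (simp add: vec_eq_iff transpose_def same_block_sym)

lemma partition_on_trivial: "partition_on UNIV {UNIV :: 'p set}"
  by (rule partition_on_space) simp

lemma same_block_trivial [simp]: "same_block {UNIV} i j"
  by (simp add: same_block_def)

lemma block_restrict_trivial [simp]: "block_restrict {UNIV} \<Gamma> = \<Gamma>"
  by (simp add: block_restrict_eq_iff)

text \<open>The blocks are the connected components of the graph whose edges are the nonzero entries: a partition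
  that leaves the matrix unchanged contains every edge, hence every path.\<close>

lemma finest_partition_exists:
  fixes \<Gamma> :: "real^'p^'p"
  shows "\<exists>!B. partition_on UNIV B \<and> block_restrict B \<Gamma> = \<Gamma> \<and>
        (\<forall>B'. partition_on UNIV B' \<and> block_restrict B' \<Gamma> = \<Gamma> \<longrightarrow> refines UNIV B B')"
proof (rule ex_ex1I)
  define E where "E = {(i, j). \<Gamma> $ i $ j \<noteq> 0 \<or> \<Gamma> $ j $ i \<noteq> 0}"
  define B where "B = UNIV // (E\<^sup>*)"
  have "sym E" unfolding E_def sym_def by auto
  then have eq: "equiv UNIV (E\<^sup>*)"
    by (simp add: equiv_def refl_rtrancl sym_rtrancl trans_rtrancl)
  have p: "partition_on UNIV B" unfolding B_def by (rule partition_on_quotient[OF eq])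
  have sb: "same_block B i j \<longleftrightarrow> (i, j) \<in> E\<^sup>*" for i j
  proof
    assume "same_block B i j"
    then obtain x where "(x, i) \<in> E\<^sup>*" "(x, j) \<in> E\<^sup>*"
      unfolding B_def same_block_def quotient_def by auto
    then show "(i, j) \<in> E\<^sup>*" using eq by (meson equivE symD transD)
  next
    assume ij: "(i, j) \<in> E\<^sup>*"
    have "E\<^sup>* `` {i} \<in> B" unfolding B_def by (rule quotientI) simp
    then show "same_block B i j" using ij unfolding same_block_def by blast
  qed
  have "block_restrict B \<Gamma> = \<Gamma>"
    unfolding block_restrict_eq_iff sb by (auto simp: E_def)
  moreover have "refines UNIV B B'" if B': "partition_on UNIV B'" "block_restrict B' \<Gamma> = \<Gamma>" for B'
  proof -
    have "same_block B' i j" if "(i, j) \<in> E\<^sup>*" for i j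
      using that
    proof (induction rule: rtrancl_induct)
      case base
      then show ?case by (rule same_block_refl[OF B'(1)])
    next
      case (step y z)
      have "same_block B' y z"
        proof -
        have "\<Gamma> $ y $ z \<noteq> 0 \<or> \<Gamma> $ z $ y \<noteq> 0" using step(2) unfolding E_def by simp
        then show ?thesis using B'(2) same_block_sym[of B' y z] unfolding block_restrict_eq_iff by metis
      qed
      then show ?case using step(3) same_block_trans[OF B'(1)] by blast
    qed
    then show ?thesis using p B'(1) sb by (simp add: refines_iff_same_block)
  qed
  ultimately show "\<exists>B. partition_on UNIV B \<and> block_restrict B \<Gamma> = \<Gamma> \<and>
        (\<forall>B'. partition_on UNIV B' \<and> block_restrict B' \<Gamma> = \<Gamma> \<longrightarrow> refines UNIV B B')"
    using p by blast
qed (meson refines_asym)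

lemmas finest_partition_all = theI'[OF finest_partition_exists, folded finest_partition_def]

lemma partition_on_finest: "partition_on UNIV (finest_partition \<Gamma>)"
  and block_restrict_finest: "block_restrict (finest_partition \<Gamma>) \<Gamma> = \<Gamma>"
  and finest_refines: "partition_on UNIV B \<Longrightarrow> block_restrict B \<Gamma> = \<Gamma> \<Longrightarrow> refines UNIV (finest_partition \<Gamma>) B"
  using finest_partition_all[of \<Gamma>] by blast+

lemma finest_same_block:
  assumes "partition_on UNIV B" "block_restrict B \<Gamma> = \<Gamma>" "same_block (finest_partition \<Gamma>) i j"
  shows "same_block B i j"
  using finest_refines[OF assms(1,2)] assms(3)
  by (simp add: refines_iff_same_block[OF partition_on_finest assms(1)])

text \<open>An index always shares a block with itself, so only the off-diagonal entries matter.\<close>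

lemma finest_partition_support:
  assumes "\<And>i j. i \<noteq> j \<Longrightarrow> \<Gamma> $ i $ j \<noteq> 0 \<longleftrightarrow> \<Delta> $ i $ j \<noteq> 0"
  shows "finest_partition \<Gamma> = finest_partition \<Delta>"
proof -
  have "block_restrict B \<Gamma> = \<Gamma> \<longleftrightarrow> block_restrict B \<Delta> = \<Delta>" if "partition_on UNIV B" for B
    unfolding block_restrict_eq_iff using assms same_block_refl[OF that] by metis
  then show ?thesis unfolding finest_partition_def by (metis (no_types, lifting))
qed

text \<open>The penalty counts the pairs of indices that share a block; this makes its strict
  monotonicity under coarsening evident.\<close>

lemma sum_card_squared_eq_pairs:
  fixes B :: "'p::finite set set"
  assumes "partition_on UNIV B"
  shows "(\<Sum>b\<in>B. (real (card b))\<^sup>2) = real (card {(i, j). same_block B i j})"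
proof -
  have eq: "{(i, j). same_block B i j} = (\<Union>b\<in>B. b \<times> b)"
    unfolding same_block_def by auto
  have "card (\<Union>b\<in>B. b \<times> b) = (\<Sum>b\<in>B. card (b \<times> b))"
  proof (rule card_UN_disjoint)
    show "\<forall>i\<in>B. \<forall>j\<in>B. i \<noteq> j \<longrightarrow> i \<times> i \<inter> j \<times> j = {}"
      using assms unfolding partition_on_def disjoint_def by fast
  qed auto
  then show ?thesis unfolding eq by (simp add: power2_eq_square)
qed

section \<open>Positive definite matrices: simultaneous diagonalisation and Gibbs' inequality\<close>

lemma symmetric_dot: "transpose G = G \<Longrightarrow> x \<bullet> (G *v y) = y \<bullet> (G *v (x :: real^'n))"
  by (metis dot_lmul_matrix inner_commute transpose_matrix_vector)

text \<open>First-order condition at a maximum: near 0 a quadratic term cannot compensate a linear one.\<close>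

lemma quadratic_le_imp_zero:
  assumes "\<And>t::real. 2 * t * a \<le> t\<^sup>2 * c"
  shows "a = 0"
proof (rule ccontr)
  assume a: "a \<noteq> 0"
  have p: "\<bar>c\<bar> + 1 > 0" by simp
  have "2 * (a / (\<bar>c\<bar> + 1)) * a \<le> (a / (\<bar>c\<bar> + 1))\<^sup>2 * c" by (rule assms)
  then have "(2 * (a / (\<bar>c\<bar> + 1)) * a) * (\<bar>c\<bar> + 1)\<^sup>2 \<le> ((a / (\<bar>c\<bar> + 1))\<^sup>2 * c) * (\<bar>c\<bar> + 1)\<^sup>2"
    by (rule mult_right_mono) simp
  moreover have "(2 * (a / (\<bar>c\<bar> + 1)) * a) * (\<bar>c\<bar> + 1)\<^sup>2 = a\<^sup>2 * (2 * (\<bar>c\<bar> + 1))"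
    using p by (simp add: field_simps power2_eq_square)
  moreover have "((a / (\<bar>c\<bar> + 1))\<^sup>2 * c) * (\<bar>c\<bar> + 1)\<^sup>2 = a\<^sup>2 * c"
    using p by (simp add: power_divide)
  ultimately have "a\<^sup>2 * (2 * (\<bar>c\<bar> + 1)) \<le> a\<^sup>2 * c" by simp
  moreover have "a\<^sup>2 * c < a\<^sup>2 * (2 * (\<bar>c\<bar> + 1))" using a by (intro mult_strict_left_mono) auto
  ultimately show False by linarith
qed

text \<open>One step of the diagonalisation: maximising the Rayleigh quotient of \<open>S\<close> with respect to \<open>G\<close>
  on a non-trivial subspace gives a vector whose \<open>G\<close>-orthogonal complement in the subspace
  is also \<open>S\<close>-orthogonal to it.\<close>

lemma rayleigh_maximiser:
  fixes G S :: "real^'n^'n"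
  assumes G: "sym_pos_def G" and S: "transpose S = S"
    and W: "subspace W" "W \<noteq> {0}"
  obtains v where "v \<in> W" "v \<bullet> (G *v v) = 1"
    "\<And>x. x \<in> W \<Longrightarrow> v \<bullet> (G *v x) = 0 \<Longrightarrow> v \<bullet> (S *v x) = 0"
proof -
  have Gs: "transpose G = G" and Gp: "\<And>x. x \<noteq> 0 \<Longrightarrow> x \<bullet> (G *v x) > 0"
    using G unfolding sym_pos_def_def by auto
  define q where "q y = y \<bullet> (S *v y) / (y \<bullet> (G *v y))" for y
  obtain w where w: "w \<in> W" "w \<noteq> 0" using W subspace_0 by blast
  have "w /\<^sub>R norm w \<in> W" using W(1) w(1) by (simp add: subspace_scale)
  then have ne: "W \<inter> sphere 0 1 \<noteq> {}" using w(2) by (auto simp: disjoint_iff intro!: exI[of _ "w /\<^sub>R norm w"])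
  have cpt: "compact (W \<inter> sphere 0 1)" using closed_subspace[OF W(1)] by (simp add: closed_Int_compact)
  have "x \<bullet> (G *v x) \<noteq> 0" if "x \<in> W \<inter> sphere 0 1" for x using Gp[of x] that by fastforce
  then have cont: "continuous_on (W \<inter> sphere 0 1) q"
    unfolding q_def
    by (intro continuous_intros linear_continuous_on_compose[OF continuous_on_id] ) blast
  obtain y where y: "y \<in> W \<inter> sphere 0 1" and ymax: "\<And>z. z \<in> W \<inter> sphere 0 1 \<Longrightarrow> q z \<le> q y"
    using continuous_attains_sup[OF cpt ne cont] by blast
  have y0: "y \<noteq> 0" using y by auto
  define m where "m = q y"
  have le: "z \<bullet> (S *v z) \<le> m * (z \<bullet> (G *v z))" if z: "z \<in> W" for z
  proof (cases "z = 0")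
    case False
    have "z /\<^sub>R norm z \<in> W \<inter> sphere 0 1"
      using z False W(1) by (simp add: subspace_scale)
    then have "q (z /\<^sub>R norm z) \<le> m" unfolding m_def by (rule ymax)
    moreover have "q (z /\<^sub>R norm z) = q z"
      unfolding q_def using False by (simp add: matrix_vector_mult_scaleR)
    ultimately show ?thesis using Gp[OF False] unfolding q_def by (simp add: divide_le_eq)
  qed simp
  define c where "c = y \<bullet> (G *v y)"
  have c: "c > 0" using Gp[OF y0] c_def by simp
  define v where "v = y /\<^sub>R sqrt c"
  have vW: "v \<in> W" using y W(1) unfolding v_def by (simp add: subspace_scale)
  have vG: "v \<bullet> (G *v v) = 1"
    using c unfolding v_def by (simp add: matrix_vector_mult_scaleR c_def[symmetric] field_simps)
  have vS: "v \<bullet> (S *v v) = m"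
    using c unfolding v_def m_def q_def
    by (simp add: matrix_vector_mult_scaleR c_def[symmetric] field_simps)
  have "v \<bullet> (S *v x) = 0" if x: "x \<in> W" "v \<bullet> (G *v x) = 0" for x
  proof (rule quadratic_le_imp_zero)
    fix t :: real
    have "v + t *\<^sub>R x \<in> W" using vW x(1) W(1) by (simp add: subspace_add subspace_scale)
    from le[OF this]
    have "m + 2 * t * (v \<bullet> (S *v x)) + t\<^sup>2 * (x \<bullet> (S *v x)) \<le> m * (1 + t\<^sup>2 * (x \<bullet> (G *v x)))"
      using vG vS x(2) symmetric_dot[OF Gs, of x v] symmetric_dot[OF S, of x v]
      by (simp add: matrix_vector_right_distrib matrix_vector_mult_scaleR inner_add_left inner_add_right
          power2_eq_square algebra_simps)
    then show "2 * t * (v \<bullet> (S *v x)) \<le> t\<^sup>2 * (m * (x \<bullet> (G *v x)) - x \<bullet> (S *v x))"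
      by (simp add: algebra_simps)
  qed
  then show thesis using that vW vG by blast
qed

text \<open>The third clause is the invariant that makes the induction work: the \<open>G\<close>-orthogonal complement of the
  vectors found so far is also \<open>S\<close>-orthogonal to them, so each new vector found there extends both orthogonality relations.\<close>

lemma simultaneous_orthogonal_sequence:
  fixes G S :: "real^'n^'n"
  assumes G: "sym_pos_def G" and S: "transpose S = S" and "k \<le> CARD('n)"
  shows "\<exists>u :: nat \<Rightarrow> real^'n.
    (\<forall>a<k. \<forall>b<k. u a \<bullet> (G *v u b) = (if a = b then 1 else 0)) \<and>
    (\<forall>a<k. \<forall>b<k. a \<noteq> b \<longrightarrow> u a \<bullet> (S *v u b) = 0) \<and>
    (\<forall>x. (\<forall>b<k. u b \<bullet> (G *v x) = 0) \<longrightarrow> (\<forall>a<k. u a \<bullet> (S *v x) = 0))"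
  using assms(3)
proof (induction k)
  case (Suc k)
  have Gs: "transpose G = G" using G unfolding sym_pos_def_def by auto
  obtain u :: "nat \<Rightarrow> real^'n" where
    u1': "\<forall>a<k. \<forall>b<k. u a \<bullet> (G *v u b) = (if a = b then 1 else 0)" and
    u2': "\<forall>a<k. \<forall>b<k. a \<noteq> b \<longrightarrow> u a \<bullet> (S *v u b) = 0" and
    u3': "\<forall>x. (\<forall>b<k. u b \<bullet> (G *v x) = 0) \<longrightarrow> (\<forall>a<k. u a \<bullet> (S *v x) = 0)"
    using Suc.IH[OF Suc_leD[OF Suc.prems]] by (elim exE conjE) (rule that, assumption+)
  have
    u1: "\<And>a b. a < k \<Longrightarrow> b < k \<Longrightarrow> u a \<bullet> (G *v u b) = (if a = b then 1 else 0)" and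
    u2: "\<And>a b. a < k \<Longrightarrow> b < k \<Longrightarrow> a \<noteq> b \<Longrightarrow> u a \<bullet> (S *v u b) = 0" and
    u3: "\<And>x a. (\<And>b. b < k \<Longrightarrow> u b \<bullet> (G *v x) = 0) \<Longrightarrow> a < k \<Longrightarrow> u a \<bullet> (S *v x) = 0"
    using u1' u2' u3' by simp_all
  define W where "W = {x. \<forall>b<k. u b \<bullet> (G *v x) = 0}"
  have sub: "subspace W" unfolding W_def
    by (auto simp: subspace_def matrix_vector_right_distrib matrix_vector_mult_scaleR inner_add_right)
  define T where "T = (\<lambda>b. G *v u b) ` {..<k}"
  have "dim T \<le> card T" by (rule dim_le_card') (simp add: T_def)
  also have "\<dots> \<le> k" unfolding T_def by (metis card_image_le card_lessThan finite_lessThan)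
  finally have "dim T < DIM(real^'n)" using Suc.prems by simp
  then obtain w where w: "w \<noteq> 0" "\<And>y. y \<in> span T \<Longrightarrow> orthogonal w y"
    by (rule orthogonal_to_subspace_exists) blast
  have "u b \<bullet> (G *v w) = 0" if "b < k" for b
  proof -
    have "w \<bullet> (G *v u b) = 0"
      using w(2)[OF span_base, of "G *v u b"] that unfolding T_def orthogonal_def by auto
    then show ?thesis using symmetric_dot[OF Gs, of w "u b"] by simp
  qed
  then have "W \<noteq> {0}" using w(1) unfolding W_def by auto
  then obtain v where v: "v \<in> W" "v \<bullet> (G *v v) = 1"
    and vx: "\<And>x. x \<in> W \<Longrightarrow> v \<bullet> (G *v x) = 0 \<Longrightarrow> v \<bullet> (S *v x) = 0"
    using rayleigh_maximiser[OF G S sub] by blast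
  have vu: "u b \<bullet> (G *v v) = 0" "v \<bullet> (G *v u b) = 0" if "b < k" for b
    using v(1) that symmetric_dot[OF Gs, of v "u b"] unfolding W_def by auto
  have vS: "u b \<bullet> (S *v v) = 0" "v \<bullet> (S *v u b) = 0" if "b < k" for b
    using u3[OF vu(1) that] symmetric_dot[OF S, of v "u b"] by auto
  let ?u = "u(k := v)"
  have "\<forall>a<Suc k. \<forall>b<Suc k. ?u a \<bullet> (G *v ?u b) = (if a = b then 1 else 0)"
    using u1 vu v(2) by (auto simp: less_Suc_eq)
  moreover have "\<forall>a<Suc k. \<forall>b<Suc k. a \<noteq> b \<longrightarrow> ?u a \<bullet> (S *v ?u b) = 0"
    using u2 vS by (auto simp: less_Suc_eq)
  moreover have "?u a \<bullet> (S *v x) = 0" if x: "\<forall>b<Suc k. ?u b \<bullet> (G *v x) = 0" and a: "a < Suc k" for x a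
  proof -
    have x1: "u b \<bullet> (G *v x) = 0" if "b < k" for b
      using x[rule_format, of b] that by auto
    have "v \<bullet> (G *v x) = 0" using x[rule_format, of k] by simp
    then show ?thesis using vx[of x] u3[OF x1] x1 a unfolding W_def by (auto simp: less_Suc_eq)
  qed
  ultimately show ?case by (intro exI[of _ ?u]) blast
qed simp

lemma congruence_nth:
  fixes L M :: "real^'n^'n"
  shows "(L ** M ** transpose L) $ i $ j = (L $ i) \<bullet> (M *v (L $ j))"
proof -
  have "(L ** M ** transpose L) $ i $ j = (\<Sum>k\<in>UNIV. \<Sum>l\<in>UNIV. L $ i $ l * M $ l $ k * L $ j $ k)"
    by (simp add: matrix_matrix_mult_def transpose_def sum_distrib_right)
  also have "\<dots> = (\<Sum>l\<in>UNIV. \<Sum>k\<in>UNIV. L $ i $ l * M $ l $ k * L $ j $ k)"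
    by (rule sum.swap)
  also have "\<dots> = (L $ i) \<bullet> (M *v (L $ j))"
    by (simp add: inner_vec_def matrix_vector_mult_def sum_distrib_left mult.assoc)
  finally show ?thesis .
qed

theorem simultaneous_diagonalisation:
  fixes G S :: "real^'n^'n"
  assumes G: "sym_pos_def G" and S: "transpose S = S"
  obtains L :: "real^'n^'n"
  where "L ** G ** transpose L = mat 1" "\<And>i j. i \<noteq> j \<Longrightarrow> (L ** S ** transpose L) $ i $ j = 0"
proof -
  obtain u :: "nat \<Rightarrow> real^'n" where
    u1: "\<And>a b. a < CARD('n) \<Longrightarrow> b < CARD('n) \<Longrightarrow> u a \<bullet> (G *v u b) = (if a = b then 1 else 0)" and
    u2: "\<And>a b. a < CARD('n) \<Longrightarrow> b < CARD('n) \<Longrightarrow> a \<noteq> b \<Longrightarrow> u a \<bullet> (S *v u b) = 0"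
    using simultaneous_orthogonal_sequence[OF G S order_refl] by metis
  obtain h :: "'n \<Rightarrow> nat" where h: "bij_betw h UNIV {0..<CARD('n)}"
    using ex_bij_betw_finite_nat[OF finite_class.finite_UNIV] by blast
  have hl: "h i < CARD('n)" for i using h by (auto simp: bij_betw_def)
  have hi: "h i = h j \<longleftrightarrow> i = j" for i j using h by (auto simp: bij_betw_def inj_on_def)
  define L :: "real^'n^'n" where "L = (\<chi> i. u (h i))"
  show thesis
    by (rule that[of L]) (auto simp: vec_eq_iff congruence_nth L_def u1 u2 hl hi mat_def)
qed

lemma matrix_mul_cancel:
  fixes A B :: "real^'n^'n"
  shows "A ** B = mat 1 \<Longrightarrow> matrix_inv A = B"
proof -
  assume AB: "A ** B = mat 1"
  then have BA: "B ** A = mat 1" by (simp add: matrix_left_right_inverse)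
  have "A ** matrix_inv A = mat 1 \<and> matrix_inv A ** A = mat 1"
    unfolding matrix_inv_def by (rule someI[of _ B]) (use AB BA in simp)
  then show "matrix_inv A = B"
    by (metis BA matrix_mul_assoc matrix_mul_lid matrix_mul_rid)
qed

lemma matrix_inv_mult:
  fixes A :: "real^'n^'n"
  assumes "det A \<noteq> 0"
  shows "A ** matrix_inv A = mat 1" "matrix_inv A ** A = mat 1"
proof -
  obtain B where "A ** B = mat 1" using assms invertible_det_nz unfolding invertible_def by blast
  then show "A ** matrix_inv A = mat 1" "matrix_inv A ** A = mat 1"
    using matrix_mul_cancel[of A B] matrix_left_right_inverse[of A B] by auto
qed

lemma sym_pos_def_det_pos:
  fixes G :: "real^'n^'n"
  assumes "sym_pos_def G"
  shows "det G > 0"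
proof -
  have "transpose G = G" using assms unfolding sym_pos_def_def by auto
  then obtain L :: "real^'n^'n" where L: "L ** G ** transpose L = mat 1"
    using simultaneous_diagonalisation[OF assms] by blast
  have "(det L)\<^sup>2 * det G = 1"
    using arg_cong[OF L, of det] by (simp add: det_mul power2_eq_square mult_ac)
  then show ?thesis using mult_nonneg_nonpos[OF zero_le_power2[of "det L"], of "det G"] by linarith
qed

text \<open>Gibbs' inequality for centred Gaussian laws, i.e. positivity of the Kullback--Leibler divergence:
  in coordinates that diagonalise both matrices it is \<open>ln x \<le> x - 1\<close>.\<close>

theorem log_det_gibbs:
  fixes G S :: "real^'n^'n"
  assumes G: "sym_pos_def G" and S: "sym_pos_def S" and ne: "S \<noteq> G"
  shows "ln (det S) + CARD('n) < ln (det G) + trace (matrix_inv G ** S)"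
proof -
  have Ss: "transpose S = S" using S unfolding sym_pos_def_def by auto
  obtain L :: "real^'n^'n" where L: "L ** G ** transpose L = mat 1"
    and D: "\<And>i j. i \<noteq> j \<Longrightarrow> (L ** S ** transpose L) $ i $ j = 0"
    using simultaneous_diagonalisation[OF G Ss] by blast
  define d where "d i = (L ** S ** transpose L) $ i $ i" for i
  have dG: "(det L)\<^sup>2 * det G = 1"
    using arg_cong[OF L, of det] by (simp add: det_mul power2_eq_square mult_ac)
  have dS: "(det L)\<^sup>2 * det S = (\<Prod>i\<in>UNIV. d i)"
    unfolding d_def using det_diagonal[OF D] by (simp add: det_mul power2_eq_square mult_ac)
  have L0: "L $ i \<noteq> 0" for i
  proof
    assume "L $ i = 0"
    then have "(L ** G ** transpose L) $ i $ i = 0" by (simp add: congruence_nth)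
    then show False by (simp add: L mat_def)
  qed
  have dpos: "d i > 0" for i
    using S L0 unfolding d_def congruence_nth sym_pos_def_def by blast
  have inv: "matrix_inv G = transpose L ** L"
  proof (rule matrix_mul_cancel)
    have "L ** (G ** transpose L) = mat 1" using L by (simp add: matrix_mul_assoc)
    then have "(G ** transpose L) ** L = mat 1" by (simp add: matrix_left_right_inverse)
    then show "G ** (transpose L ** L) = mat 1" by (simp add: matrix_mul_assoc)
  qed
  have tr: "trace (matrix_inv G ** S) = (\<Sum>i\<in>UNIV. d i)"
  proof -
    have "trace (matrix_inv G ** S) = trace (transpose L ** (L ** S))"
      unfolding inv by (simp add: matrix_mul_assoc)
    also have "\<dots> = trace (L ** S ** transpose L)" by (rule trace_mul_sym)
    finally show ?thesis by (simp add: trace_def d_def)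
  qed
  have "\<exists>i. d i \<noteq> 1"
  proof (rule ccontr)
    assume "\<not> (\<exists>i. d i \<noteq> 1)"
    then have eq: "L ** S ** transpose L = L ** G ** transpose L"
      unfolding L using D by (simp add: vec_eq_iff mat_def d_def)
    have "det L \<noteq> 0" using dG by auto
    then have i: "invertible L" "invertible (transpose L)"
      by (simp_all add: invertible_det_nz)
    obtain L1 where L1: "L1 ** L = mat 1" using i(1) unfolding invertible_def by blast
    obtain L2 where L2: "transpose L ** L2 = mat 1" using i(2) unfolding invertible_def by blast
    have "L1 ** (L ** S ** transpose L) ** L2 = S" for S
      by (metis L1 L2 matrix_mul_assoc matrix_mul_lid matrix_mul_rid)
    then show False using eq ne by metis
  qed
  then obtain i0 where i0: "d i0 \<noteq> 1" by blast
  have "(\<Sum>i\<in>UNIV. ln (d i)) < (\<Sum>i\<in>UNIV. d i - 1)"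
  proof (rule sum_strict_mono_ex1)
    show "\<forall>i\<in>UNIV. ln (d i) \<le> d i - 1" using dpos ln_le_minus_one by blast
    have "ln (d i0) \<noteq> d i0 - 1" using ln_eq_minus_one[OF dpos] i0 by blast
    then show "\<exists>i\<in>UNIV. ln (d i) < d i - 1" using ln_le_minus_one[OF dpos] by (metis UNIV_I less_eq_real_def)
  qed simp
  moreover have "(\<Sum>i\<in>UNIV. ln (d i)) = ln (\<Prod>i\<in>UNIV. d i)"
    using ln_prod[of UNIV d] dpos by (simp add: less_imp_neq[symmetric])
  moreover have "ln (\<Prod>i\<in>UNIV. d i) = ln (det S) - ln (det G)"
  proof -
    have "(det L)\<^sup>2 = 1 / det G" using dG sym_pos_def_det_pos[OF G] by (simp add: field_simps)
    then have "(\<Prod>i\<in>UNIV. d i) = det S / det G" using dS by simp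
    then show ?thesis using sym_pos_def_det_pos[OF G] sym_pos_def_det_pos[OF S] by (simp add: ln_div)
  qed
  ultimately show ?thesis unfolding tr by (simp add: sum_subtractf)
qed

section \<open>Block restriction of positive definite matrices\<close>

lemma sum_blocks_indicator:
  fixes B :: "'p::finite set set"
  assumes "partition_on UNIV B"
  shows "(\<Sum>b\<in>B. if i \<in> b \<and> j \<in> b then x else 0) = (if same_block B i j then x else (0::real))"
proof -
  obtain b0 where b0: "b0 \<in> B" "i \<in> b0"
    using assms unfolding partition_on_def by blast
  have "(i \<in> b \<and> j \<in> b) \<longleftrightarrow> (b = b0 \<and> same_block B i j)" if "b \<in> B" for b
  proof
    assume *: "i \<in> b \<and> j \<in> b"
    then have "b \<inter> b0 \<noteq> {}" using b0 by blast
    then have "b = b0" using that b0 assms unfolding partition_on_def disjoint_def by metis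
    then show "b = b0 \<and> same_block B i j" using * same_block_iff_mem[OF assms b0] by simp
  qed (use b0 same_block_iff_mem[OF assms b0] in auto)
  then have "(\<Sum>b\<in>B. if i \<in> b \<and> j \<in> b then x else 0) = (\<Sum>b\<in>B. if b = b0 then (if same_block B i j then x else 0) else 0)"
    by (intro sum.cong) auto
  then show ?thesis using b0 by simp
qed

text \<open>The quadratic form of a block-restricted matrix is the sum over the blocks of the original form at the
  vector cut down to the block.\<close>

lemma sym_pos_def_block_restrict:
  fixes S :: "real^'p^'p"
  assumes S: "sym_pos_def S" and B: "partition_on UNIV B"
  shows "sym_pos_def (block_restrict B S)"
proof -
  define r where "r x b = (\<chi> i. if i \<in> b then x $ i else 0)" for x :: "real^'p" and b
  have eq: "x \<bullet> (block_restrict B S *v x) = (\<Sum>b\<in>B. r x b \<bullet> (S *v r x b))" for x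
  proof -
    have "(\<Sum>b\<in>B. r x b \<bullet> (S *v r x b)) =
      (\<Sum>b\<in>B. \<Sum>i\<in>UNIV. \<Sum>j\<in>UNIV. if i \<in> b \<and> j \<in> b then x $ i * (S $ i $ j * x $ j) else 0)"
      unfolding r_def inner_vec_def matrix_vector_mult_def
      by (intro sum.cong refl) (simp add: sum_distrib_left, auto intro!: sum.cong)
    also have "\<dots> = (\<Sum>i\<in>UNIV. \<Sum>j\<in>UNIV. \<Sum>b\<in>B. if i \<in> b \<and> j \<in> b then x $ i * (S $ i $ j * x $ j) else 0)"
      by (subst sum.swap, intro sum.cong refl, rule sum.swap)
    also have "\<dots> = x \<bullet> (block_restrict B S *v x)"
      unfolding sum_blocks_indicator[OF B] inner_vec_def matrix_vector_mult_def
      by (intro sum.cong refl) (simp add: sum_distrib_left, auto intro!: sum.cong)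
    finally show ?thesis by simp
  qed
  have "x \<bullet> (block_restrict B S *v x) > 0" if x: "x \<noteq> 0" for x
    unfolding eq
  proof -
    obtain i where i: "x $ i \<noteq> 0" using x by (auto simp: vec_eq_iff)
    obtain b where b: "b \<in> B" "i \<in> b" using B unfolding partition_on_def by blast
    have "r x b $ i \<noteq> 0" using i b by (simp add: r_def)
    then have "r x b \<noteq> 0" by (metis zero_index)
    then have "r x b \<bullet> (S *v r x b) > 0" using S unfolding sym_pos_def_def by blast
    moreover have "r x c \<bullet> (S *v r x c) \<ge> 0" for c
      using S unfolding sym_pos_def_def by (cases "r x c = 0") (auto simp: less_imp_le)
    ultimately show "0 < (\<Sum>b\<in>B. r x b \<bullet> (S *v r x b))"
      using b(1) by (intro sum_pos2[of B b]) auto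
  qed
  then show ?thesis using S transpose_block_restrict unfolding sym_pos_def_def by blast
qed

lemma block_restrict_mult:
  assumes B: "partition_on UNIV B"
  shows "block_restrict B \<Gamma> ** block_restrict B N = block_restrict B (block_restrict B \<Gamma> ** N)"
proof -
  have "block_restrict B \<Gamma> $ i $ k * block_restrict B N $ k $ j =
      (if same_block B i j then block_restrict B \<Gamma> $ i $ k * N $ k $ j else 0)" for i j k
    using same_block_trans[OF B, of i k j] same_block_trans[OF B, of k i j] same_block_sym[of B i k]
    by auto
  then show ?thesis by (simp add: vec_eq_iff matrix_matrix_mult_def)
qed

lemma block_restrict_mat1: "partition_on UNIV B \<Longrightarrow> block_restrict B (mat 1) = mat 1"
  by (auto simp: vec_eq_iff mat_def same_block_refl)

text \<open>For the Gaussian likelihood of a block-restricted empirical covariance only the determinant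
  matters: the trace term equals the dimension, because the inverse is supported on the same blocks.\<close>

lemma trace_inverse_block_restrict:
  fixes S :: "real^'p^'p"
  assumes B: "partition_on UNIV B" and d: "det (block_restrict B S) \<noteq> 0"
  shows "trace (matrix_inv (block_restrict B S) ** S) = CARD('p)"
proof -
  let ?G = "block_restrict B S"
  let ?N = "matrix_inv ?G"
  have inv: "?G ** ?N = mat 1" "?N ** ?G = mat 1"
    using matrix_inv_mult[OF d] by auto
  have "?G ** block_restrict B ?N = mat 1"
    by (simp add: block_restrict_mult[OF B] inv block_restrict_mat1[OF B])
  then have N: "block_restrict B ?N = ?N" by (metis matrix_mul_cancel)
  have "?N $ i $ j * S $ j $ i = ?N $ i $ j * ?G $ j $ i" for i j
    using N unfolding block_restrict_eq_iff using same_block_sym[of B i j] by auto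
  then have "trace (?N ** S) = trace (?N ** ?G)"
    unfolding trace_def matrix_matrix_mult_def by (simp only: vec_lambda_beta)
  then show ?thesis by (simp add: inv trace_I)
qed

section \<open>Selection of the block structure\<close>

lemma norm_matrix_le_sum_entries:
  fixes M :: "real^'n^'m"
  shows "norm M \<le> (\<Sum>i\<in>UNIV. \<Sum>j\<in>UNIV. \<bar>M $ i $ j\<bar>)"
proof -
  have "norm M \<le> (\<Sum>i\<in>UNIV. norm (M $ i))" by (simp add: norm_vec_def L2_set_le_sum)
  also have "\<dots> \<le> (\<Sum>i\<in>UNIV. \<Sum>j\<in>UNIV. \<bar>M $ i $ j\<bar>)" by (intro sum_mono norm_le_l1_cart)
  finally show ?thesis .
qed

lemma norm_matrix_le_of_entries:
  fixes M :: "real^'n^'n"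
  assumes "\<And>i j. \<bar>M $ i $ j\<bar> \<le> e"
  shows "norm M \<le> (real CARD('n))\<^sup>2 * e"
proof -
  have "norm M \<le> (\<Sum>i\<in>(UNIV::'n set). \<Sum>j\<in>(UNIV::'n set). e)"
    by (rule order_trans[OF norm_matrix_le_sum_entries]) (intro sum_mono assms)
  then show ?thesis by (simp add: power2_eq_square mult.assoc)
qed

lemma det_polynomial: "real_polynomial_function (det :: real^'n^'n \<Rightarrow> real)"
proof -
  have "real_polynomial_function (\<lambda>A :: real^'n^'n. A $ i $ j)" for i j
    by (intro real_polynomial_function.intros(1) bounded_linear_compose[OF bounded_linear_vec_nth bounded_linear_vec_nth])
  then show ?thesis
    unfolding det_def[abs_def]
    by (intro real_polynomial_function_sum real_polynomial_function.intros(4) real_polynomial_function.intros(2)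
        real_polynomial_function_prod) (auto intro: finite_permutations)
qed

text \<open>A first-order bound suffices later, since the penalty decays more slowly than the sampling error.\<close>

lemma ln_det_calm:
  fixes G :: "real^'n^'n"
  assumes "det G > 0"
  obtains C e0 where "C > 0" "e0 > 0"
    "\<And>M e. (\<And>i j. \<bar>M $ i $ j - G $ i $ j\<bar> \<le> e) \<Longrightarrow> e \<le> e0 \<Longrightarrow>
      det M > 0 \<and> \<bar>ln (det M) - ln (det G)\<bar> \<le> C * e"
proof -
  have dif: "det differentiable (at G)"
    using det_polynomial differentiable_at_real_polynomial_function by blast
  moreover have "ln differentiable (at (det G))"
    unfolding differentiable_def using DERIV_ln[OF assms, THEN has_field_derivative_imp_has_derivative] by blast
  ultimately have "(ln \<circ> det) differentiable (at G)" by (rule differentiable_chain_at)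
  then have "(\<lambda>M. ln (det M)) differentiable (at G)" by (simp add: o_def)
  then obtain f' where f': "((\<lambda>M. ln (det M)) has_derivative f') (at G)"
    unfolding differentiable_def by blast
  then obtain K where K: "\<And>x. norm (f' x) \<le> norm x * K" "K > 0"
    using bounded_linear.pos_bounded[OF has_derivative_bounded_linear[OF f']] by blast
  obtain d1 where d1: "d1 > 0"
    "\<And>M. norm (M - G) < d1 \<Longrightarrow> norm (ln (det M) - ln (det G) - f' (M - G)) \<le> 1 * norm (M - G)"
    using f' unfolding has_derivative_at_alt by (metis zero_less_one)
  have "isCont det G" using dif by (simp add: differentiable_imp_continuous_within)
  then have "eventually (\<lambda>M. det M > 0) (nhds G)"
    using order_tendstoD(1)[OF _ assms] by (simp add: isCont_def tendsto_at_iff_tendsto_nhds)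
  then obtain d2 where d2: "d2 > 0" "\<And>M. dist M G < d2 \<Longrightarrow> det M > 0"
    unfolding eventually_nhds_metric by blast
  define n where "n = (real CARD('n))\<^sup>2"
  have n: "n > 0" unfolding n_def by simp
  show thesis
  proof (rule that[of "(K + 1) * n" "min d1 d2 / (2 * n)"])
    show "(K + 1) * n > 0" "min d1 d2 / (2 * n) > 0" using K n d1 d2 by auto
    fix M :: "real^'n^'n" and e
    assume e: "\<And>i j. \<bar>M $ i $ j - G $ i $ j\<bar> \<le> e" "e \<le> min d1 d2 / (2 * n)"
    have le: "norm (M - G) \<le> n * e"
      unfolding n_def by (rule norm_matrix_le_of_entries) (simp add: e)
    have "n * e \<le> min d1 d2 / 2" using e(2) n by (simp add: field_simps)
    then have lt: "norm (M - G) < d1" "norm (M - G) < d2" using le d1(1) d2(1) by auto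
    have "\<bar>ln (det M) - ln (det G)\<bar> \<le> norm (f' (M - G)) + norm (M - G)"
      using d1(2)[OF lt(1)] by auto
    also have "\<dots> \<le> norm (M - G) * (K + 1)" using K(1)[of "M - G"] by (simp add: algebra_simps)
    also have "\<dots> \<le> n * e * (K + 1)" using le K by (intro mult_right_mono) auto
    finally show "det M > 0 \<and> \<bar>ln (det M) - ln (det G)\<bar> \<le> (K + 1) * n * e"
      using d2(2)[of M] lt(2) by (simp add: dist_norm mult_ac)
  qed
qed

lemma sym_pos_def_open:
  fixes G :: "real^'n^'n"
  assumes G: "sym_pos_def G"
  obtains e0 where "e0 > 0"
    "\<And>M. transpose M = M \<Longrightarrow> (\<And>i j. \<bar>M $ i $ j - G $ i $ j\<bar> \<le> e0) \<Longrightarrow> sym_pos_def M"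
proof -
  have cont: "continuous_on (sphere 0 1) (\<lambda>x. x \<bullet> (G *v x))"
    by (intro continuous_intros linear_continuous_on_compose[OF continuous_on_id]) auto
  have "(sphere 0 1 :: (real^'n) set) \<noteq> {}" by simp
  then obtain y :: "real^'n" where y: "norm y = 1" and ymin: "\<And>x. norm x = 1 \<Longrightarrow> y \<bullet> (G *v y) \<le> x \<bullet> (G *v x)"
    using continuous_attains_inf[OF compact_sphere _ cont] by auto
  define m where "m = y \<bullet> (G *v y)"
  have "y \<noteq> 0" using y by auto
  then have m: "m > 0" using G unfolding m_def sym_pos_def_def by blast
  define n where "n = (real CARD('n))\<^sup>2"
  have n: "n > 0" unfolding n_def by simp
  show thesis
  proof (rule that[of "m / (2 * n)"])
    show "m / (2 * n) > 0" using m n by simp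
    fix M :: "real^'n^'n"
    assume M: "transpose M = M" "\<And>i j. \<bar>M $ i $ j - G $ i $ j\<bar> \<le> m / (2 * n)"
    have "x \<bullet> (M *v x) > 0" if x: "x \<noteq> 0" for x
    proof -
      define z where "z = x /\<^sub>R norm x"
      have z: "norm z = 1" using x by (simp add: z_def)
      have "\<bar>z \<bullet> ((M - G) *v z)\<bar> \<le> (\<Sum>i\<in>UNIV. \<Sum>j\<in>UNIV. \<bar>z $ i * ((M - G) $ i $ j * z $ j)\<bar>)"
        unfolding inner_vec_def matrix_vector_mult_def
        by (simp add: sum_distrib_left) (rule order_trans[OF sum_abs], intro sum_mono sum_abs)
      also have "\<dots> \<le> (\<Sum>i\<in>(UNIV :: 'n set). \<Sum>j\<in>(UNIV :: 'n set). 1 * (m / (2 * n) * 1))"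
        unfolding abs_mult using M(2) component_le_norm_cart[of z] z m n
        by (intro sum_mono mult_mono) auto
      also have "\<dots> = m / 2" using n by (simp add: n_def power2_eq_square)
      finally have "\<bar>z \<bullet> ((M - G) *v z)\<bar> \<le> m / 2" .
      moreover have "z \<bullet> ((M - G) *v z) = z \<bullet> (M *v z) - z \<bullet> (G *v z)"
        by (simp add: matrix_vector_mult_diff_rdistrib inner_diff_right)
      moreover have "m \<le> z \<bullet> (G *v z)" unfolding m_def by (rule ymin[OF z])
      ultimately have "z \<bullet> (M *v z) > 0" using m by linarith
      moreover have "z \<bullet> (M *v z) = (x \<bullet> (M *v x)) / (norm x)\<^sup>2"
        by (simp add: z_def matrix_vector_mult_scaleR power2_eq_square divide_simps)
      ultimately show ?thesis using x by (simp add: zero_less_divide_iff)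
    qed
    then show "sym_pos_def M" using M(1) unfolding sym_pos_def_def by blast
  qed
qed

text \<open>An empirical entry may vanish by accident, so the finest partition of a restricted matrix can be finer
  than the partition used for the restriction. Both restrict the matrix in the same way.\<close>

lemma finest_block_restrict_same:
  fixes S :: "real^'p^'p"
  assumes B: "partition_on UNIV B"
  defines "B' \<equiv> finest_partition (block_restrict B S)"
  shows "block_restrict B S = block_restrict B' S"
proof -
  have idem: "block_restrict B (block_restrict B S) = block_restrict B S"
    by (simp add: vec_eq_iff)
  have r: "same_block B' i j \<Longrightarrow> same_block B i j" for i j
    unfolding B'_def by (rule finest_same_block[OF B idem])
  have "block_restrict B S = block_restrict B' (block_restrict B S)"
    unfolding B'_def by (rule block_restrict_finest[symmetric])
  also have "\<dots> = block_restrict B' S" using r by (simp add: vec_eq_iff)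
  finally show ?thesis .
qed

lemma finest_partition_eqI:
  assumes "\<And>i j. \<Gamma> $ i $ j \<noteq> 0 \<Longrightarrow> M $ i $ j \<noteq> 0"
    and "\<And>i j. M $ i $ j \<noteq> 0 \<Longrightarrow> same_block (finest_partition \<Gamma>) i j"
  shows "finest_partition M = finest_partition \<Gamma>"
proof (rule refines_asym)
  show "refines UNIV (finest_partition M) (finest_partition \<Gamma>)"
    by (rule finest_refines[OF partition_on_finest]) (use assms(2) in \<open>simp add: block_restrict_eq_iff\<close>)
  show "refines UNIV (finest_partition \<Gamma>) (finest_partition M)"
    by (rule finest_refines[OF partition_on_finest])
      (use assms(1) block_restrict_finest[of M] in \<open>auto simp: block_restrict_eq_iff\<close>)
qed

lemma criterion_eq:
  fixes S :: "real^'p^'p"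
  assumes B: "partition_on UNIV B" and d: "det (block_restrict B S) > 0"
  shows "criterion \<kappa> S B = ln (det (block_restrict B S)) / CARD('p) + 1
    + \<kappa> * card {(i, j). same_block (finest_partition (block_restrict B S)) i j}"
  using trace_inverse_block_restrict[OF B] d
  unfolding criterion_def penalised_def neg_loglik_def pen_def
    sum_card_squared_eq_pairs[OF partition_on_finest]
  by (simp add: add_divide_distrib)

text \<open>The conclusion compares the restricted matrices and not the partitions: if \<open>S\<close> has accidental zeros,
  several partitions give the same restriction and the same value of the criterion. Here \<open>e\<close> bounds the
  sampling error, and the hypothesis \<open>C * e < \<kappa>\<close> says that the penalty dominates it.\<close>

theorem criterion_selects_blocks:
  fixes Sig :: "real^'p^'p"
  assumes Sig: "sym_pos_def Sig"
  obtains C e0 where "C > 0" "e0 > 0"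
    "\<And>S e \<kappa> B. (\<And>i j. \<bar>S $ i $ j - Sig $ i $ j\<bar> \<le> e) \<Longrightarrow> e \<le> e0 \<Longrightarrow>
      C * e < \<kappa> \<Longrightarrow> \<kappa> \<le> e0 \<Longrightarrow> partition_on UNIV B \<Longrightarrow>
      criterion \<kappa> S B \<le> criterion \<kappa> S (finest_partition Sig) \<Longrightarrow>
      block_restrict B S = block_restrict (finest_partition Sig) S"
proof -
  let ?P = "{B :: 'p set set. partition_on UNIV B}"
  let ?B = "finest_partition Sig"
  define p where "p = real CARD('p)"
  have p: "p > 0" unfolding p_def by simp
  have fin: "finite ?P" by simp
  have PB: "?B \<in> ?P" by (simp add: partition_on_finest)
  have SigB: "block_restrict ?B Sig = Sig" by (rule block_restrict_finest)
  have spd: "sym_pos_def (block_restrict B Sig)" if "B \<in> ?P" for B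
    using sym_pos_def_block_restrict[OF Sig] that by simp
  let ?near = "\<lambda>B C e0. \<forall>M e. (\<forall>i j. \<bar>M $ i $ j - block_restrict B Sig $ i $ j\<bar> \<le> e) \<longrightarrow> e \<le> e0 \<longrightarrow>
      det M > 0 \<and> \<bar>ln (det M) - ln (det (block_restrict B Sig))\<bar> \<le> C * e"
  have "\<forall>B\<in>?P. \<exists>C e0. C > 0 \<and> e0 > 0 \<and> ?near B C e0"
  proof
    fix B assume "B \<in> ?P"
    from ln_det_calm[OF sym_pos_def_det_pos[OF spd[OF this]]] show "\<exists>C e0. C > 0 \<and> e0 > 0 \<and> ?near B C e0"
      by metis
  qed
  then obtain Cf ef where Cf: "\<And>B. B \<in> ?P \<Longrightarrow> Cf B > 0" and ef: "\<And>B. B \<in> ?P \<Longrightarrow> ef B > 0"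
    and near: "\<And>B. B \<in> ?P \<Longrightarrow> ?near B (Cf B) (ef B)"
    by metis
  define C0 where "C0 = Max (Cf ` ?P)"
  define e1 where "e1 = Min (ef ` ?P)"
  have C0: "Cf B \<le> C0" if "B \<in> ?P" for B unfolding C0_def using that fin by (intro Max_ge) auto
  have C0p: "C0 > 0" using Cf[OF PB] C0[OF PB] by linarith
  have e1: "e1 \<le> ef B" if "B \<in> ?P" for B unfolding e1_def using that fin by (intro Min_le) auto
  have "e1 \<in> ef ` ?P" unfolding e1_def using fin PB by (intro Min_in) auto
  then have e1p: "e1 > 0" using ef by auto
  \<comment> \<open>The least loss of likelihood over the partitions that cut a true block; the 1 keeps the set nonempty when there are none.\<close>
  define gs where "gs = insert 1 ((\<lambda>B. ln (det (block_restrict B Sig)) - ln (det Sig)) ` {B \<in> ?P. block_restrict B Sig \<noteq> Sig})"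
  define g where "g = Min gs"
  have "g \<in> gs" unfolding g_def by (intro Min_in) (auto simp: gs_def)
  moreover have "ln (det Sig) < ln (det (block_restrict B Sig))" if "B \<in> ?P" "block_restrict B Sig \<noteq> Sig" for B
    using log_det_gibbs[OF spd[OF that(1)] Sig] that
      trace_inverse_block_restrict[of B Sig] sym_pos_def_det_pos[OF spd[OF that(1)]] by simp
  ultimately have gp: "g > 0" unfolding gs_def by auto
  have gle: "g \<le> ln (det (block_restrict B Sig)) - ln (det Sig)" if "B \<in> ?P" "block_restrict B Sig \<noteq> Sig" for B
    unfolding g_def using that by (intro Min_le) (auto simp: gs_def)
  \<comment> \<open>The least absolute value of a nonzero entry of \<open>Sig\<close>: smaller deviations cannot create zeros inside the true blocks.\<close>
  define hs where "hs = insert 1 ((\<lambda>(i, j). \<bar>Sig $ i $ j\<bar>) ` {(i, j). Sig $ i $ j \<noteq> 0})"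
  define h where "h = Min hs"
  have "h \<in> hs" unfolding h_def by (intro Min_in) (auto simp: hs_def)
  then have hp: "h > 0" unfolding hs_def by auto
  have hle: "h \<le> \<bar>Sig $ i $ j\<bar>" if "Sig $ i $ j \<noteq> 0" for i j
    unfolding h_def using that by (intro Min_le) (auto simp: hs_def)
  \<comment> \<open>The last bound makes \<open>\<kappa> (1 + p\<^sup>3) < g\<close>, where the true penalty, multiplied by \<open>p\<close>, is at most \<open>p\<^sup>3\<close>.\<close>
  define e0 where "e0 = Min {e1, h / 2, g / (2 * (1 + p ^ 3))}"
  have e0p: "e0 > 0" unfolding e0_def using e1p hp gp p by (simp add: add_pos_pos)
  show thesis
  proof (rule that[of "2 * C0" e0])
    show "2 * C0 > 0" "e0 > 0" using C0p e0p by auto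
    fix S :: "real^'p^'p" and e \<kappa> :: real and B
    assume e: "\<And>i j. \<bar>S $ i $ j - Sig $ i $ j\<bar> \<le> e" "e \<le> e0"
      and \<kappa>: "2 * C0 * e < \<kappa>" "\<kappa> \<le> e0" and B: "partition_on UNIV B"
      and le: "criterion \<kappa> S B \<le> criterion \<kappa> S ?B"
    have e_nonneg: "0 \<le> e" using e(1)[of undefined undefined] by linarith
    then have \<kappa>p: "\<kappa> > 0" using \<kappa>(1) C0p mult_nonneg_nonneg[of "2 * C0" e] by linarith
    have est: "det (block_restrict A S) > 0"
      "\<bar>ln (det (block_restrict A S)) - ln (det (block_restrict A Sig))\<bar> \<le> C0 * e" if A: "A \<in> ?P" for A
    proof -
      have "\<forall>i j. \<bar>block_restrict A S $ i $ j - block_restrict A Sig $ i $ j\<bar> \<le> e"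
        using e(1) e_nonneg by auto
      moreover have "e \<le> ef A" using e(2) e1[OF A] unfolding e0_def by simp
      ultimately have "det (block_restrict A S) > 0 \<and>
        \<bar>ln (det (block_restrict A S)) - ln (det (block_restrict A Sig))\<bar> \<le> Cf A * e"
        using near[OF A] by blast
      moreover have "Cf A * e \<le> C0 * e" using C0[OF A] e_nonneg by (rule mult_right_mono)
      ultimately show "det (block_restrict A S) > 0"
        "\<bar>ln (det (block_restrict A S)) - ln (det (block_restrict A Sig))\<bar> \<le> C0 * e" by auto
    qed
    define B' where "B' = finest_partition (block_restrict B S)"
    have B'P: "B' \<in> ?P" unfolding B'_def by (simp add: partition_on_finest)
    have SB': "block_restrict B S = block_restrict B' S"
      unfolding B'_def by (rule finest_block_restrict_same[OF B])
    have fS: "finest_partition (block_restrict ?B S) = ?B"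
    proof (rule finest_partition_eqI)
      fix i j assume nz: "Sig $ i $ j \<noteq> 0"
      have "same_block ?B i j" using SigB nz unfolding block_restrict_eq_iff by blast
      moreover have "S $ i $ j \<noteq> 0"
      proof
        assume "S $ i $ j = 0"
        then have "\<bar>Sig $ i $ j\<bar> \<le> h / 2" using e(1)[of i j] e(2) unfolding e0_def by simp
        then show False using hle[OF nz] hp by simp
      qed
      ultimately show "block_restrict ?B S $ i $ j \<noteq> 0" by simp
    qed (simp split: if_splits)
    define N where "N A = real (card {(i, j). same_block A i j})" for A :: "'p set set"
    have cB: "criterion \<kappa> S B = ln (det (block_restrict B' S)) / p + 1 + \<kappa> * N B'"
      using criterion_eq[OF B, of S \<kappa>] est(1)[OF B'P] unfolding SB' N_def p_def
      by (simp add: B'_def[symmetric] SB'[symmetric])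
    have cB0: "criterion \<kappa> S ?B = ln (det (block_restrict ?B S)) / p + 1 + \<kappa> * N ?B"
      using criterion_eq[OF partition_on_finest est(1)[OF PB], of \<kappa>] unfolding N_def p_def fS by simp
    have key: "ln (det (block_restrict B' S)) + p * \<kappa> * N B' \<le> ln (det (block_restrict ?B S)) + p * \<kappa> * N ?B"
    proof -
      have "ln (det (block_restrict B' S)) / p + \<kappa> * N B' \<le> ln (det (block_restrict ?B S)) / p + \<kappa> * N ?B"
        using le unfolding cB cB0 by simp
      then have "p * (ln (det (block_restrict B' S)) / p + \<kappa> * N B') \<le> p * (ln (det (block_restrict ?B S)) / p + \<kappa> * N ?B)"
        using p by (intro mult_left_mono) auto
      then show ?thesis using p by (simp add: algebra_simps)
    qed
    have E0: "\<bar>ln (det (block_restrict ?B S)) - ln (det Sig)\<bar> \<le> C0 * e"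
      using est(2)[OF PB] unfolding SigB .
    have p1: "p \<ge> 1" unfolding p_def by (simp add: Suc_leI)
    \<comment> \<open>The partition may not cut a true block: the loss of likelihood would exceed the penalty that is saved.\<close>
    have Sig': "block_restrict B' Sig = Sig"
    proof (rule ccontr)
      assume ne: "block_restrict B' Sig \<noteq> Sig"
      have "N ?B \<le> p\<^sup>2"
      proof -
        have "card {(i, j). same_block ?B i j} \<le> card (UNIV :: ('p \<times> 'p) set)" by (intro card_mono) auto
        then show ?thesis unfolding N_def p_def by (simp add: power2_eq_square flip: of_nat_mult)
      qed
      then have "p * \<kappa> * N ?B \<le> p * \<kappa> * p\<^sup>2" using p \<kappa>p by (intro mult_left_mono) auto
      moreover have "p * \<kappa> * N B' \<ge> 0" using p \<kappa>p by (simp add: N_def)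
      moreover have "p * \<kappa> * p\<^sup>2 = \<kappa> * p ^ 3" by (simp add: power2_eq_square power3_eq_cube)
      ultimately have "g \<le> \<kappa> + \<kappa> * p ^ 3"
        using key gle[OF B'P ne] est(2)[OF B'P] E0 \<kappa>(1) unfolding abs_le_iff by linarith
      also have "\<dots> = \<kappa> * (1 + p ^ 3)" by (simp add: algebra_simps)
      also have "\<dots> \<le> g / (2 * (1 + p ^ 3)) * (1 + p ^ 3)"
        using \<kappa>(2) p unfolding e0_def by (intro mult_right_mono) auto
      also have "\<dots> = g / 2"
      proof -
        have half: "g / (2 * q) * q = g / 2" if "q > 0" for q using that by (simp add: field_simps)
        show ?thesis by (rule half) (use p in \<open>simp add: add_pos_pos\<close>)
      qed
      finally show False using gp by simp
    qed
    have sub: "same_block ?B i j \<Longrightarrow> same_block B' i j" for i j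
      using finest_same_block[OF _ Sig'] B'P by blast
    \<comment> \<open>It may not merge true blocks either: one more pair in a block costs at least \<open>\<kappa>\<close>.\<close>
    have "\<exists>i j. \<not> (same_block B' i j \<longrightarrow> same_block ?B i j) \<Longrightarrow> False"
    proof -
      assume "\<exists>i j. \<not> (same_block B' i j \<longrightarrow> same_block ?B i j)"
      then have "{(i, j). same_block ?B i j} \<subset> {(i, j). same_block B' i j}" using sub by blast
      then have "card {(i, j). same_block ?B i j} < card {(i, j). same_block B' i j}"
        by (intro psubset_card_mono) auto
      then have "N B' \<ge> N ?B + 1" unfolding N_def by linarith
      then have "p * \<kappa> * N B' \<ge> p * \<kappa> * (N ?B + 1)" using p \<kappa>p by (intro mult_left_mono) auto
      then have "p * \<kappa> \<le> 2 * C0 * e"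
        using key E0 est(2)[OF B'P] unfolding Sig' by (simp add: abs_le_iff algebra_simps)
      moreover have "1 * \<kappa> \<le> p * \<kappa>" using p1 \<kappa>p by (intro mult_right_mono) auto
      ultimately show False using \<kappa>(1) by simp
    qed
    then have "block_restrict B' S = block_restrict ?B S" using sub by (auto simp: vec_eq_iff)
    then show "block_restrict B S = block_restrict ?B S" unfolding SB' .
  qed
qed

section \<open>The candidates obtained by thresholding correlations\<close>

lemma eventually_nhds_entries:
  fixes G :: "real^'n^'n"
  assumes "eventually P (nhds G)"
  obtains e0 where "e0 > 0" "\<And>M. (\<And>i j. \<bar>M $ i $ j - G $ i $ j\<bar> \<le> e0) \<Longrightarrow> P M"
proof -
  obtain d where d: "d > 0" "\<And>M. dist M G < d \<Longrightarrow> P M"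
    using assms unfolding eventually_nhds_metric by blast
  define n where "n = (real CARD('n))\<^sup>2"
  have n: "n > 0" unfolding n_def by simp
  show thesis
  proof (rule that[of "d / (2 * n)"])
    show "d / (2 * n) > 0" using d n by simp
    fix M :: "real^'n^'n" assume e: "\<And>i j. \<bar>M $ i $ j - G $ i $ j\<bar> \<le> d / (2 * n)"
    have "norm (M - G) \<le> n * (d / (2 * n))"
      unfolding n_def by (rule norm_matrix_le_of_entries) (use e in \<open>simp add: n_def\<close>)
    then show "P M" using d n by (intro d(2)) (simp add: dist_norm)
  qed
qed

lemma sym_pos_def_diag_pos: "sym_pos_def G \<Longrightarrow> G $ i $ i > 0"
proof -
  assume "sym_pos_def G"
  moreover have "axis i 1 \<noteq> (0 :: real^'a)" by (simp add: axis_eq_0_iff)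
  ultimately have "axis i 1 \<bullet> (G *v axis i 1) > 0" unfolding sym_pos_def_def by blast
  then show ?thesis by (simp add: inner_axis' matrix_vector_mul_component inner_axis)
qed

lemma finite_corr_levels: "finite (corr_levels (C :: real^'p^'p))"
proof -
  have "corr_levels C \<subseteq> (\<lambda>(i, j). \<bar>C $ i $ j\<bar>) ` UNIV" unfolding corr_levels_def by auto
  then show ?thesis by (rule finite_subset) simp
qed

text \<open>Near \<open>Sig\<close> the empirical correlations at vanishing entries of \<open>Sig\<close> are smaller than those at the other
  entries, so the largest of the former is a level that separates the two groups.\<close>

lemma threshold_at_spurious_level:
  fixes Sig :: "real^'p^'p"
  assumes Sig: "sym_pos_def Sig" and z: "a \<noteq> b" "Sig $ a $ b = 0"
  obtains e0 where "e0 > 0"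
    "\<And>S. (\<And>i j. \<bar>S $ i $ j - Sig $ i $ j\<bar> \<le> e0) \<Longrightarrow>
      finest_partition Sig \<in> threshold_partition (corr_matrix S) ` corr_levels (corr_matrix S)"
proof -
  define c where "c i j S = \<bar>corr_matrix S $ i $ j\<bar>" for i j and S :: "real^'p^'p"
  have lim: "(c i j \<longlongrightarrow> c i j Sig) (nhds Sig)" for i j
    using sym_pos_def_diag_pos[OF Sig, of i] sym_pos_def_diag_pos[OF Sig, of j]
    unfolding c_def corr_matrix_def vec_lambda_beta
    by (intro tendsto_intros filterlim_ident) auto
  have "\<forall>\<^sub>F S in nhds Sig. (Sig $ i $ j \<noteq> 0 \<and> Sig $ k $ l = 0 \<longrightarrow> c k l S < c i j S)" for i j k l
  proof (cases "Sig $ i $ j \<noteq> 0 \<and> Sig $ k $ l = 0")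
    case True
    then have "c k l Sig < c i j Sig"
      using sym_pos_def_diag_pos[OF Sig, of i] sym_pos_def_diag_pos[OF Sig, of j]
      unfolding c_def corr_matrix_def by auto
    then have "0 < c i j Sig - c k l Sig" by simp
    from order_tendstoD(1)[OF tendsto_diff[OF lim lim] this] show ?thesis
      by eventually_elim simp
  qed auto
  then have "\<forall>\<^sub>F S in nhds Sig. \<forall>i j k l. Sig $ i $ j \<noteq> 0 \<and> Sig $ k $ l = 0 \<longrightarrow> c k l S < c i j S"
    by (intro eventually_all_finite) auto
  then obtain e0 where e0: "e0 > 0" and sep: "\<And>S i j k l. (\<And>i j. \<bar>S $ i $ j - Sig $ i $ j\<bar> \<le> e0) \<Longrightarrow>
      Sig $ i $ j \<noteq> 0 \<Longrightarrow> Sig $ k $ l = 0 \<Longrightarrow> c k l S < c i j S"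
    by (rule eventually_nhds_entries) blast
  show thesis
  proof (rule that[OF e0])
    fix S :: "real^'p^'p" assume S: "\<And>i j. \<bar>S $ i $ j - Sig $ i $ j\<bar> \<le> e0"
    define Z where "Z = (\<lambda>(k, l). c k l S) ` {(k, l). k \<noteq> l \<and> Sig $ k $ l = 0}"
    have finZ: "finite Z" and neZ: "Z \<noteq> {}" unfolding Z_def using z by auto
    define t where "t = Max Z"
    have tZ: "t \<in> Z" unfolding t_def using finZ neZ by (rule Max_in)
    then have "t \<in> corr_levels (corr_matrix S)" unfolding Z_def corr_levels_def c_def by auto
    moreover have "finest_partition Sig = threshold_partition (corr_matrix S) t"
      unfolding threshold_partition_def
    proof (rule finest_partition_support)
      fix i j :: 'p assume ij: "i \<noteq> j"
      obtain k l where kl: "Sig $ k $ l = 0" "t = c k l S" using tZ unfolding Z_def by auto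
      show "Sig $ i $ j \<noteq> 0 \<longleftrightarrow> (\<chi> i j. if \<bar>corr_matrix S $ i $ j\<bar> > t then corr_matrix S $ i $ j else 0) $ i $ j \<noteq> 0"
      proof
        assume "Sig $ i $ j \<noteq> 0"
        then have "t < c i j S" using sep[OF S _ kl(1)] kl(2) by simp
        moreover have "t \<ge> 0" unfolding kl(2) c_def by simp
        ultimately show "(\<chi> i j. if \<bar>corr_matrix S $ i $ j\<bar> > t then corr_matrix S $ i $ j else 0) $ i $ j \<noteq> 0"
          unfolding c_def by auto
      next
        assume "(\<chi> i j. if \<bar>corr_matrix S $ i $ j\<bar> > t then corr_matrix S $ i $ j else 0) $ i $ j \<noteq> 0"
        then have "c i j S > t" unfolding c_def by (auto split: if_splits)
        then have "c i j S \<notin> Z" using finZ unfolding t_def by (meson Max_ge not_le)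
        then show "Sig $ i $ j \<noteq> 0" unfolding Z_def using ij by auto
      qed
    qed
    ultimately show "finest_partition Sig \<in> threshold_partition (corr_matrix S) ` corr_levels (corr_matrix S)"
      by blast
  qed
qed

lemma finest_partition_connected:
  fixes \<Gamma> :: "real^'p^'p"
  assumes "\<And>i j. same_block (finest_partition \<Gamma>) i j"
  shows "finest_partition \<Gamma> = {UNIV}"
  by (rule refines_asym[of UNIV])
    (use assms in \<open>simp_all add: refines_iff_same_block partition_on_trivial partition_on_finest\<close>)

lemma finest_partition_full:
  fixes \<Gamma> :: "real^'p^'p"
  assumes full: "\<And>i j. i \<noteq> j \<Longrightarrow> \<Gamma> $ i $ j \<noteq> 0"
  shows "finest_partition \<Gamma> = {UNIV}"
proof (rule finest_partition_connected)
  show "same_block (finest_partition \<Gamma>) i j" for i j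
  proof (cases "i = j")
    case False
    then show ?thesis
      using block_restrict_finest[of \<Gamma>] full[OF False] unfolding block_restrict_eq_iff by blast
  qed (simp add: same_block_refl[OF partition_on_finest])
qed

text \<open>If no entry of \<open>Sig\<close> vanishes, thresholding at the smallest level removes a single edge of the
  complete graph when the absolute correlations are pairwise distinct, and with three or more vertices
  the remaining graph is connected.\<close>

lemma threshold_at_smallest_level:
  fixes Sig S :: "real^'p^'p"
  assumes full: "\<And>i j. i \<noteq> j \<Longrightarrow> Sig $ i $ j \<noteq> 0" and card: "CARD('p) \<ge> 3"
    and S: "sym_pos_def S"
    and noties: "\<And>i j k l. i \<noteq> j \<Longrightarrow> k \<noteq> l \<Longrightarrow> i \<notin> {k, l} \<Longrightarrow>
      (S $ i $ j)\<^sup>2 * S $ k $ k * S $ l $ l \<noteq> (S $ k $ l)\<^sup>2 * S $ i $ i * S $ j $ j"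
  shows "finest_partition Sig \<in> threshold_partition (corr_matrix S) ` corr_levels (corr_matrix S)"
proof -
  let ?C = "corr_matrix S"
  have ties: "\<bar>?C $ i $ j\<bar> \<noteq> \<bar>?C $ k $ l\<bar>" if ij: "i \<noteq> j" "k \<noteq> l" "i \<notin> {k, l}" for i j k l
  proof
    assume "\<bar>?C $ i $ j\<bar> = \<bar>?C $ k $ l\<bar>"
    then have "(?C $ i $ j)\<^sup>2 = (?C $ k $ l)\<^sup>2" by (metis power2_abs)
    moreover have d: "S $ i $ i > 0" "S $ j $ j > 0" "S $ k $ k > 0" "S $ l $ l > 0"
      using sym_pos_def_diag_pos[OF S] by blast+
    ultimately have "(S $ i $ j)\<^sup>2 / (S $ i $ i * S $ j $ j) = (S $ k $ l)\<^sup>2 / (S $ k $ k * S $ l $ l)"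
      unfolding corr_matrix_def by (simp add: power_divide)
    then have "(S $ i $ j)\<^sup>2 * (S $ k $ k * S $ l $ l) = (S $ k $ l)\<^sup>2 * (S $ i $ i * S $ j $ j)"
      using d by (simp add: frac_eq_eq)
    then show False using noties[OF ij] by (simp add: mult.assoc)
  qed
  have "\<not> (\<forall>i j :: 'p. i = j)"
  proof
    assume "\<forall>i j :: 'p. i = j"
    then have "(UNIV :: 'p set) \<subseteq> {undefined}" by auto
    from card_mono[OF _ this] show False using card by simp
  qed
  then have "corr_levels ?C \<noteq> {}" unfolding corr_levels_def by auto
  then have "Min (corr_levels ?C) \<in> corr_levels ?C" by (intro Min_in finite_corr_levels)
  then obtain a b where ab: "a \<noteq> b" "Min (corr_levels ?C) = \<bar>?C $ a $ b\<bar>"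
    unfolding corr_levels_def by auto
  define t where "t = \<bar>?C $ a $ b\<bar>"
  have tmem: "t \<in> corr_levels ?C" unfolding t_def corr_levels_def using ab by blast
  have tle: "t \<le> \<bar>?C $ i $ j\<bar>" if "i \<noteq> j" for i j
    unfolding t_def ab(2)[symmetric] by (rule Min_le[OF finite_corr_levels]) (use that in \<open>auto simp: corr_levels_def\<close>)
  define T where "T = (\<chi> i j. if \<bar>?C $ i $ j\<bar> > t then ?C $ i $ j else 0)"
  have Tnz: "T $ i $ j \<noteq> 0" if ij: "i \<noteq> j" "i \<notin> {a, b} \<or> j \<notin> {a, b}" for i j
  proof -
    have sym: "?C $ i $ j = ?C $ j $ i"
    proof -
      have "S $ i $ j = S $ j $ i"
      proof -
        have "transpose S = S" using S unfolding sym_pos_def_def by blast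
        from arg_cong[OF this, of "\<lambda>M. M $ j $ i"] show ?thesis by (simp add: transpose_def)
      qed
      then show ?thesis by (simp add: corr_matrix_def mult.commute)
    qed
    have "\<bar>?C $ i $ j\<bar> \<noteq> t"
      using ties[of i j a b] ties[of j i a b] ij ab(1) sym unfolding t_def by metis
    then have "\<bar>?C $ i $ j\<bar> > t" using tle[OF ij(1)] by simp
    moreover have "t \<ge> 0" unfolding t_def by simp
    ultimately show ?thesis unfolding T_def by auto
  qed
  let ?F = "finest_partition T"
  have sbT: "same_block ?F i j" if "T $ i $ j \<noteq> 0" for i j
    using block_restrict_finest[of T] that unfolding block_restrict_eq_iff by blast
  obtain k where k: "k \<notin> {a, b}"
  proof -
    have "card {a, b} < CARD('p)" using card ab(1) by simp
    then have "{a, b} \<noteq> UNIV" by (metis less_irrefl)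
    then show thesis using that by blast
  qed
  have toK: "same_block ?F i k" for i
  proof (cases "i = k")
    case False
    then show ?thesis using sbT[OF Tnz] k by blast
  qed (simp add: same_block_refl[OF partition_on_finest])
  have "same_block ?F i j" for i j
    using toK[of i] toK[of j] same_block_sym[of ?F j k] same_block_trans[OF partition_on_finest] by blast
  then have "finest_partition Sig = ?F"
    using finest_partition_full[OF full] finest_partition_connected[of T] by simp
  then have "finest_partition Sig = threshold_partition ?C t"
    unfolding T_def threshold_partition_def .
  then show ?thesis using tmem by blast
qed

section \<open>Gaussian vectors\<close>

lemma borel_measurable_vec_lambda:
  assumes "\<And>i. (\<lambda>x. f x i) \<in> borel_measurable M"
  shows "(\<lambda>x. (\<chi> i. f x i) :: real^'d) \<in> borel_measurable M"
  by (subst borel_measurable_euclidean_space) (use assms in \<open>auto simp: Basis_vec_def inner_axis\<close>)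

lemma borel_measurable_vec_nth [measurable]: "(\<lambda>x :: real^'d. x $ i) \<in> borel_measurable borel"
  by simp

text \<open>Lebesgue measure as a product measure, which makes the coordinates of a standard normal vector independent.\<close>

lemma lborel_vec_eq_PiM:
  "(lborel :: (real^'d) measure) = distr (\<Pi>\<^sub>M i\<in>UNIV. lborel) borel (\<lambda>f. \<chi> i. f i)"
proof (rule lborel_eqI)
  interpret product_sigma_finite "\<lambda>_ :: 'd. lborel :: real measure" by standard
  fix l u :: "real^'d" assume lu: "\<And>b. b \<in> Basis \<Longrightarrow> l \<bullet> b \<le> u \<bullet> b"
  have le: "l $ i \<le> u $ i" for i
    using lu[of "axis i 1"] by (simp add: inner_axis axis_in_Basis_iff)
  have meas: "(\<lambda>f. \<chi> i. f i) \<in> (\<Pi>\<^sub>M i\<in>(UNIV :: 'd set). lborel) \<rightarrow>\<^sub>M (borel :: (real^'d) measure)"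
    by (intro borel_measurable_vec_lambda) simp
  have pre: "(\<lambda>f. \<chi> i. f i) -` box l u \<inter> space (\<Pi>\<^sub>M i\<in>(UNIV :: 'd set). lborel) = (\<Pi>\<^sub>E i\<in>UNIV. {l $ i <..< u $ i})"
    by (auto simp: space_PiM mem_box_cart PiE_def Pi_def)
  have "emeasure (distr (\<Pi>\<^sub>M i\<in>UNIV. lborel) borel (\<lambda>f. \<chi> i. f i)) (box l u) = (\<Prod>i\<in>UNIV. ennreal (u $ i - l $ i))"
    using le by (simp add: emeasure_distr meas pre emeasure_PiM)
  also have "\<dots> = (\<Prod>b\<in>Basis. (u - l) \<bullet> b)"
  proof -
    have "(\<Prod>b\<in>Basis. (u - l) \<bullet> b) = (\<Prod>i\<in>UNIV. (u - l) \<bullet> axis i 1)"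
      unfolding Basis_vec_def by (simp add: prod.reindex inj_on_def axis_eq_axis UNION_singleton_eq_range)
    then show ?thesis using le by (simp add: prod_ennreal inner_axis)
  qed
  finally show "emeasure (distr (\<Pi>\<^sub>M i\<in>UNIV. lborel) borel (\<lambda>f. \<chi> i. f i)) (box l u) = (\<Prod>b\<in>Basis. (u - l) \<bullet> b)" .
qed simp

lemma measurable_vec_of_fun [measurable]:
  "(\<lambda>f. \<chi> i. f i) \<in> (\<Pi>\<^sub>M i\<in>(UNIV :: 'd::finite set). lborel) \<rightarrow>\<^sub>M (borel :: (real^'d) measure)"
  by (intro borel_measurable_vec_lambda) simp

lemma measurable_std_normal_prod [measurable]:
  "(\<lambda>z :: real^'d. \<Prod>i\<in>UNIV. std_normal_density (z $ i)) \<in> borel_measurable borel"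
  by (intro borel_measurable_prod measurable_compose[OF borel_measurable_vec_nth]) auto

lemma sets_std_normal_vec [simp, measurable_cong]: "sets std_normal_vec = sets borel"
  by (simp add: std_normal_vec_def)

lemma space_std_normal_vec [simp]: "space std_normal_vec = UNIV"
  by (simp add: std_normal_vec_def)

lemma measurable_std_normal_vec [simp]: "measurable std_normal_vec N = measurable borel N"
  by (rule measurable_cong_sets) simp_all

lemma prob_space_std_normal_vec: "prob_space (std_normal_vec :: (real^'d) measure)"
proof
  interpret product_sigma_finite "\<lambda>_ :: 'd. lborel :: real measure" by standard
  have 1: "(\<integral>\<^sup>+x. ennreal (std_normal_density x) \<partial>lborel) = 1"
    by (subst nn_integral_eq_integral) (auto simp: integral_normal_density)
  have "emeasure (std_normal_vec :: (real^'d) measure) UNIV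
      = (\<integral>\<^sup>+z. ennreal (\<Prod>i\<in>UNIV. std_normal_density (z $ i)) \<partial>(lborel :: (real^'d) measure))"
    unfolding std_normal_vec_def by (subst emeasure_density) auto
  also have "\<dots> = (\<integral>\<^sup>+f. (\<Prod>i\<in>UNIV. ennreal (std_normal_density (f i))) \<partial>(\<Pi>\<^sub>M i\<in>(UNIV :: 'd set). lborel))"
    by (subst lborel_vec_eq_PiM, subst nn_integral_distr) (auto simp: prod_ennreal)
  also have "\<dots> = 1"
    by (subst product_nn_integral_prod) (auto simp: 1)
  finally show "emeasure (std_normal_vec :: (real^'d) measure) (space std_normal_vec) = 1" by simp
qed

lemma char_std_normal_vec:
  fixes a :: "real^'d"
  shows "(CLINT z|std_normal_vec. iexp (a \<bullet> z)) = exp (- (norm a)\<^sup>2 / 2)"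
proof -
  interpret product_sigma_finite "\<lambda>_ :: 'd. lborel :: real measure" by standard
  have "(CLINT z|std_normal_vec. iexp (a \<bullet> z))
      = (CLINT z|lborel. (\<Prod>i\<in>UNIV. std_normal_density (z $ i)) *\<^sub>R iexp (a \<bullet> z))"
    unfolding std_normal_vec_def
    by (subst integral_density) (auto intro!: prod_nonneg)
  also have "\<dots> = (CLINT f|(\<Pi>\<^sub>M i\<in>(UNIV :: 'd set). lborel).
      (\<Prod>i\<in>UNIV. std_normal_density (f i)) *\<^sub>R iexp (a \<bullet> (\<chi> i. f i)))"
    by (subst lborel_vec_eq_PiM, subst integral_distr) auto
  also have "\<dots> = (CLINT f|(\<Pi>\<^sub>M i\<in>(UNIV :: 'd set). lborel).
      (\<Prod>i\<in>UNIV. std_normal_density (f i) *\<^sub>R iexp (a $ i * f i)))"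
    by (simp add: inner_vec_def scaleR_conv_of_real prod.distrib of_real_sum sum_distrib_left exp_sum)
  also have "\<dots> = (\<Prod>i\<in>UNIV. (CLINT x|lborel. std_normal_density x *\<^sub>R iexp (a $ i * x)))"
  proof (rule product_integral_prod)
    fix i :: 'd
    show "integrable lborel (\<lambda>x. std_normal_density x *\<^sub>R iexp (a $ i * x))"
      by (rule Bochner_Integration.integrable_bound[of _ std_normal_density]) (auto simp: norm_mult)
  qed simp
  also have "\<dots> = (\<Prod>i\<in>UNIV. char std_normal_distribution (a $ i))"
    unfolding char_def by (subst integral_density) auto
  also have "\<dots> = exp (- (norm a)\<^sup>2 / 2)"
    by (simp add: char_std_normal_distribution norm_vec_def L2_set_def sum_nonneg sum_divide_distrib
        flip: of_real_prod exp_sum sum_negf)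
  finally show ?thesis .
qed

text \<open>Comparing characteristic functions covers degenerate forms (\<open>a = 0\<close>) without a case distinction.\<close>

lemma distr_linear_form_std_normal_vec:
  fixes a :: "real^'d"
  shows "distr std_normal_vec borel (\<lambda>z. a \<bullet> z) = distr std_normal_distribution borel (\<lambda>u. norm a * u)"
proof (rule Levy_uniqueness)
  interpret V: prob_space "std_normal_vec :: (real^'d) measure" by (rule prob_space_std_normal_vec)
  interpret N: real_distribution std_normal_distribution by (rule real_dist_normal_dist)
  show "real_distribution (distr std_normal_vec borel (\<lambda>z. a \<bullet> z))"
    by (rule V.real_distribution_distr) simp
  show "real_distribution (distr std_normal_distribution borel (\<lambda>u. norm a * u))"
    by (rule N.real_distribution_distr) simp
  show "char (distr std_normal_vec borel (\<lambda>z. a \<bullet> z)) = char (distr std_normal_distribution borel (\<lambda>u. norm a * u))"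
  proof
    fix t :: real
    have "char (distr std_normal_vec borel (\<lambda>z. a \<bullet> z)) t = (CLINT z|std_normal_vec. iexp (t * (a \<bullet> z)))"
      unfolding char_def by (subst integral_distr) auto
    also have "\<dots> = (CLINT z|std_normal_vec. iexp ((t *\<^sub>R a) \<bullet> z))" by simp
    also have "\<dots> = exp (- (t * norm a)\<^sup>2 / 2)"
      unfolding char_std_normal_vec by (simp add: power_mult_distrib)
    also have "\<dots> = char std_normal_distribution (t * norm a)"
      by (simp add: char_std_normal_distribution)
    also have "\<dots> = char (distr std_normal_distribution borel (\<lambda>u. norm a * u)) t"
      unfolding char_def by (subst integral_distr) (auto simp: mult.assoc)
    finally show "char (distr std_normal_vec borel (\<lambda>z. a \<bullet> z)) t
        = char (distr std_normal_distribution borel (\<lambda>u. norm a * u)) t" .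
  qed
qed

lemma integrable_linear_form_power:
  fixes a :: "real^'d"
  shows "integrable std_normal_vec (\<lambda>z. (a \<bullet> z) ^ k)"
proof -
  have "integrable (distr std_normal_distribution borel (\<lambda>u. norm a * u)) (\<lambda>x. x ^ k)"
    by (subst integrable_distr_eq) (auto simp: power_mult_distrib integrable_std_normal_distribution_moment)
  then have "integrable (distr std_normal_vec borel (\<lambda>z. a \<bullet> z)) (\<lambda>x. x ^ k)"
    by (simp add: distr_linear_form_std_normal_vec)
  then show ?thesis by (subst (asm) integrable_distr_eq) auto
qed

lemma integral_linear_form_power:
  fixes a :: "real^'d"
  shows "(\<integral>z. (a \<bullet> z) ^ k \<partial>std_normal_vec) = norm a ^ k * (\<integral>x. x ^ k \<partial>std_normal_distribution)"
proof -
  have "(\<integral>z. (a \<bullet> z) ^ k \<partial>std_normal_vec) = (\<integral>x. x ^ k \<partial>distr std_normal_vec borel (\<lambda>z. a \<bullet> z))"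
    by (subst integral_distr) auto
  also have "\<dots> = (\<integral>u. (norm a * u) ^ k \<partial>std_normal_distribution)"
    unfolding distr_linear_form_std_normal_vec by (subst integral_distr) auto
  finally show ?thesis by (simp add: power_mult_distrib)
qed

lemma std_normal_distribution_moments_4:
  "(\<integral>x. x \<partial>std_normal_distribution) = 0"
  "(\<integral>x. x ^ 2 \<partial>std_normal_distribution) = 1"
  "(\<integral>x. x ^ 4 \<partial>std_normal_distribution) = 3"
  using integral_std_normal_distribution_moment_odd[of 1] std_normal_distribution_even_moments(1)[of 1]
    std_normal_distribution_even_moments(1)[of 2]
  by (simp_all add: fact_numeral)

lemma polarisation_2: "x * y = ((x + y)\<^sup>2 - (x - y)\<^sup>2) / (4::real)"
  by (simp add: power2_eq_square field_simps)

text \<open>The mixed moments of linear forms follow from the moments of a single linear form by polarisation.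
  For four factors, polarising fourth powers gives the products of two squares, and polarising these
  gives Isserlis' (Wick's) formula.\<close>

lemma linear_forms_moment_1: "(\<integral>z. a \<bullet> z \<partial>std_normal_vec) = 0"
  using integral_linear_form_power[of a 1] std_normal_distribution_moments_4(1) by simp

lemma linear_forms_moment_2:
  "integrable std_normal_vec (\<lambda>z. (a \<bullet> z) * (b \<bullet> z))"
  "(\<integral>z. (a \<bullet> z) * (b \<bullet> z) \<partial>std_normal_vec) = a \<bullet> b"
proof -
  have eq: "(a \<bullet> z) * (b \<bullet> z) = (((a + b) \<bullet> z)\<^sup>2 - ((a - b) \<bullet> z)\<^sup>2) / 4" for z
    unfolding inner_add_left inner_diff_left by (rule polarisation_2)
  show "integrable std_normal_vec (\<lambda>z. (a \<bullet> z) * (b \<bullet> z))"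
    unfolding eq by (intro integrable_divide Bochner_Integration.integrable_diff integrable_linear_form_power)
  have "(\<integral>z. (a \<bullet> z) * (b \<bullet> z) \<partial>std_normal_vec) = ((norm (a + b))\<^sup>2 - (norm (a - b))\<^sup>2) / 4"
    unfolding eq by (simp add: integrable_linear_form_power integral_linear_form_power std_normal_distribution_moments_4)
  also have "\<dots> = a \<bullet> b"
    unfolding power2_norm_eq_inner by (simp add: inner_add_left inner_add_right inner_diff_left inner_diff_right inner_commute)
  finally show "(\<integral>z. (a \<bullet> z) * (b \<bullet> z) \<partial>std_normal_vec) = a \<bullet> b" .
qed

lemma linear_forms_moment_22:
  "integrable std_normal_vec (\<lambda>z. (a \<bullet> z)\<^sup>2 * (b \<bullet> z)\<^sup>2)"
  "(\<integral>z. (a \<bullet> z)\<^sup>2 * (b \<bullet> z)\<^sup>2 \<partial>std_normal_vec) = (a \<bullet> a) * (b \<bullet> b) + 2 * (a \<bullet> b)\<^sup>2"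
proof -
  have eq: "(a \<bullet> z)\<^sup>2 * (b \<bullet> z)\<^sup>2
      = (((a + b) \<bullet> z)^4 + ((a - b) \<bullet> z)^4 - 2 * (a \<bullet> z)^4 - 2 * (b \<bullet> z)^4) / 12" for z
    unfolding inner_add_left inner_diff_left by (simp add: power4_eq_xxxx power2_eq_square algebra_simps)
  show "integrable std_normal_vec (\<lambda>z. (a \<bullet> z)\<^sup>2 * (b \<bullet> z)\<^sup>2)"
    unfolding eq by (simp add: integrable_linear_form_power)
  have norm4: "norm v ^ 4 = (v \<bullet> v)\<^sup>2" for v :: "real^'a"
    by (simp add: power2_norm_eq_inner[symmetric])
  have "(\<integral>z. (a \<bullet> z)\<^sup>2 * (b \<bullet> z)\<^sup>2 \<partial>std_normal_vec)
      = 3 * (norm (a + b)^4 + norm (a - b)^4 - 2 * norm a^4 - 2 * norm b^4) / 12"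
    unfolding eq
    by (simp add: integrable_linear_form_power integral_linear_form_power std_normal_distribution_moments_4)
  also have "\<dots> = (a \<bullet> a) * (b \<bullet> b) + 2 * (a \<bullet> b)\<^sup>2"
    unfolding norm4 inner_add_left inner_add_right inner_diff_left inner_diff_right inner_commute[of b a]
    by (simp add: power2_eq_square algebra_simps)
  finally show "(\<integral>z. (a \<bullet> z)\<^sup>2 * (b \<bullet> z)\<^sup>2 \<partial>std_normal_vec) = (a \<bullet> a) * (b \<bullet> b) + 2 * (a \<bullet> b)\<^sup>2" .
qed

lemma linear_forms_moment_4:
  "integrable std_normal_vec (\<lambda>z. (a \<bullet> z) * (b \<bullet> z) * (c \<bullet> z) * (d \<bullet> z))"
  "(\<integral>z. (a \<bullet> z) * (b \<bullet> z) * (c \<bullet> z) * (d \<bullet> z) \<partial>std_normal_vec)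
    = (a \<bullet> b) * (c \<bullet> d) + (a \<bullet> c) * (b \<bullet> d) + (a \<bullet> d) * (b \<bullet> c)"
proof -
  let ?q = "\<lambda>u v z. (u \<bullet> z)\<^sup>2 * (v \<bullet> z)\<^sup>2"
  have eq: "(a \<bullet> z) * (b \<bullet> z) * (c \<bullet> z) * (d \<bullet> z)
      = (?q (a + b) (c + d) z - ?q (a + b) (c - d) z - ?q (a - b) (c + d) z + ?q (a - b) (c - d) z) / 16" for z
    unfolding inner_add_left inner_diff_left by (simp add: power2_eq_square algebra_simps)
  show "integrable std_normal_vec (\<lambda>z. (a \<bullet> z) * (b \<bullet> z) * (c \<bullet> z) * (d \<bullet> z))"
    unfolding eq by (simp add: linear_forms_moment_22)
  let ?Q = "\<lambda>u v. (u \<bullet> u) * (v \<bullet> v) + 2 * (u \<bullet> v)\<^sup>2"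
  have "(\<integral>z. (a \<bullet> z) * (b \<bullet> z) * (c \<bullet> z) * (d \<bullet> z) \<partial>std_normal_vec)
      = (?Q (a + b) (c + d) - ?Q (a + b) (c - d) - ?Q (a - b) (c + d) + ?Q (a - b) (c - d)) / 16"
    unfolding eq by (simp add: linear_forms_moment_22)
  also have "\<dots> = (a \<bullet> b) * (c \<bullet> d) + (a \<bullet> c) * (b \<bullet> d) + (a \<bullet> d) * (b \<bullet> c)"
    unfolding inner_add_left inner_add_right inner_diff_left inner_diff_right inner_commute[of b a] inner_commute[of d c]
    by (simp add: power2_eq_square algebra_simps)
  finally show "(\<integral>z. (a \<bullet> z) * (b \<bullet> z) * (c \<bullet> z) * (d \<bullet> z) \<partial>std_normal_vec)
    = (a \<bullet> b) * (c \<bullet> d) + (a \<bullet> c) * (b \<bullet> d) + (a \<bullet> d) * (b \<bullet> c)" .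
qed

section \<open>A continuity theorem for characteristic functions of vectors\<close>

text \<open>Real trigonometric sums with arbitrary frequencies. By the product formula for cosines they form an algebra,
  and their integrals are determined by the characteristic function.\<close>

inductive_set trig_functions :: "(real^'d \<Rightarrow> real) set" where
  wave: "(\<lambda>x. c * cos (t \<bullet> x + b)) \<in> trig_functions"
| sum: "f \<in> trig_functions \<Longrightarrow> g \<in> trig_functions \<Longrightarrow> (\<lambda>x. f x + g x) \<in> trig_functions"

lemma trig_functions_const: "(\<lambda>x. c) \<in> trig_functions"
  using wave[of c 0 0] by simp

lemma trig_functions_cos: "(\<lambda>x. cos (t \<bullet> x)) \<in> trig_functions"
  using wave[of 1 t 0] by simp

lemma trig_functions_sin: "(\<lambda>x. sin (t \<bullet> x)) \<in> trig_functions"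
proof -
  have "(\<lambda>x. sin (t \<bullet> x)) = (\<lambda>x. 1 * cos (t \<bullet> x + - pi / 2))" by (simp add: cos_diff)
  then show ?thesis by (simp only: trig_functions.wave)
qed

lemma trig_functions_mult:
  assumes "f \<in> trig_functions" "g \<in> trig_functions"
  shows "(\<lambda>x. f x * g x) \<in> trig_functions"
  using assms
proof (induction arbitrary: g rule: trig_functions.induct)
  case (wave c t b)
  from wave show ?case
  proof (induction rule: trig_functions.induct)
    case (wave c' t' b')
    have "(\<lambda>x. c * cos (t \<bullet> x + b) * (c' * cos (t' \<bullet> x + b'))) =
      (\<lambda>x. (c * c' / 2) * cos ((t + t') \<bullet> x + (b + b')) + (c * c' / 2) * cos ((t - t') \<bullet> x + (b - b')))"
    proof
      fix x
      have "cos (t \<bullet> x + b) * cos (t' \<bullet> x + b')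
          = (cos ((t \<bullet> x + b) - (t' \<bullet> x + b')) + cos ((t \<bullet> x + b) + (t' \<bullet> x + b'))) / 2"
        by (rule cos_times_cos)
      moreover have "(t \<bullet> x + b) - (t' \<bullet> x + b') = (t - t') \<bullet> x + (b - b')"
        "(t \<bullet> x + b) + (t' \<bullet> x + b') = (t + t') \<bullet> x + (b + b')"
        by (simp_all add: inner_add_left inner_diff_left)
      ultimately have "cos (t \<bullet> x + b) * cos (t' \<bullet> x + b')
          = (cos ((t - t') \<bullet> x + (b - b')) + cos ((t + t') \<bullet> x + (b + b'))) / 2" by simp
      then have "c * c' * (cos (t \<bullet> x + b) * cos (t' \<bullet> x + b'))
          = c * c' * ((cos ((t - t') \<bullet> x + (b - b')) + cos ((t + t') \<bullet> x + (b + b'))) / 2)" by simp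
      then show "c * cos (t \<bullet> x + b) * (c' * cos (t' \<bullet> x + b')) =
        (c * c' / 2) * cos ((t + t') \<bullet> x + (b + b')) + (c * c' / 2) * cos ((t - t') \<bullet> x + (b - b'))"
        by (simp add: field_simps)
    qed
    then show ?case by (simp only: trig_functions.intros)
  next
    case (sum f g)
    show ?case unfolding distrib_left by (rule trig_functions.sum[OF sum.IH])
  qed
next
  case (sum f h)
  show ?case unfolding distrib_right by (rule trig_functions.sum[OF sum.IH(1)[OF sum.prems] sum.IH(2)[OF sum.prems]])
qed

lemma trig_functions_continuous: "f \<in> trig_functions \<Longrightarrow> continuous_on A f"
  by (induction rule: trig_functions.induct) (auto intro!: continuous_intros)

lemma trig_functions_integrable:
  assumes "f \<in> trig_functions" and "prob_space M" and [measurable_cong]: "sets M = sets borel"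
  shows "integrable M f"
proof -
  interpret prob_space M by fact
  from assms(1) show ?thesis
  proof (induction rule: trig_functions.induct)
    case (wave c t b)
    show ?case
      by (rule integrable_const_bound[of _ "\<bar>c\<bar>"]) (auto simp: abs_mult mult_left_le)
  qed simp
qed

lemma trig_functions_integral_tendsto:
  fixes L :: "nat \<Rightarrow> (real^'d) measure"
  assumes L: "\<And>n. prob_space (L n)" "\<And>n. sets (L n) = sets borel"
    and N: "prob_space N" "sets N = sets borel"
    and char: "\<And>t. (\<lambda>n. CLINT x|L n. iexp (t \<bullet> x)) \<longlonglongrightarrow> (CLINT x|N. iexp (t \<bullet> x))"
    and f: "f \<in> trig_functions"
  shows "(\<lambda>n. \<integral>x. f x \<partial>L n) \<longlonglongrightarrow> (\<integral>x. f x \<partial>N)"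
  using f
proof (induction rule: trig_functions.induct)
  case (wave c t b)
  have eq: "(\<integral>x. c * cos (t \<bullet> x + b) \<partial>M) = c * Re (iexp b * (CLINT x|M. iexp (t \<bullet> x)))"
    if M: "prob_space M" "sets M = sets borel" for M :: "(real^'d) measure"
  proof -
    interpret prob_space M by fact
    note [measurable_cong] = M(2)
    have "integrable M (\<lambda>x. iexp (t \<bullet> x))"
      by (rule integrable_const_bound[of _ 1]) auto
    then have "integrable M (\<lambda>x. iexp b * iexp (t \<bullet> x))" by simp
    have "iexp b * (CLINT x|M. iexp (t \<bullet> x)) = (CLINT x|M. iexp b * iexp (t \<bullet> x))" by simp
    then have "Re (iexp b * (CLINT x|M. iexp (t \<bullet> x))) = (\<integral>x. Re (iexp b * iexp (t \<bullet> x)) \<partial>M)"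
      using integral_Re[OF \<open>integrable M (\<lambda>x. iexp b * iexp (t \<bullet> x))\<close>] by simp
    also have "\<dots> = (\<integral>x. cos (t \<bullet> x + b) \<partial>M)"
      by (intro Bochner_Integration.integral_cong refl) (simp add: cis_conv_exp[symmetric] cos_add)
    finally show ?thesis by simp
  qed
  show ?case unfolding eq[OF L] eq[OF N] by (intro tendsto_intros char)
next
  case (sum f g)
  have "(\<integral>x. f x + g x \<partial>M) = (\<integral>x. f x \<partial>M) + (\<integral>x. g x \<partial>M)" if "prob_space M" "sets M = sets borel" for M
    using trig_functions_integrable[OF sum(1) that] trig_functions_integrable[OF sum(2) that] by simp
  then show ?case using L N sum.IH by (simp add: tendsto_add)
qed

text \<open>Points of \<open>[-pi, pi]\<close> with the same image on the circle coincide or are both endpoints. A function that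
  vanishes on the boundary of a cube therefore descends to the torus.\<close>

lemma same_angle:
  assumes "cos a = cos b" "sin a = sin b" "\<bar>a\<bar> \<le> pi" "\<bar>b\<bar> \<le> pi"
  shows "a = b \<or> (\<bar>a\<bar> = pi \<and> \<bar>b\<bar> = pi)"
proof (rule ccontr)
  assume *: "\<not> (a = b \<or> (\<bar>a\<bar> = pi \<and> \<bar>b\<bar> = pi))"
  have "cos \<bar>a\<bar> = cos \<bar>b\<bar>" using assms by simp
  then have ab: "\<bar>a\<bar> = \<bar>b\<bar>" using assms by (auto intro!: cos_inj_pi[of "\<bar>a\<bar>" "\<bar>b\<bar>"])
  then have "b = - a" "a \<noteq> 0" using * by auto
  then have "sin a = 0" using assms(2) by simp
  then have "sin \<bar>a\<bar> = 0" by (simp add: abs_if)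
  moreover have "0 < \<bar>a\<bar>" "\<bar>a\<bar> < pi" using \<open>a \<noteq> 0\<close> assms(3) * ab by auto
  ultimately show False using sin_gt_zero[of "\<bar>a\<bar>"] by simp
qed

lemma reduced_angle: "\<exists>b. \<bar>b\<bar> \<le> pi \<and> cos b = cos a \<and> sin b = sin a" for a :: real
proof -
  obtain t where t: "0 \<le> t" "t < 2 * pi" "cos a = cos t" "sin a = sin t"
    using sincos_total_2pi[of "cos a" "sin a"] by auto
  show ?thesis
  proof (cases "t \<le> pi")
    case True
    then show ?thesis using t by (intro exI[of _ t]) auto
  next
    case False
    then show ?thesis using t by (intro exI[of _ "t - 2 * pi"]) (auto simp: cos_diff sin_diff)
  qed
qed

text \<open>A bounded continuous function is approximated, uniformly on a large ball and boundedly outside,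
  by a trigonometric sum: cut it off, extend it periodically, and apply the Stone--Weierstrass
  theorem on the torus.\<close>

lemma trig_functions_approximate:
  fixes f :: "real^'d \<Rightarrow> real"
  assumes f: "continuous_on UNIV f" "\<And>x. \<bar>f x\<bar> \<le> K" and R: "R > 0" and e: "e > 0"
  obtains h where "h \<in> trig_functions" "\<And>x. norm x \<le> R \<Longrightarrow> \<bar>h x - f x\<bar> \<le> e" "\<And>x. \<bar>h x\<bar> \<le> K + e"
proof -
  define l where "l = R + 1"
  have l: "l > 0" using R l_def by simp
  define box where "box = cbox (\<chi> i. - l) ((\<chi> i. l) :: real^'d)"
  have box_iff: "x \<in> box \<longleftrightarrow> (\<forall>i. \<bar>x $ i\<bar> \<le> l)" for x
    unfolding box_def mem_box_cart by (auto simp: abs_le_iff minus_le_iff)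
  define E where "E x = ((\<chi> i. cos (pi * x $ i / l)), (\<chi> i. sin (pi * x $ i / l)))" for x :: "real^'d"
  define S where "S = E ` box"
  have contE: "continuous_on A E" for A
    unfolding E_def by (intro continuous_intros) (use l in auto)
  have cbox: "compact box" unfolding box_def by simp
  have cS: "compact S" unfolding S_def by (rule compact_continuous_image[OF contE cbox])
  \<comment> \<open>The cut-off is 1 on the ball of radius \<open>R\<close> and 0 on the faces of the cube.\<close>
  define g where "g x = f x * max 0 (min 1 (l - norm x))" for x
  have contg: "continuous_on A g" for A
    unfolding g_def by (intro continuous_intros continuous_on_subset[OF f(1)]) auto
  have g0: "g x = 0" if "\<bar>x $ i\<bar> = l" for x i
    using component_le_norm_cart[of x i] that unfolding g_def by simp
  have gK: "\<bar>g x\<bar> \<le> K" for x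
  proof -
    have "\<bar>g x\<bar> \<le> \<bar>f x\<bar> * 1" unfolding g_def abs_mult by (rule mult_left_mono) auto
    then show ?thesis using f(2)[of x] by simp
  qed
  have gE: "g x = g y" if xy: "x \<in> box" "y \<in> box" "E x = E y" for x y
  proof (cases "x = y")
    case False
    then obtain i where i: "x $ i \<noteq> y $ i" by (auto simp: vec_eq_iff)
    have "cos (pi * x $ i / l) = cos (pi * y $ i / l)" "sin (pi * x $ i / l) = sin (pi * y $ i / l)"
      using xy(3) unfolding E_def by (simp_all add: vec_eq_iff)
    moreover have ang: "\<bar>pi * z $ i / l\<bar> \<le> pi" if "z \<in> box" for z
    proof -
      have "pi * \<bar>z $ i\<bar> \<le> pi * l" using that by (intro mult_left_mono) (auto simp: box_iff)
      then show ?thesis using l by (simp add: abs_mult divide_le_eq)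
    qed
    ultimately have "pi * x $ i / l = pi * y $ i / l \<or> (\<bar>pi * x $ i / l\<bar> = pi \<and> \<bar>pi * y $ i / l\<bar> = pi)"
      using xy by (intro same_angle ang)
    then have "\<bar>x $ i\<bar> = l" "\<bar>y $ i\<bar> = l" using i l by (auto simp: abs_mult divide_eq_eq)
    then show ?thesis using g0 by metis
  qed simp
  \<comment> \<open>Every point, inside the cube or not, is mapped to the torus; this is the periodic extension.\<close>
  have ES: "E x \<in> S" for x
  proof -
    have "\<forall>i. \<exists>b. \<bar>b\<bar> \<le> pi \<and> cos b = cos (pi * x $ i / l) \<and> sin b = sin (pi * x $ i / l)"
      using reduced_angle by blast
    then obtain b where b: "\<And>i. \<bar>b i\<bar> \<le> pi \<and> cos (b i) = cos (pi * x $ i / l) \<and> sin (b i) = sin (pi * x $ i / l)"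
      using choice[of "\<lambda>i b. \<bar>b\<bar> \<le> pi \<and> cos b = cos (pi * x $ i / l) \<and> sin b = sin (pi * x $ i / l)"] by blast
    define y :: "real^'d" where "y = (\<chi> i. b i * l / pi)"
    have "y \<in> box" unfolding box_iff
    proof
      fix i
      have "\<bar>b i\<bar> * l \<le> pi * l" using b[of i] l by (intro mult_right_mono) auto
      then show "\<bar>y $ i\<bar> \<le> l" using l by (simp add: y_def abs_mult divide_le_eq mult.commute)
    qed
    moreover have "E y = E x" unfolding E_def y_def using b l by (simp add: vec_eq_iff)
    ultimately show ?thesis unfolding S_def by (metis imageI)
  qed
  define G where "G z = g (SOME x. x \<in> box \<and> E x = z)" for z
  have GE: "G (E x) = g x" if x: "x \<in> box" for x
  proof -
    have "(SOME y. y \<in> box \<and> E y = E x) \<in> box \<and> E (SOME y. y \<in> box \<and> E y = E x) = E x"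
      by (rule someI[of _ x]) (use x in simp)
    then show ?thesis unfolding G_def using x by (intro gE) auto
  qed
  have GK: "\<bar>G z\<bar> \<le> K" for z unfolding G_def by (rule gK)
  have contG: "continuous_on S G"
  proof -
    have cm: "continuous_map (top_of_set box) (top_of_set S) E"
      using contE by (auto simp: continuous_map_in_subtopology S_def)
    have "closed_map (top_of_set box) (top_of_set S) E"
      by (rule continuous_imp_closed_map) (use cm cbox in \<open>auto simp: Hausdorff_space_subtopology compact_space_subtopology\<close>)
    then have q: "quotient_map (top_of_set box) (top_of_set S) E"
      by (rule continuous_closed_imp_quotient_map[OF cm]) (simp add: S_def)
    have "continuous_on box (G \<circ> E)"
      using contg[of box] GE by (simp cong: continuous_on_cong_simp)
    then have "continuous_map (top_of_set S) euclidean G"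
      by (intro continuous_compose_quotient_map[OF q]) simp
    then show ?thesis by simp
  qed
  define P where "P = {F. continuous_on S F \<and> (\<lambda>x. F (E x)) \<in> trig_functions}"
  have "function_ring_on P S"
  proof
    show "\<exists>F\<in>P. F x \<noteq> F y" if xy: "x \<in> S" "y \<in> S" "x \<noteq> y" for x y
    proof -
      have c: "(\<lambda>z. fst z $ i) \<in> P" and s: "(\<lambda>z. snd z $ i) \<in> P" for i
      proof -
        have ax: "pi * x $ i / l = ((pi / l) *\<^sub>R axis i 1) \<bullet> x" for x :: "real^'d"
          by (simp add: inner_axis')
        have "(\<lambda>x. fst (E x) $ i) \<in> trig_functions" "(\<lambda>x. snd (E x) $ i) \<in> trig_functions"
          unfolding E_def fst_conv snd_conv vec_lambda_beta ax
          by (rule trig_functions_cos trig_functions_sin)+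
        then show "(\<lambda>z. fst z $ i) \<in> P" "(\<lambda>z. snd z $ i) \<in> P"
          unfolding P_def by (auto intro!: continuous_intros)
      qed
      show ?thesis using xy(3) bexI[OF _ c] bexI[OF _ s] by (auto simp: prod_eq_iff vec_eq_iff)
    qed
  qed (auto simp: P_def cS trig_functions_const intro: trig_functions.sum trig_functions_mult continuous_intros)
  then obtain F where F: "F \<in> P" "\<And>z. z \<in> S \<Longrightarrow> \<bar>G z - F z\<bar> < e"
    using function_ring_on.Stone_Weierstrass_basic[OF _ contG e] by blast
  show thesis
  proof (rule that[of "\<lambda>x. F (E x)"])
    show "(\<lambda>x. F (E x)) \<in> trig_functions" using F(1) unfolding P_def by simp
    fix x
    show "\<bar>F (E x)\<bar> \<le> K + e" using F(2)[OF ES[of x]] GK[of "E x"] by linarith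
    assume x: "norm x \<le> R"
    have "x \<in> box" unfolding box_iff
    proof
      fix i show "\<bar>x $ i\<bar> \<le> l" using component_le_norm_cart[of x i] x unfolding l_def by linarith
    qed
    then have "G (E x) = f x" using x unfolding GE[OF \<open>x \<in> box\<close>] g_def l_def by (simp add: min_def)
    then show "\<bar>F (E x) - f x\<bar> \<le> e" using F(2)[OF ES[of x]] by linarith
  qed
qed

lemma tight_single:
  fixes N :: "(real^'d) measure"
  assumes "prob_space N" and [measurable_cong]: "sets N = sets borel" and e: "e > 0"
  shows "\<exists>R. measure N {x. R < norm x} \<le> e"
proof -
  interpret prob_space N by fact
  have sp: "space N = UNIV" using sets_eq_imp_space_eq[OF assms(2)] by simp
  have "(\<lambda>n. measure N {x. real n < norm x}) \<longlonglongrightarrow> measure N (\<Inter>n. {x. real n < norm x})"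
  proof (rule finite_Lim_measure_decseq)
    show "range (\<lambda>n. {x :: real^'d. real n < norm x}) \<subseteq> sets N" by (auto simp: assms(2))
    show "decseq (\<lambda>n. {x :: real^'d. real n < norm x})"
      by (auto simp: decseq_def)
  qed
  moreover have "(\<Inter>n. {x :: real^'d. real n < norm x}) = {}"
    by (auto simp: set_eq_iff not_less intro: real_arch_simple)
  ultimately have "(\<lambda>n. measure N {x. real n < norm x}) \<longlonglongrightarrow> 0" by simp
  from order_tendstoD(2)[OF this e] show ?thesis
    by (auto simp: eventually_sequentially intro: less_imp_le)
qed

lemma integral_approx_outside_ball:
  fixes f h :: "real^'d \<Rightarrow> real"
  assumes "prob_space M" and [measurable_cong]: "sets M = sets borel"
    and [measurable]: "f \<in> borel_measurable borel" "h \<in> borel_measurable borel"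
    and bnd: "\<And>x. \<bar>f x\<bar> \<le> K" "\<And>x. \<bar>h x\<bar> \<le> K + e"
    and close: "\<And>x. norm x \<le> R \<Longrightarrow> \<bar>h x - f x\<bar> \<le> e" and e: "e > 0"
    and tail: "measure M {x. R < norm x} \<le> e"
  shows "\<bar>(\<integral>x. h x \<partial>M) - (\<integral>x. f x \<partial>M)\<bar> \<le> e + (2 * K + e) * e"
proof -
  interpret prob_space M by fact
  have sp: "space M = UNIV" using sets_eq_imp_space_eq[OF assms(2)] by simp
  have K: "K \<ge> 0" using bnd(1)[of 0] by linarith
  have if_int: "integrable M f" by (rule integrable_const_bound[of _ K]) (auto simp: bnd)
  have ih_int: "integrable M h" by (rule integrable_const_bound[of _ "K + e"]) (auto simp: bnd)
  have ms: "{x :: real^'d. R < norm x} \<in> sets M" by (simp add: assms(2))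
  have "\<bar>(\<integral>x. h x \<partial>M) - (\<integral>x. f x \<partial>M)\<bar> = \<bar>\<integral>x. h x - f x \<partial>M\<bar>"
    using if_int ih_int by simp
  also have "\<dots> \<le> (\<integral>x. \<bar>h x - f x\<bar> \<partial>M)" by (rule integral_abs_bound)
  also have "\<dots> \<le> (\<integral>x. e + (2 * K + e) * indicator {x. R < norm x} x \<partial>M)"
  proof (rule integral_mono)
    show "integrable M (\<lambda>x. \<bar>h x - f x\<bar>)" using if_int ih_int by simp
    show "integrable M (\<lambda>x. e + (2 * K + e) * indicator {x. R < norm x} x)"
      using ms by (intro Bochner_Integration.integrable_add integrable_mult_right) (auto simp: less_top[symmetric])
    fix x
    show "\<bar>h x - f x\<bar> \<le> e + (2 * K + e) * indicator {x. R < norm x} x"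
    proof (cases "norm x \<le> R")
      case False
      then show ?thesis using bnd(1)[of x] bnd(2)[of x] e by (simp add: abs_le_iff)
    qed (use close[of x] in simp)
  qed
  also have "\<dots> = e + (2 * K + e) * measure M {x. R < norm x}"
    using ms sp prob_space by (simp add: less_top[symmetric])
  also have "\<dots> \<le> e + (2 * K + e) * e"
    using tail K e by (intro add_left_mono mult_left_mono) auto
  finally show ?thesis .
qed

text \<open>Tightness reduces a bounded continuous test function to a large ball, where it is uniformly close to a
  trigonometric sum, for which convergence of characteristic functions is the claim.\<close>

theorem converges_in_law_of_char:
  fixes L :: "nat \<Rightarrow> (real^'d) measure"
  assumes L: "\<And>n. prob_space (L n)" "\<And>n. sets (L n) = sets borel"
    and N: "prob_space N" "sets N = sets borel"
    and char: "\<And>t. (\<lambda>n. CLINT x|L n. iexp (t \<bullet> x)) \<longlonglongrightarrow> (CLINT x|N. iexp (t \<bullet> x))"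
    and tight: "\<And>e. e > 0 \<Longrightarrow> \<exists>R. \<forall>n. measure (L n) {x. R < norm x} \<le> e"
  shows "converges_in_law L N"
  unfolding converges_in_law_def
proof (intro allI impI)
  fix f :: "real^'d \<Rightarrow> real"
  assume f: "continuous_on UNIV f \<and> bounded (range f)"
  then obtain K where K: "\<And>x. \<bar>f x\<bar> \<le> K" "K > 0" unfolding bounded_pos by auto
  have fm: "f \<in> borel_measurable borel" using f by (intro borel_measurable_continuous_onI) auto
  show "(\<lambda>n. integral\<^sup>L (L n) f) \<longlonglongrightarrow> integral\<^sup>L N f"
  proof (rule LIMSEQ_I)
    fix r :: real assume r: "r > 0"
    define e where "e = min 1 (r / (3 * (2 * K + 3)))"
    have e: "e > 0" "e \<le> 1" unfolding e_def using r K by auto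
    have "e + (2 * K + e) * e = e * (2 * K + 1 + e)" by (simp add: algebra_simps)
    also have "\<dots> < e * (2 * K + 3)" using e by (intro mult_strict_left_mono) auto
    also have "\<dots> \<le> (r / (3 * (2 * K + 3))) * (2 * K + 3)"
      using K by (intro mult_right_mono) (auto simp: e_def)
    also have "\<dots> = r / 3" using K by (simp add: divide_eq_eq)
    finally have small: "e + (2 * K + e) * e < r / 3" .
    obtain R1 where R1: "\<And>n. measure (L n) {x. R1 < norm x} \<le> e" using tight[OF e(1)] by blast
    obtain R2 where R2: "measure N {x. R2 < norm x} \<le> e" using tight_single[OF N e(1)] by blast
    define R where "R = max 1 (max R1 R2)"
    have tail: "measure M {x. R < norm x} \<le> e"
      if M: "prob_space M" "sets M = sets borel" and Q: "measure M {x. Q < norm x} \<le> e" "Q \<le> R"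
      for M :: "(real^'d) measure" and Q
    proof -
      interpret prob_space M by fact
      have "measure M {x. R < norm x} \<le> measure M {x. Q < norm x}"
        using Q(2) by (intro finite_measure_mono) (auto simp: M(2))
      then show ?thesis using Q(1) by simp
    qed
    obtain h where h: "h \<in> trig_functions" "\<And>x. norm x \<le> R \<Longrightarrow> \<bar>h x - f x\<bar> \<le> e" "\<And>x. \<bar>h x\<bar> \<le> K + e"
      by (rule trig_functions_approximate[of f K R e]) (use f K(1) e(1) in \<open>auto simp: R_def\<close>)
    have hm: "h \<in> borel_measurable borel"
      using trig_functions_continuous[OF h(1)] by (intro borel_measurable_continuous_onI)
    have R12: "R1 \<le> R" "R2 \<le> R" unfolding R_def by auto
    note approx = integral_approx_outside_ball[OF _ _ fm hm K(1) h(3) h(2) e(1)]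
    have aL: "\<bar>(\<integral>x. h x \<partial>L n) - (\<integral>x. f x \<partial>L n)\<bar> < r / 3" for n
      using approx[OF L(1)[of n] L(2)[of n] _ tail[OF L(1)[of n] L(2)[of n] R1[of n] R12(1)]] small by simp
    have aN: "\<bar>(\<integral>x. h x \<partial>N) - (\<integral>x. f x \<partial>N)\<bar> < r / 3"
      using approx[OF N _ tail[OF N R2 R12(2)]] small by simp
    have "(\<lambda>n. \<integral>x. h x \<partial>L n) \<longlonglongrightarrow> (\<integral>x. h x \<partial>N)"
      by (rule trig_functions_integral_tendsto[OF L N char h(1)])
    moreover have "r / 3 > 0" using r by simp
    ultimately obtain n0 where n0: "\<And>n. n \<ge> n0 \<Longrightarrow> norm ((\<integral>x. h x \<partial>L n) - (\<integral>x. h x \<partial>N)) < r / 3"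
      by (blast dest: LIMSEQ_D)
    show "\<exists>n0. \<forall>n\<ge>n0. norm ((\<integral>x. f x \<partial>L n) - (\<integral>x. f x \<partial>N)) < r"
    proof (intro exI[of _ n0] allI impI)
      fix n assume "n \<ge> n0"
      show "norm ((\<integral>x. f x \<partial>L n) - (\<integral>x. f x \<partial>N)) < r"
        using n0[OF \<open>n \<ge> n0\<close>] aL[of n] aN unfolding real_norm_def abs_less_iff by linarith
    qed
  qed
qed

section \<open>The constrained Cramer--Rao bound\<close>

lemma orthonormal_basis_exists:
  fixes V :: "(real^'d) set"
  assumes "subspace V"
  shows "\<exists>u. is_orthonormal_basis u V"
proof -
  obtain B where B: "pairwise orthogonal B" "\<And>x. x \<in> B \<Longrightarrow> norm x = 1" "independent B" "card B = dim V" "span B = V"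
    using orthonormal_basis_subspace[OF assms] by metis
  have "finite B" using B(3) by (rule independent_imp_finite)
  then obtain u where u: "bij_betw u {0..<card B} B" using ex_bij_betw_nat_finite by blast
  have "u a \<bullet> u b = (if a = b then 1 else 0)" if ab: "a < dim V" "b < dim V" for a b
  proof (cases "a = b")
    case True
    have "u a \<in> B" using u ab B(4) by (auto simp: bij_betw_def)
    from B(2)[OF this] show ?thesis using True by (simp add: norm_eq_1)
  next
    case False
    then have "u a \<noteq> u b" "u a \<in> B" "u b \<in> B" using u ab B(4) by (auto simp: bij_betw_def inj_on_def)
    then show ?thesis using B(1) False unfolding pairwise_def orthogonal_def by auto
  qed
  moreover have "u ` {..<dim V} = B" using u B(4) by (simp add: bij_betw_def lessThan_atLeast0)
  ultimately show ?thesis using B(5) unfolding is_orthonormal_basis_def by metis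
qed

lemma orthonormal_basis_expansion:
  assumes u: "is_orthonormal_basis u V" and v: "v \<in> V"
  shows "(\<Sum>a<dim V. (u a \<bullet> v) *\<^sub>R u a) = v"
proof -
  have on: "\<And>a b. a < dim V \<Longrightarrow> b < dim V \<Longrightarrow> u a \<bullet> u b = (if a = b then 1 else 0)"
    and sp: "span (u ` {..<dim V}) = V" using u unfolding is_orthonormal_basis_def by auto
  define w where "w = v - (\<Sum>a<dim V. (u a \<bullet> v) *\<^sub>R u a)"
  have "v \<in> span (u ` {..<dim V})" using v sp by simp
  then have wV: "w \<in> span (u ` {..<dim V})" unfolding w_def
    by (intro span_diff span_sum span_scale) (auto intro: span_base)
  have "u b \<bullet> w = 0" if b: "b < dim V" for b
  proof -
    have "u b \<bullet> (\<Sum>a<dim V. (u a \<bullet> v) *\<^sub>R u a) = (\<Sum>a<dim V. if a = b then u b \<bullet> v else 0)"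
      unfolding inner_sum_right by (rule sum.cong) (auto simp: on b)
    then show ?thesis using b by (simp add: w_def inner_diff_right)
  qed
  then have "orthogonal w y" if "y \<in> u ` {..<dim V}" for y
    using that by (auto simp: orthogonal_def inner_commute)
  then have "orthogonal w w" using orthogonal_to_span[OF wV, of w] by blast
  then show ?thesis by (simp add: w_def orthogonal_self)
qed

text \<open>A symmetric \<open>R\<close> with image in \<open>V\<close> that inverts \<open>J\<close> on \<open>V\<close> is the bound: with \<open>U U\<^sup>T\<close> the projection onto \<open>V\<close>,
  \<open>U\<^sup>T R U\<close> inverts \<open>U\<^sup>T J U\<close>, and \<open>U (U\<^sup>T R U) U\<^sup>T = R\<close>.\<close>

theorem cramer_rao_bound_eqI:
  fixes J R :: "real^'d^'d"
  assumes V: "subspace V" and J: "transpose J = J" and R: "transpose R = R"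
    and RV: "\<And>x. R *v x \<in> V" and RJ: "\<And>v. v \<in> V \<Longrightarrow> R *v (J *v v) = v"
  shows "cramer_rao_bound J V = R"
proof -
  define q where "q = dim V"
  define u where "u = (SOME u. is_orthonormal_basis u V)"
  have u: "is_orthonormal_basis u V"
    unfolding u_def by (rule someI_ex[OF orthonormal_basis_exists[OF V]])
  have on: "\<And>a b. a < q \<Longrightarrow> b < q \<Longrightarrow> u a \<bullet> u b = (if a = b then 1 else 0)"
    using u unfolding is_orthonormal_basis_def q_def by auto
  have uV: "u a \<in> V" if "a < q" for a
    using u that unfolding is_orthonormal_basis_def q_def by (metis imageI lessThan_iff span_base)
  note ex = orthonormal_basis_expansion[OF u, folded q_def]
  define G where "G a b = u a \<bullet> (J *v u b)" for a b
  define W0 where "W0 a b = u a \<bullet> (R *v u b)" for a b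
  have inv0: "is_matrix_inverse q G W0"
    unfolding is_matrix_inverse_def
  proof (intro allI impI conjI)
    fix a b assume ab: "a < q" "b < q"
    have "(\<Sum>c<q. G a c * W0 c b) = (\<Sum>c<q. (J *v u a) \<bullet> ((u c \<bullet> (R *v u b)) *\<^sub>R u c))"
      unfolding G_def W0_def by (intro sum.cong refl) (simp add: symmetric_dot[OF J, of "u a"] inner_commute)
    also have "\<dots> = (J *v u a) \<bullet> (R *v u b)"
      unfolding inner_sum_right[symmetric] ex[OF RV] ..
    also have "\<dots> = u b \<bullet> (R *v (J *v u a))" by (rule symmetric_dot[OF R])
    also have "\<dots> = (if a = b then 1 else 0)" using on[OF ab(2,1)] uV[OF ab(1)] by (simp add: RJ)
    finally show "(\<Sum>c<q. G a c * W0 c b) = (if a = b then 1 else 0)" .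
    have "(\<Sum>c<q. W0 a c * G c b) = (\<Sum>c<q. (J *v u b) \<bullet> ((u c \<bullet> (R *v u a)) *\<^sub>R u c))"
      unfolding G_def W0_def by (intro sum.cong refl) (simp add: symmetric_dot[OF R, of "u a"] inner_commute)
    also have "\<dots> = (J *v u b) \<bullet> (R *v u a)"
      unfolding inner_sum_right[symmetric] ex[OF RV] ..
    also have "\<dots> = u a \<bullet> (R *v (J *v u b))" by (rule symmetric_dot[OF R])
    also have "\<dots> = (if a = b then 1 else 0)" using on[OF ab] uV[OF ab(2)] by (simp add: RJ)
    finally show "(\<Sum>c<q. W0 a c * G c b) = (if a = b then 1 else 0)" .
  qed
  define W where "W = (SOME W. is_matrix_inverse q G W)"
  have inv: "is_matrix_inverse q G W" unfolding W_def by (rule someI[of _ W0]) (rule inv0)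
  have W: "W a b = W0 a b" if ab: "a < q" "b < q" for a b
  proof -
    have "W a b = (\<Sum>c<q. W a c * (if c = b then 1 else 0))" using ab by (simp add: if_distrib cong: if_cong)
    also have "\<dots> = (\<Sum>c<q. W a c * (\<Sum>d<q. G c d * W0 d b))"
      using inv0 ab unfolding is_matrix_inverse_def by (intro sum.cong refl) auto
    also have "\<dots> = (\<Sum>c<q. \<Sum>d<q. W a c * G c d * W0 d b)"
      by (simp add: sum_distrib_left mult.assoc)
    also have "\<dots> = (\<Sum>d<q. \<Sum>c<q. W a c * G c d * W0 d b)" by (rule sum.swap)
    also have "\<dots> = (\<Sum>d<q. (\<Sum>c<q. W a c * G c d) * W0 d b)" by (simp add: sum_distrib_right)
    also have "\<dots> = (\<Sum>d<q. (if a = d then 1 else 0) * W0 d b)"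
      using inv ab unfolding is_matrix_inverse_def by (intro sum.cong refl) auto
    also have "\<dots> = W0 a b" using ab by (simp add: if_distrib if_distribR cong: if_cong)
    finally show ?thesis .
  qed
  have "(\<Sum>a<q. \<Sum>b<q. u a $ i * W a b * u b $ j) = R $ i $ j" for i j
  proof -
    have rowV: "R $ i \<in> V"
    proof -
      have "R $ i = R *v axis i 1"
        using R by (simp add: matrix_vector_mult_basis column_def vec_eq_iff transpose_def)
      then show ?thesis using RV by simp
    qed
    have "(\<Sum>a<q. \<Sum>b<q. u a $ i * W a b * u b $ j) = (\<Sum>a<q. \<Sum>b<q. u a $ i * W0 a b * u b $ j)"
      using W by simp
    also have "\<dots> = (\<Sum>b<q. \<Sum>a<q. u a $ i * W0 a b * u b $ j)" by (rule sum.swap)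
    also have "\<dots> = (\<Sum>b<q. (\<Sum>a<q. (u a \<bullet> (R *v u b)) *\<^sub>R u a) $ i * u b $ j)"
      unfolding W0_def by (simp add: sum_distrib_left sum_distrib_right mult_ac)
    also have "\<dots> = (\<Sum>b<q. (R *v u b) $ i * u b $ j)" unfolding ex[OF RV] ..
    also have "\<dots> = (\<Sum>b<q. (u b \<bullet> (R $ i)) *\<^sub>R u b) $ j"
      by (simp add: matrix_vector_mul_component inner_commute)
    also have "\<dots> = R $ i $ j" unfolding ex[OF rowV] ..
    finally show ?thesis .
  qed
  then show ?thesis
    unfolding cramer_rao_bound_def Let_def q_def[symmetric] u_def[symmetric] G_def[symmetric] W_def[symmetric]
    by (simp add: vec_eq_iff)
qed

text \<open>The covariance of \<open>vec (Z Z\<^sup>T)\<close> for a centred Gaussian vector \<open>Z\<close> with covariance \<open>Sig\<close>,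
  restricted to the entries inside the blocks.\<close>

definition block_wishart_cov :: "'p::finite set set \<Rightarrow> real^'p^'p \<Rightarrow> real^('p \<times> 'p)^('p \<times> 'p)" where
  "block_wishart_cov B Sig = (\<chi> ij kl.
     if same_block B (fst ij) (snd ij) \<and> same_block B (fst kl) (snd kl)
     then Sig $ fst ij $ fst kl * Sig $ snd ij $ snd kl + Sig $ fst ij $ snd kl * Sig $ snd ij $ fst kl
     else 0)"

text \<open>It is the covariance of the block entries of \<open>A (G + G\<^sup>T) A\<^sup>T / \<surd>2\<close>, where \<open>G\<close> has independent standard
  normal entries and \<open>A A\<^sup>T = Sig\<close>; this gives an explicit square root.\<close>

definition block_wishart_root :: "'p::finite set set \<Rightarrow> real^'p^'p \<Rightarrow> real^('p \<times> 'p)^('p \<times> 'p)" where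
  "block_wishart_root B A = (\<chi> ij ab.
     if same_block B (fst ij) (snd ij)
     then (A $ fst ij $ fst ab * A $ snd ij $ snd ab + A $ snd ij $ fst ab * A $ fst ij $ snd ab) / sqrt 2
     else 0)"

lemma sum_UNIV_prod: "(\<Sum>x\<in>(UNIV :: ('a::finite \<times> 'b::finite) set). f x) = (\<Sum>i\<in>UNIV. \<Sum>j\<in>UNIV. f (i, j))"
  by (simp add: sum.cartesian_product UNIV_Times_UNIV[symmetric] del: UNIV_Times_UNIV)

lemma block_wishart_root_mult:
  fixes A :: "real^'p^'p"
  assumes A: "A ** transpose A = Sig"
  shows "block_wishart_root B A ** transpose (block_wishart_root B A) = block_wishart_cov B Sig"
proof -
  have S: "Sig $ i $ j = (\<Sum>a\<in>UNIV. A $ i $ a * A $ j $ a)" for i j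
    unfolding A[symmetric] by (simp add: matrix_matrix_mult_def transpose_def)
  have SS: "Sig $ i $ k * Sig $ j $ l = (\<Sum>a\<in>UNIV. \<Sum>b\<in>UNIV. (A $ i $ a * A $ k $ a) * (A $ j $ b * A $ l $ b))" for i j k l
    unfolding S by (rule sum_product)
  have core: "(\<Sum>a\<in>UNIV. \<Sum>b\<in>UNIV. ((A $ i $ a * A $ j $ b + A $ j $ a * A $ i $ b) / sqrt 2) *
        ((A $ k $ a * A $ l $ b + A $ l $ a * A $ k $ b) / sqrt 2))
      = Sig $ i $ k * Sig $ j $ l + Sig $ i $ l * Sig $ j $ k" for i j k l
  proof -
    have "((A $ i $ a * A $ j $ b + A $ j $ a * A $ i $ b) / sqrt 2) *
        ((A $ k $ a * A $ l $ b + A $ l $ a * A $ k $ b) / sqrt 2) =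
        ((A $ i $ a * A $ k $ a) * (A $ j $ b * A $ l $ b) + (A $ i $ a * A $ l $ a) * (A $ j $ b * A $ k $ b)
         + (A $ j $ a * A $ k $ a) * (A $ i $ b * A $ l $ b) + (A $ j $ a * A $ l $ a) * (A $ i $ b * A $ k $ b)) / 2" for a b
      by (simp add: field_simps)
    then have "(\<Sum>a\<in>UNIV. \<Sum>b\<in>UNIV. ((A $ i $ a * A $ j $ b + A $ j $ a * A $ i $ b) / sqrt 2) *
        ((A $ k $ a * A $ l $ b + A $ l $ a * A $ k $ b) / sqrt 2)) =
      (Sig $ i $ k * Sig $ j $ l + Sig $ i $ l * Sig $ j $ k + Sig $ j $ k * Sig $ i $ l + Sig $ j $ l * Sig $ i $ k) / 2"
      unfolding SS by (simp add: sum.distrib sum_divide_distrib[symmetric])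
    then show ?thesis by simp
  qed
  have "(block_wishart_root B A ** transpose (block_wishart_root B A)) $ (i, j) $ (k, l)
      = block_wishart_cov B Sig $ (i, j) $ (k, l)" for i j k l
  proof (cases "same_block B i j \<and> same_block B k l")
    case True
    then show ?thesis using core[of i j k l]
      by (simp add: matrix_matrix_mult_def transpose_def block_wishart_root_def block_wishart_cov_def sum_UNIV_prod
          del: times_divide_times_eq)
  next
    case False
    then show ?thesis
      by (auto simp: matrix_matrix_mult_def transpose_def block_wishart_root_def block_wishart_cov_def)
  qed
  then show ?thesis by (simp add: vec_eq_iff split_paired_all)
qed

lemma matrix_nth_mult3: "((A :: real^'n^'n) ** Y ** C) $ i $ j = (\<Sum>k\<in>UNIV. \<Sum>l\<in>UNIV. A $ i $ k * Y $ k $ l * C $ l $ j)"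
proof -
  have "(A ** Y ** C) $ i $ j = (\<Sum>l\<in>UNIV. \<Sum>k\<in>UNIV. A $ i $ k * Y $ k $ l * C $ l $ j)"
    by (simp add: matrix_matrix_mult_def sum_distrib_right)
  then show ?thesis by (subst sum.swap)
qed

text \<open>On symmetric matrices \<open>J\<close> acts as \<open>H \<mapsto> \<gamma> H \<gamma> / 2\<close> with \<open>\<gamma>\<close> the inverse of \<open>Sig\<close>, and the covariance as
  \<open>Y \<mapsto> 2 Sig Y Sig\<close> followed by restriction to the blocks. Entries outside the blocks do not contribute, because \<open>Sig\<close> vanishes there.\<close>

lemma block_wishart_cov_inverts:
  fixes Sig :: "real^'p^'p"
  assumes sym: "transpose Sig = Sig" and d: "det Sig \<noteq> 0"
    and B: "partition_on UNIV B" and blk: "block_restrict B Sig = Sig"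
    and v: "v \<in> block_space B"
  shows "block_wishart_cov B Sig *v (fisher_information Sig *v v) = v"
proof -
  let ?R = "block_wishart_cov B Sig" and ?J = "fisher_information Sig"
  let ?g = "matrix_inv Sig"
  have sS: "Sig $ i $ j = Sig $ j $ i" for i j
    using arg_cong[OF sym, of "\<lambda>M. M $ j $ i"] by (simp add: transpose_def)
  obtain H where v: "v = vectorize H" "transpose H = H" "block_restrict B H = H"
    using v unfolding block_space_def by auto
  have sH: "H $ i $ j = H $ j $ i" for i j
    using arg_cong[OF v(2), of "\<lambda>M. M $ j $ i"] by (simp add: transpose_def)
  define Y where "Y = ?g ** H ** ?g"
  have JH: "(?J *v v) $ (k, l) = Y $ l $ k / 2" for k l
    unfolding Y_def matrix_nth_mult3 matrix_vector_mult_def v(1)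
    by (simp add: sum_UNIV_prod fisher_information_def Let_def vectorize_def sum_divide_distrib mult_ac)
  have SYS: "Sig ** Y ** Sig = H"
  proof -
    have "Sig ** Y ** Sig = (Sig ** ?g) ** H ** (?g ** Sig)"
      unfolding Y_def by (simp add: matrix_mul_assoc)
    then show ?thesis by (simp add: matrix_inv_mult[OF d])
  qed
  have "(?R *v (?J *v v)) $ (i, j) = v $ (i, j)" for i j
  proof (cases "same_block B i j")
    case False
    then have "H $ i $ j = 0" using v(3) unfolding block_restrict_eq_iff by blast
    then show ?thesis using False
      by (simp add: matrix_vector_mult_def block_wishart_cov_def v(1) vectorize_def)
  next
    case True
    have drop: "(if same_block B k l then Sig $ i $ k * Sig $ j $ l + Sig $ i $ l * Sig $ j $ k else 0)
        = Sig $ i $ k * Sig $ j $ l + Sig $ i $ l * Sig $ j $ k" for k l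
    proof (cases "same_block B k l")
      case False
      have z: "Sig $ a $ b = 0 \<or> same_block B a b" for a b
        using blk unfolding block_restrict_eq_iff by blast
      have "\<not> (same_block B i k \<and> same_block B j l)" "\<not> (same_block B i l \<and> same_block B j k)"
        using True False same_block_sym same_block_trans[OF B] by metis+
      then have z2: "Sig $ i $ k * Sig $ j $ l = 0" "Sig $ i $ l * Sig $ j $ k = 0"
        using z by auto
      show ?thesis unfolding z2 by simp
    qed simp
    have R: "?R $ (i, j) $ (k, l) = Sig $ i $ k * Sig $ j $ l + Sig $ i $ l * Sig $ j $ k" for k l
      using drop[of k l] by (simp only: block_wishart_cov_def vec_lambda_beta fst_conv snd_conv True simp_thms)
    have t: "(Sig $ i $ k * Sig $ j $ l + Sig $ i $ l * Sig $ j $ k) * (Y $ l $ k / 2)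
        = (Sig $ j $ l * Y $ l $ k * Sig $ k $ i + Sig $ i $ l * Y $ l $ k * Sig $ k $ j) / 2" for k l
      using sS[of i k] sS[of j k] by (simp add: algebra_simps)
    have "(?R *v (?J *v v)) $ (i, j) = ((\<Sum>k\<in>UNIV. \<Sum>l\<in>UNIV. Sig $ j $ l * Y $ l $ k * Sig $ k $ i)
        + (\<Sum>k\<in>UNIV. \<Sum>l\<in>UNIV. Sig $ i $ l * Y $ l $ k * Sig $ k $ j)) / 2"
      unfolding matrix_vector_mult_def[of ?R] vec_lambda_beta sum_UNIV_prod JH R t
      by (simp only: sum_divide_distrib[symmetric] sum.distrib)
    also have "\<dots> = ((Sig ** Y ** Sig) $ j $ i + (Sig ** Y ** Sig) $ i $ j) / 2"
      unfolding matrix_nth_mult3 by (subst (1 3) sum.swap) simp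
    also have "\<dots> = v $ (i, j)" unfolding SYS v(1) using sH[of i j] by (simp add: vectorize_def)
    finally show ?thesis .
  qed
  then show ?thesis by (simp add: vec_eq_iff split_paired_all)
qed

theorem CR_eq_block_wishart_cov:
  fixes Sig :: "real^'p^'p"
  assumes sym: "transpose Sig = Sig" and d: "det Sig \<noteq> 0"
    and B: "partition_on UNIV B" and blk: "block_restrict B Sig = Sig"
  shows "CR Sig B = block_wishart_cov B Sig"
  unfolding CR_def
proof (rule cramer_rao_bound_eqI)
  let ?R = "block_wishart_cov B Sig" and ?J = "fisher_information Sig"
  have sS: "Sig $ i $ j = Sig $ j $ i" for i j
    using arg_cong[OF sym, of "\<lambda>M. M $ j $ i"] by (simp add: transpose_def)
  show "subspace (block_space B)"
    unfolding subspace_def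
  proof (intro conjI ballI allI)
    show "0 \<in> block_space B"
      unfolding block_space_def by (auto intro!: exI[of _ 0] simp: vectorize_def transpose_def vec_eq_iff)
    fix x assume "x \<in> block_space B"
    then obtain \<Gamma> where x: "x = vectorize \<Gamma>" "transpose \<Gamma> = \<Gamma>" "block_restrict B \<Gamma> = \<Gamma>"
      unfolding block_space_def by auto
    show "c *\<^sub>R x \<in> block_space B" for c
      unfolding block_space_def using x
      by (auto intro!: exI[of _ "c *\<^sub>R \<Gamma>"] simp: vectorize_def block_restrict_eq_iff transpose_def)
        (auto simp: vec_eq_iff transpose_def)
    fix y assume "y \<in> block_space B"
    then obtain \<Delta> where y: "y = vectorize \<Delta>" "transpose \<Delta> = \<Delta>" "block_restrict B \<Delta> = \<Delta>"
      unfolding block_space_def by auto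
    show "x + y \<in> block_space B"
      unfolding block_space_def using x y
      by (auto intro!: exI[of _ "\<Gamma> + \<Delta>"] simp: vectorize_def block_restrict_eq_iff transpose_def)
        (auto simp: vec_eq_iff transpose_def, metis add.right_neutral)
  qed
  show "transpose ?J = ?J"
    by (simp add: vec_eq_iff transpose_def fisher_information_def Let_def mult_ac)
  show "transpose ?R = ?R"
    using sS by (auto simp: vec_eq_iff transpose_def block_wishart_cov_def mult_ac)
  show "?R *v x \<in> block_space B" for x
  proof -
    define \<Gamma> where "\<Gamma> = (\<chi> i j. (?R *v x) $ (i, j))"
    have "\<Gamma> $ i $ j = \<Gamma> $ j $ i" for i j
      unfolding \<Gamma>_def vec_lambda_beta matrix_vector_mult_def
      by (intro sum.cong refl) (auto simp: block_wishart_cov_def same_block_sym[of B i j] add.commute mult.commute)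
    then have "transpose \<Gamma> = \<Gamma>" by (simp add: vec_eq_iff transpose_def)
    moreover have "block_restrict B \<Gamma> = \<Gamma>"
      unfolding \<Gamma>_def by (simp add: vec_eq_iff matrix_vector_mult_def block_wishart_cov_def)
    moreover have "?R *v x = vectorize \<Gamma>" unfolding \<Gamma>_def vectorize_def by (simp add: vec_eq_iff)
    ultimately show ?thesis unfolding block_space_def by blast
  qed
  show "?R *v (?J *v v) = v" if "v \<in> block_space B" for v
    by (rule block_wishart_cov_inverts[OF sym d B blk that])
qed

section \<open>Normal laws\<close>

lemma measurable_affine [measurable, simp]:
  "(\<lambda>z. m + A *v z) \<in> borel \<rightarrow>\<^sub>M (borel :: (real^'d) measure)" for A :: "real^'d^'d"
  by (intro borel_measurable_continuous_onI continuous_intros linear_continuous_on_compose[OF continuous_on_id]) auto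

lemma is_normal_lawE:
  fixes Q :: "real^'d^'d"
  assumes "is_normal_law m Q N"
  obtains A :: "real^'d^'d" where "A ** transpose A = Q" "N = distr std_normal_vec borel (\<lambda>z. m + A *v z)"
  using assms unfolding is_normal_law_def by (elim exE conjE) (rule that, assumption+)

lemma normal_law_prob_space:
  fixes Q :: "real^'d^'d"
  assumes "is_normal_law m Q N"
  shows "prob_space N"
proof -
  obtain A :: "real^'d^'d" where A: "N = distr std_normal_vec borel (\<lambda>z. m + A *v z)"
    using assms by (rule is_normal_lawE)
  show ?thesis unfolding A
    by (intro prob_space.prob_space_distr prob_space_std_normal_vec) simp
qed

lemma normal_law_sets: "is_normal_law m Q N \<Longrightarrow> sets N = sets borel"
  unfolding is_normal_law_def by (elim exE conjE) (simp only: sets_distr)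

lemma inner_matrix_transpose: "x \<bullet> (A *v y) = (transpose A *v x) \<bullet> (y :: real^'d)"
  by (metis dot_lmul_matrix transpose_matrix_vector)

lemma char_normal_law:
  fixes Q :: "real^'d^'d"
  assumes "is_normal_law m Q N"
  shows "(CLINT x|N. iexp (t \<bullet> x)) = iexp (t \<bullet> m) * exp (- (t \<bullet> (Q *v t)) / 2)"
proof -
  obtain A :: "real^'d^'d" where A: "A ** transpose A = Q" "N = distr std_normal_vec borel (\<lambda>z. m + A *v z)"
    using assms by (rule is_normal_lawE)
  have "(CLINT x|N. iexp (t \<bullet> x)) = (CLINT z|std_normal_vec. iexp (t \<bullet> (m + A *v z)))"
    unfolding A(2) by (subst integral_distr) auto
  also have "\<dots> = (CLINT z|std_normal_vec. iexp (t \<bullet> m) * iexp ((transpose A *v t) \<bullet> z))"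
    by (intro Bochner_Integration.integral_cong refl)
      (simp add: inner_add_right inner_matrix_transpose[of t A] distrib_left exp_add)
  also have "\<dots> = iexp (t \<bullet> m) * exp (- (norm (transpose A *v t))\<^sup>2 / 2)"
    by (simp add: char_std_normal_vec)
  also have "(norm (transpose A *v t))\<^sup>2 = t \<bullet> (Q *v t)"
    unfolding power2_norm_eq_inner inner_matrix_transpose[symmetric] A(1)[symmetric]
    by (simp only: matrix_vector_mul_assoc)
  finally show ?thesis .
qed

text \<open>The characteristic function of a normal law does not depend on the choice of the square root, so
  neither does the law; the continuity theorem, applied to a constant sequence, makes this precise.\<close>

lemma normal_law_integral_unique:
  fixes N N' :: "(real^'d) measure" and f :: "real^'d \<Rightarrow> real"
  assumes N: "is_normal_law m Q N" and N': "is_normal_law m Q N'"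
    and f: "continuous_on UNIV f" "bounded (range f)"
  shows "(\<integral>x. f x \<partial>N) = (\<integral>x. f x \<partial>N')"
proof -
  have "converges_in_law (\<lambda>_ :: nat. N) N'"
  proof (rule converges_in_law_of_char)
    show "(\<lambda>n :: nat. CLINT x|N. iexp (t \<bullet> x)) \<longlonglongrightarrow> (CLINT x|N'. iexp (t \<bullet> x))" for t
      unfolding char_normal_law[OF N] char_normal_law[OF N'] by simp
    show "\<exists>R. \<forall>n :: nat. measure N {x. R < norm x} \<le> e" if "e > 0" for e
      using tight_single[OF normal_law_prob_space[OF N] normal_law_sets[OF N] that] by simp
  qed (simp_all only: normal_law_prob_space[OF N] normal_law_prob_space[OF N'] normal_law_sets[OF N] normal_law_sets[OF N'])
  from this[unfolded converges_in_law_def, rule_format, OF conjI[OF f]]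
  have "(\<lambda>_ :: nat. \<integral>x. f x \<partial>N) \<longlonglongrightarrow> (\<integral>x. f x \<partial>N')" .
  then show ?thesis by (simp add: LIMSEQ_const_iff)
qed

lemma normal_law_complex_integral_unique:
  fixes N N' :: "(real^'d) measure" and f :: "real^'d \<Rightarrow> real"
  assumes N: "is_normal_law m Q N" and N': "is_normal_law m Q N'"
    and f: "continuous_on UNIV f"
  shows "(CLINT x|N. iexp (f x)) = (CLINT x|N'. iexp (f x))"
proof -
  have eq: "(CLINT x|L. iexp (f x)) = Complex (\<integral>x. cos (f x) \<partial>L) (\<integral>x. sin (f x) \<partial>L)"
    if L: "prob_space L" "sets L = sets borel" for L
  proof -
    interpret prob_space L by fact
    note [measurable_cong] = L(2)
    have [measurable]: "f \<in> borel_measurable borel" using f by (rule borel_measurable_continuous_onI)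
    have int: "integrable L (\<lambda>x. iexp (f x))" by (rule integrable_const_bound[of _ 1]) auto
    show ?thesis
      using integral_Re[OF int] integral_Im[OF int]
      by (simp add: complex_eq_iff cis_conv_exp[symmetric])
  qed
  have "(\<integral>x. cos (f x) \<partial>N) = (\<integral>x. cos (f x) \<partial>N')"
    by (rule normal_law_integral_unique[OF N N']) (auto intro!: continuous_intros f boundedI[of _ 1])
  moreover have "(\<integral>x. sin (f x) \<partial>N) = (\<integral>x. sin (f x) \<partial>N')"
    by (rule normal_law_integral_unique[OF N N']) (auto intro!: continuous_intros f boundedI[of _ 1])
  ultimately show ?thesis
    using eq[OF normal_law_prob_space[OF N] normal_law_sets[OF N]]
      eq[OF normal_law_prob_space[OF N'] normal_law_sets[OF N']] by simp
qed

lemma normal_law_transfer: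
  fixes X :: "'a \<Rightarrow> real^'d" and g :: "real^'d \<Rightarrow> real" and A :: "real^'d^'d"
  assumes X: "X \<in> borel_measurable M" and A: "distr M borel X = distr std_normal_vec borel (\<lambda>z. m + A *v z)"
    and g: "continuous_on UNIV g"
    and h: "\<And>z. g (m + A *v z) = h z" and int: "integrable std_normal_vec h"
  shows "integrable M (\<lambda>\<omega>. g (X \<omega>))" "(\<integral>\<omega>. g (X \<omega>) \<partial>M) = (\<integral>z. h z \<partial>std_normal_vec)"
proof -
  have [measurable]: "g \<in> borel_measurable borel" using g by (rule borel_measurable_continuous_onI)
  have "integrable (distr std_normal_vec borel (\<lambda>z. m + A *v z)) g"
    using int by (subst integrable_distr_eq) (auto simp: h)
  then have "integrable (distr M borel X) g" by (simp add: A)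
  then show "integrable M (\<lambda>\<omega>. g (X \<omega>))" using X by (subst (asm) integrable_distr_eq) auto
  have "(\<integral>\<omega>. g (X \<omega>) \<partial>M) = (\<integral>x. g x \<partial>distr M borel X)"
    using X by (subst integral_distr) auto
  also have "\<dots> = (\<integral>z. h z \<partial>std_normal_vec)"
    unfolding A by (subst integral_distr) (auto simp: h)
  finally show "(\<integral>\<omega>. g (X \<omega>) \<partial>M) = (\<integral>z. h z \<partial>std_normal_vec)" .
qed

lemma normal_moments:
  fixes X :: "'a \<Rightarrow> real^'p"
  assumes X: "X \<in> borel_measurable M" and law: "is_normal_law \<mu> Sig (distr M borel X)"
  defines "Y i \<omega> \<equiv> X \<omega> $ i - \<mu> $ i"
  shows "integrable M (Y i)" "(\<integral>\<omega>. Y i \<omega> \<partial>M) = 0"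
    "integrable M (\<lambda>\<omega>. Y i \<omega> * Y j \<omega>)" "(\<integral>\<omega>. Y i \<omega> * Y j \<omega> \<partial>M) = Sig $ i $ j"
    "integrable M (\<lambda>\<omega>. Y i \<omega> * Y j \<omega> * Y k \<omega> * Y l \<omega>)"
    "(\<integral>\<omega>. Y i \<omega> * Y j \<omega> * Y k \<omega> * Y l \<omega> \<partial>M)
      = Sig $ i $ j * Sig $ k $ l + Sig $ i $ k * Sig $ j $ l + Sig $ i $ l * Sig $ j $ k"
proof -
  obtain A :: "real^'p^'p" where A: "A ** transpose A = Sig" "distr M borel X = distr std_normal_vec borel (\<lambda>z. \<mu> + A *v z)"
    using law by (rule is_normal_lawE)
  have S: "A $ i \<bullet> A $ j = Sig $ i $ j" for i j
    unfolding A(1)[symmetric] by (simp add: matrix_matrix_mult_def transpose_def inner_vec_def)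
  have row: "(\<mu> + A *v z) $ i - \<mu> $ i = A $ i \<bullet> z" for z i
    by (simp add: matrix_vector_mul_component)
  note tr = normal_law_transfer[OF X A(2)]
  have c: "continuous_on UNIV (\<lambda>x :: real^'p. x $ i - \<mu> $ i)" for i by (intro continuous_intros)
  have i1: "integrable std_normal_vec (\<lambda>z. A $ i \<bullet> z)"
    using integrable_linear_form_power[of "A $ i" 1] by simp
  show "integrable M (Y i)" "(\<integral>\<omega>. Y i \<omega> \<partial>M) = 0"
    unfolding Y_def using tr[of "\<lambda>x. x $ i - \<mu> $ i", OF c row i1] linear_forms_moment_1[of "A $ i"]
    by auto
  show "integrable M (\<lambda>\<omega>. Y i \<omega> * Y j \<omega>)" "(\<integral>\<omega>. Y i \<omega> * Y j \<omega> \<partial>M) = Sig $ i $ j"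
    unfolding Y_def using tr[of "\<lambda>x. (x $ i - \<mu> $ i) * (x $ j - \<mu> $ j)", unfolded row, OF continuous_on_mult[OF c c] refl linear_forms_moment_2(1)]
      linear_forms_moment_2(2)[of "A $ i" "A $ j"]
    by (auto simp: S)
  show "integrable M (\<lambda>\<omega>. Y i \<omega> * Y j \<omega> * Y k \<omega> * Y l \<omega>)"
    "(\<integral>\<omega>. Y i \<omega> * Y j \<omega> * Y k \<omega> * Y l \<omega> \<partial>M)
      = Sig $ i $ j * Sig $ k $ l + Sig $ i $ k * Sig $ j $ l + Sig $ i $ l * Sig $ j $ k"
    unfolding Y_def
    using tr[of "\<lambda>x. (x $ i - \<mu> $ i) * (x $ j - \<mu> $ j) * (x $ k - \<mu> $ k) * (x $ l - \<mu> $ l)", unfolded row,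
        OF continuous_on_mult[OF continuous_on_mult[OF continuous_on_mult[OF c c] c] c] refl linear_forms_moment_4(1)]
      linear_forms_moment_4(2)[of "A $ i" "A $ j" "A $ k" "A $ l"]
    by (auto simp: S)
qed

section \<open>A central limit theorem for empirical covariance matrices\<close>

lemma (in prob_space) indep_vars_shift:
  fixes X :: "nat \<Rightarrow> 'a \<Rightarrow> 'b"
  assumes "indep_vars (\<lambda>_. N) X {1..}"
  shows "indep_vars (\<lambda>_. N) (\<lambda>i. X (Suc i)) UNIV"
  unfolding indep_vars_def2 indep_sets_def
proof (intro conjI ballI allI impI)
  let ?F = "\<lambda>i. {X i -` A \<inter> space M |A. A \<in> sets N}"
  have rv: "\<And>i. i \<in> {1..} \<Longrightarrow> random_variable N (X i)" and
    ind: "\<And>J A. J \<subseteq> {1..} \<Longrightarrow> J \<noteq> {} \<Longrightarrow> finite J \<Longrightarrow> A \<in> Pi J ?F \<Longrightarrow> prob (\<Inter>j\<in>J. A j) = (\<Prod>j\<in>J. prob (A j))"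
    using assms unfolding indep_vars_def2 indep_sets_def by auto
  show "random_variable N (X (Suc i))" for i using rv by simp
  then show "?F (Suc i) \<subseteq> events" for i by (auto intro: measurable_sets)
  fix J and A :: "nat \<Rightarrow> 'a set"
  assume J: "J \<noteq> {}" "finite J" and A: "A \<in> (\<Pi> j\<in>J. ?F (Suc j))"
  have "prob (\<Inter>j\<in>Suc ` J. A (j - 1)) = (\<Prod>j\<in>Suc ` J. prob (A (j - 1)))"
    by (rule ind) (use J A in \<open>auto simp: Pi_iff\<close>)
  then show "prob (\<Inter>j\<in>J. A j) = (\<Prod>j\<in>J. prob (A j))"
    by (simp add: prod.reindex)
qed

lemma norm_iexp_diff: "norm (iexp a - iexp b) \<le> \<bar>a - b\<bar>"
proof -
  have "iexp a - iexp b = iexp b * (iexp (a - b) - 1)"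
    by (simp add: algebra_simps flip: exp_add)
  then have "norm (iexp a - iexp b) = norm (iexp (a - b) - 1)" by (simp add: norm_mult)
  also have "\<dots> \<le> \<bar>a - b\<bar>" using iexp_approx1[of "a - b" 0] by simp
  finally show ?thesis .
qed

text \<open>The degenerate case \<open>v = 0\<close>, which occurs for projections on the kernel of the limiting covariance,
  is included: all summands then vanish almost surely.\<close>

lemma (in prob_space) clt_char:
  fixes \<xi> :: "nat \<Rightarrow> 'a \<Rightarrow> real"
  assumes ind: "indep_vars (\<lambda>_. borel) \<xi> {1..}"
    and int: "\<And>l. l \<ge> 1 \<Longrightarrow> integrable M (\<xi> l)" "\<And>l. l \<ge> 1 \<Longrightarrow> integrable M (\<lambda>\<omega>. (\<xi> l \<omega>)\<^sup>2)"
    and mean: "\<And>l. l \<ge> 1 \<Longrightarrow> (\<integral>\<omega>. \<xi> l \<omega> \<partial>M) = 0"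
    and var: "\<And>l. l \<ge> 1 \<Longrightarrow> (\<integral>\<omega>. (\<xi> l \<omega>)\<^sup>2 \<partial>M) = v"
    and dist: "\<And>l. l \<ge> 1 \<Longrightarrow> distr M borel (\<xi> l) = N"
  shows "(\<lambda>n. CLINT \<omega>|M. iexp ((\<Sum>l=1..n. \<xi> l \<omega>) / sqrt n)) \<longlonglongrightarrow> exp (- v / 2)"
proof -
  have rv: "l \<ge> 1 \<Longrightarrow> \<xi> l \<in> borel_measurable M" for l using int(1) by auto
  have "v = (\<integral>\<omega>. (\<xi> 1 \<omega>)\<^sup>2 \<partial>M)" using var[of 1] by simp
  then have v0: "v \<ge> 0" by simp
  show ?thesis
  proof (cases "v = 0")
    case True
    have "AE \<omega> in M. \<xi> l \<omega> = 0" if "l \<ge> 1" for l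
      using integral_nonneg_eq_0_iff_AE[OF int(2)[OF that]] var[OF that] True by simp
    then have z0: "AE \<omega> in M. \<forall>l\<in>{1..n}. \<xi> l \<omega> = 0" for n
      by (intro AE_finite_allI) auto
    have z: "AE \<omega> in M. (\<Sum>l=1..n. \<xi> l \<omega>) = 0" for n
      using z0[of n] by (rule eventually_mono) simp
    have "(CLINT \<omega>|M. iexp ((\<Sum>l=1..n. \<xi> l \<omega>) / sqrt n)) = (CLINT \<omega>|M. 1)" for n
    proof (rule integral_cong_AE)
      show "AE \<omega> in M. iexp ((\<Sum>l=1..n. \<xi> l \<omega>) / sqrt n) = 1"
        using z[of n] by (rule eventually_mono) (simp only: div_0 of_real_0 mult_zero_right exp_zero)
    qed (use rv in auto)
    then show ?thesis using True by (simp add: prob_space)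
  next
    case False
    then have v: "v > 0" using v0 by simp
    have "weak_conv_m (\<lambda>n. distr M borel (\<lambda>x. (\<Sum>i<n. \<xi> (Suc i) x) / sqrt (real n * (sqrt v)\<^sup>2))) std_normal_distribution"
    proof (rule central_limit_theorem_zero_mean[OF indep_vars_shift[OF ind], where \<mu> = N])
      show "variance (\<xi> (Suc n)) = (sqrt v)\<^sup>2" for n using mean[of "Suc n"] var[of "Suc n"] v by simp
    qed (use int mean dist v in auto)
    then have "(\<lambda>n. char (distr M borel (\<lambda>x. (\<Sum>i<n. \<xi> (Suc i) x) / sqrt (real n * (sqrt v)\<^sup>2))) (sqrt v))
      \<longlonglongrightarrow> char std_normal_distribution (sqrt v)"
      by (intro levy_continuity1) (auto intro!: real_distribution_distr real_dist_normal_dist borel_measurable_divide borel_measurable_sum rv)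
    moreover have "char (distr M borel (\<lambda>x. (\<Sum>i<n. \<xi> (Suc i) x) / sqrt (real n * (sqrt v)\<^sup>2))) (sqrt v)
        = (CLINT \<omega>|M. iexp ((\<Sum>l=1..n. \<xi> l \<omega>) / sqrt n))" for n
    proof -
      have "(\<Sum>i<n. \<xi> (Suc i) x) = (\<Sum>l=1..n. \<xi> l x)" for x
        by (rule sum.reindex_bij_witness[of _ "\<lambda>l. l - 1" Suc]) auto
      moreover have "sqrt v * (s / sqrt (real n * (sqrt v)\<^sup>2)) = s / sqrt n" for s
        using v by (simp add: real_sqrt_mult)
      ultimately show ?thesis
        unfolding char_def using rv by (subst integral_distr) (auto simp del: real_sqrt_pow2)
    qed
    moreover have "char std_normal_distribution (sqrt v) = exp (- v / 2)"
      using v by (simp add: char_std_normal_distribution)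
    ultimately show ?thesis by simp
  qed
qed

lemma (in prob_space) second_moment_sum:
  fixes \<xi> :: "nat \<Rightarrow> 'a \<Rightarrow> real"
  assumes ind: "indep_vars (\<lambda>_. borel) \<xi> {1..}"
    and int: "\<And>l. l \<ge> 1 \<Longrightarrow> integrable M (\<xi> l)" "\<And>l. l \<ge> 1 \<Longrightarrow> integrable M (\<lambda>\<omega>. (\<xi> l \<omega>)\<^sup>2)"
    and mean: "\<And>l. l \<ge> 1 \<Longrightarrow> (\<integral>\<omega>. \<xi> l \<omega> \<partial>M) = 0"
    and var: "\<And>l. l \<ge> 1 \<Longrightarrow> (\<integral>\<omega>. (\<xi> l \<omega>)\<^sup>2 \<partial>M) = v"
  shows "integrable M (\<lambda>\<omega>. (\<Sum>l=1..n. \<xi> l \<omega>)\<^sup>2)" "(\<integral>\<omega>. (\<Sum>l=1..n. \<xi> l \<omega>)\<^sup>2 \<partial>M) = real n * v"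
proof -
  have sq: "(\<Sum>l=1..n. \<xi> l \<omega>)\<^sup>2 = (\<Sum>l=1..n. \<Sum>m=1..n. \<xi> l \<omega> * \<xi> m \<omega>)" for \<omega>
    by (simp add: power2_eq_square sum_product)
  have pr: "integrable M (\<lambda>\<omega>. \<xi> l \<omega> * \<xi> m \<omega>) \<and> (\<integral>\<omega>. \<xi> l \<omega> * \<xi> m \<omega> \<partial>M) = (if l = m then v else 0)"
    if lm: "l \<ge> 1" "m \<ge> 1" for l m
  proof (cases "l = m")
    case True
    then show ?thesis using int(2)[OF lm(1)] var[OF lm(1)] by (simp add: power2_eq_square)
  next
    case False
    have i: "indep_vars (\<lambda>_. borel) \<xi> {l, m}" by (rule indep_vars_subset[OF ind]) (use lm in auto)
    have "integrable M (\<lambda>\<omega>. \<Prod>i\<in>{l, m}. \<xi> i \<omega>)"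
      by (rule indep_vars_integrable[OF _ i]) (use lm int in auto)
    moreover have "(\<integral>\<omega>. (\<Prod>i\<in>{l, m}. \<xi> i \<omega>) \<partial>M) = (\<Prod>i\<in>{l, m}. \<integral>\<omega>. \<xi> i \<omega> \<partial>M)"
      by (rule indep_vars_lebesgue_integral[OF _ i]) (use lm int in auto)
    ultimately show ?thesis using False mean[OF lm(1)] by simp
  qed
  show "integrable M (\<lambda>\<omega>. (\<Sum>l=1..n. \<xi> l \<omega>)\<^sup>2)"
    unfolding sq using pr by (intro Bochner_Integration.integrable_sum) auto
  have "(\<integral>\<omega>. (\<Sum>l=1..n. \<xi> l \<omega>)\<^sup>2 \<partial>M) = (\<Sum>l=1..n. \<Sum>m=1..n. \<integral>\<omega>. \<xi> l \<omega> * \<xi> m \<omega> \<partial>M)"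
    unfolding sq using pr by (subst Bochner_Integration.integral_sum, force intro!: Bochner_Integration.integrable_sum)
      (intro sum.cong refl Bochner_Integration.integral_sum, auto)
  also have "\<dots> = (\<Sum>l=1..n. \<Sum>m=1..n. if l = m then v else 0)"
    using pr by (intro sum.cong refl) auto
  also have "\<dots> = real n * v" by simp
  finally show "(\<integral>\<omega>. (\<Sum>l=1..n. \<xi> l \<omega>)\<^sup>2 \<partial>M) = real n * v" .
qed

lemma borel_measurable_vecI:
  fixes f :: "'a \<Rightarrow> real^'d"
  assumes "\<And>i. (\<lambda>\<omega>. f \<omega> $ i) \<in> borel_measurable M"
  shows "f \<in> borel_measurable M"
  using borel_measurable_vec_lambda[of "\<lambda>\<omega> i. f \<omega> $ i", OF assms] by simp

text \<open>Centring at the sample mean and centring at the true mean differ by the outer product of the mean error.\<close>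

lemma sample_cov_decomposition:
  fixes x :: "nat \<Rightarrow> real^'p" and \<mu> :: "real^'p"
  assumes n: "n \<ge> 1"
  defines "m i \<equiv> (\<Sum>l=1..n. x l $ i - \<mu> $ i) / real n"
  shows "sample_cov x n $ i $ j = (\<Sum>l=1..n. (x l $ i - \<mu> $ i) * (x l $ j - \<mu> $ j)) / real n - m i * m j"
proof -
  define y where "y l i = x l $ i - \<mu> $ i" for l i
  have c: "(x l - sample_mean x n) $ i = y l i - m i" for l i
    using n unfolding sample_mean_def m_def y_def by (simp add: sum_subtractf field_simps)
  have s: "(\<Sum>l=1..n. y l i) = real n * m i" for i using n unfolding m_def y_def by simp
  have "(\<Sum>l=1..n. (x l - sample_mean x n) $ i * (x l - sample_mean x n) $ j)
    = (\<Sum>l=1..n. y l i * y l j - m j * y l i - m i * y l j + m i * m j)"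
    unfolding c by (simp add: algebra_simps)
  also have "\<dots> = (\<Sum>l=1..n. y l i * y l j) - m j * (\<Sum>l=1..n. y l i) - m i * (\<Sum>l=1..n. y l j) + real n * (m i * m j)"
    by (simp only: sum.distrib sum_subtractf sum_distrib_left[symmetric]) simp
  also have "\<dots> = (\<Sum>l=1..n. y l i * y l j) - real n * (m i * m j)"
    unfolding s by (simp add: algebra_simps)
  finally show ?thesis using n unfolding y_def by (simp add: sample_cov_def field_simps)
qed

locale gaussian_sample = prob_space M for M :: "'a measure" +
  fixes X :: "nat \<Rightarrow> 'a \<Rightarrow> real^'p" and \<mu> :: "real^'p" and Sig :: "real^'p^'p"
  assumes indep: "indep_vars (\<lambda>_. borel) X {1..}"
    and law: "\<And>l. l \<ge> 1 \<Longrightarrow> is_normal_law \<mu> Sig (distr M borel (X l))"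
begin

definition centred_product :: "'p set set \<Rightarrow> real^'p \<Rightarrow> real^('p \<times> 'p)" where
  "centred_product B x =
     vectorize (block_restrict B (\<chi> i j. (x $ i - \<mu> $ i) * (x $ j - \<mu> $ j) - Sig $ i $ j))"

definition leading_term :: "'p set set \<Rightarrow> nat \<Rightarrow> 'a \<Rightarrow> real^('p \<times> 'p)" where
  "leading_term B n \<omega> = (1 / sqrt n) *\<^sub>R (\<Sum>l=1..n. centred_product B (X l \<omega>))"

definition mean_error :: "nat \<Rightarrow> 'p \<Rightarrow> 'a \<Rightarrow> real" where
  "mean_error n i \<omega> = (\<Sum>l=1..n. X l \<omega> $ i - \<mu> $ i) / real n"

definition remainder_term :: "'p set set \<Rightarrow> nat \<Rightarrow> 'a \<Rightarrow> real^('p \<times> 'p)" where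
  "remainder_term B n \<omega> =
     sqrt n *\<^sub>R vectorize (block_restrict B (\<chi> i j. mean_error n i \<omega> * mean_error n j \<omega>))"

definition cov_error :: "'p set set \<Rightarrow> nat \<Rightarrow> 'a \<Rightarrow> real^('p \<times> 'p)" where
  "cov_error B n \<omega> = sqrt n *\<^sub>R vectorize (block_restrict B (sample_cov (\<lambda>l. X l \<omega>) n - Sig))"

definition exceeds :: "'p set set \<Rightarrow> nat \<Rightarrow> real \<Rightarrow> 'a set" where
  "exceeds B n r = {\<omega> \<in> space M. r < norm (cov_error B n \<omega>)}"

lemma X_measurable [measurable]: "l \<ge> 1 \<Longrightarrow> X l \<in> borel_measurable M"
  using indep unfolding indep_vars_def by auto

lemma centred_product_nth:
  "centred_product B x $ (i, j) =
    (if same_block B i j then (x $ i - \<mu> $ i) * (x $ j - \<mu> $ j) - Sig $ i $ j else 0)"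
  by (simp add: centred_product_def vectorize_def)

lemma cov_error_decomposition:
  assumes n: "n \<ge> 1"
  shows "cov_error B n \<omega> = leading_term B n \<omega> - remainder_term B n \<omega>"
proof -
  have "cov_error B n \<omega> $ (i, j) = (leading_term B n \<omega> - remainder_term B n \<omega>) $ (i, j)" for i j
  proof (cases "same_block B i j")
    case True
    define P where "P = (\<Sum>l=1..n. (X l \<omega> $ i - \<mu> $ i) * (X l \<omega> $ j - \<mu> $ j))"
    have "1 / sqrt (real n) = sqrt (real n) / real n"
      using n by (simp add: frac_eq_eq)
    then have "leading_term B n \<omega> $ (i, j) = sqrt n / n * (P - n * Sig $ i $ j)"
      using True by (simp add: leading_term_def sum_component centred_product_nth sum_subtractf P_def)
    also have "\<dots> = sqrt n * (P / n - Sig $ i $ j)" using n by (simp add: field_simps)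
    finally have "leading_term B n \<omega> $ (i, j) = sqrt n * (P / n - Sig $ i $ j)" .
    moreover have "sample_cov (\<lambda>l. X l \<omega>) n $ i $ j = P / n - mean_error n i \<omega> * mean_error n j \<omega>"
      using sample_cov_decomposition[OF n, of "\<lambda>l. X l \<omega>" i j \<mu>] unfolding P_def mean_error_def .
    ultimately show ?thesis using True
      by (simp add: cov_error_def remainder_term_def vectorize_def right_diff_distrib)
  qed (simp add: cov_error_def leading_term_def remainder_term_def vectorize_def sum_component centred_product_nth)
  then show ?thesis by (simp add: vec_eq_iff split_paired_all)
qed

lemma continuous_centred_product: "continuous_on UNIV (centred_product B)"
proof -
  have "continuous_on UNIV (\<lambda>x. centred_product B x $ (i, j))" for i j
    unfolding centred_product_nth by (cases "same_block B i j") (auto intro!: continuous_intros)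
  then have "continuous_on UNIV (\<lambda>x. \<chi> ij. centred_product B x $ ij)"
    by (intro continuous_on_vec_lambda) (metis surj_pair)
  then show ?thesis by simp
qed

lemma measurable_centred_product [measurable]: "centred_product B \<in> borel_measurable borel"
  by (rule borel_measurable_continuous_onI[OF continuous_centred_product])

lemma centred_product_moments:
  assumes l: "l \<ge> 1"
  shows "integrable M (\<lambda>\<omega>. centred_product B (X l \<omega>) $ x)"
    "(\<integral>\<omega>. centred_product B (X l \<omega>) $ x \<partial>M) = 0"
    "integrable M (\<lambda>\<omega>. centred_product B (X l \<omega>) $ x * centred_product B (X l \<omega>) $ y)"
    "(\<integral>\<omega>. centred_product B (X l \<omega>) $ x * centred_product B (X l \<omega>) $ y \<partial>M) = block_wishart_cov B Sig $ x $ y"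
proof -
  obtain i j where x: "x = (i, j)" by (cases x)
  obtain k m where y: "y = (k, m)" by (cases y)
  note mom = normal_moments[OF X_measurable[OF l] law[OF l]]
  show "integrable M (\<lambda>\<omega>. centred_product B (X l \<omega>) $ x)"
    unfolding x centred_product_nth using mom(3)[of i j] by (cases "same_block B i j") simp_all
  show "(\<integral>\<omega>. centred_product B (X l \<omega>) $ x \<partial>M) = 0"
    unfolding x centred_product_nth using mom(3,4)[of i j] by (cases "same_block B i j") (simp_all add: prob_space)
  define Y where "Y i \<omega> = X l \<omega> $ i - \<mu> $ i" for i \<omega>
  note mom = mom[folded Y_def]
  have eq: "(Y i \<omega> * Y j \<omega> - Sig $ i $ j) * (Y k \<omega> * Y m \<omega> - Sig $ k $ m) =
    Y i \<omega> * Y j \<omega> * Y k \<omega> * Y m \<omega> - Sig $ k $ m * (Y i \<omega> * Y j \<omega>) - Sig $ i $ j * (Y k \<omega> * Y m \<omega>) + Sig $ i $ j * Sig $ k $ m" for \<omega>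
    by (simp add: algebra_simps)
  have int: "integrable M (\<lambda>\<omega>. (Y i \<omega> * Y j \<omega> - Sig $ i $ j) * (Y k \<omega> * Y m \<omega> - Sig $ k $ m))"
    unfolding eq using mom(3)[of i j] mom(3)[of k m] mom(5)[of i j k m] by simp
  have val: "(\<integral>\<omega>. (Y i \<omega> * Y j \<omega> - Sig $ i $ j) * (Y k \<omega> * Y m \<omega> - Sig $ k $ m) \<partial>M)
      = Sig $ i $ k * Sig $ j $ m + Sig $ i $ m * Sig $ j $ k"
    unfolding eq using mom(3,4)[of i j] mom(3,4)[of k m] mom(5,6)[of i j k m] by (simp add: prob_space)
  show "integrable M (\<lambda>\<omega>. centred_product B (X l \<omega>) $ x * centred_product B (X l \<omega>) $ y)"
    unfolding x y centred_product_nth Y_def[symmetric] using int by (cases "same_block B i j"; cases "same_block B k m") simp_all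
  show "(\<integral>\<omega>. centred_product B (X l \<omega>) $ x * centred_product B (X l \<omega>) $ y \<partial>M) = block_wishart_cov B Sig $ x $ y"
    unfolding x y centred_product_nth Y_def[symmetric] using val
    by (cases "same_block B i j"; cases "same_block B k m") (simp_all add: block_wishart_cov_def)
qed

lemma indep_function:
  assumes "g \<in> borel_measurable borel"
  shows "indep_vars (\<lambda>_. borel) (\<lambda>l \<omega>. g (X l \<omega>)) {1..}"
  by (rule indep_vars_compose2[OF indep]) (use assms in simp)

text \<open>The observations have the same law although the hypothesis allows a different square root of \<open>Sig\<close>
  for each of them.\<close>

lemma distr_function_unique:
  fixes g :: "real^'p \<Rightarrow> real"
  assumes g: "continuous_on UNIV g" and l: "l \<ge> 1"
  shows "distr M borel (\<lambda>\<omega>. g (X l \<omega>)) = distr M borel (\<lambda>\<omega>. g (X 1 \<omega>))"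
proof (rule Levy_uniqueness)
  have [measurable]: "g \<in> borel_measurable borel" using g by (rule borel_measurable_continuous_onI)
  note [measurable] = X_measurable[OF l] X_measurable[of 1, simplified]
  show "real_distribution (distr M borel (\<lambda>\<omega>. g (X l \<omega>)))" by (rule real_distribution_distr) simp
  show "real_distribution (distr M borel (\<lambda>\<omega>. g (X 1 \<omega>)))" by (rule real_distribution_distr) simp
  have "char (distr M borel (\<lambda>\<omega>. g (X k \<omega>))) t = (CLINT x|distr M borel (X k). iexp (t * g x))"
    if [measurable]: "X k \<in> borel_measurable M" for k t
    unfolding char_def by (subst (1 2) integral_distr) auto
  moreover have "(CLINT x|distr M borel (X l). iexp (t * g x)) = (CLINT x|distr M borel (X 1). iexp (t * g x))" for t
    by (rule normal_law_complex_integral_unique[OF law[OF l] law[of 1]]) (auto intro!: continuous_intros g)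
  ultimately show "char (distr M borel (\<lambda>\<omega>. g (X l \<omega>))) = char (distr M borel (\<lambda>\<omega>. g (X 1 \<omega>)))"
    by (intro ext) simp
qed

lemma mean_error_second_moment:
  assumes n: "n \<ge> 1"
  shows "integrable M (\<lambda>\<omega>. (mean_error n i \<omega>)\<^sup>2)" "(\<integral>\<omega>. (mean_error n i \<omega>)\<^sup>2 \<partial>M) = Sig $ i $ i / n"
proof -
  have ind: "indep_vars (\<lambda>_. borel) (\<lambda>l \<omega>. X l \<omega> $ i - \<mu> $ i) {1..}"
    by (rule indep_function[of "\<lambda>x. x $ i - \<mu> $ i"]) simp
  note mom = normal_moments[OF X_measurable law]
  note sm = second_moment_sum[OF ind, of "Sig $ i $ i", unfolded power2_eq_square[of "X _ _ $ _ - _"], OF mom(1) mom(3) mom(2) mom(4)]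
  show "integrable M (\<lambda>\<omega>. (mean_error n i \<omega>)\<^sup>2)"
    unfolding mean_error_def power_divide using sm(1)[of n] by simp
  show "(\<integral>\<omega>. (mean_error n i \<omega>)\<^sup>2 \<partial>M) = Sig $ i $ i / n"
    unfolding mean_error_def power_divide using sm(2)[of n] n by (simp add: power2_eq_square)
qed

lemma mean_error_measurable [measurable]: "mean_error n i \<in> borel_measurable M"
proof -
  have "(\<lambda>\<omega>. X l \<omega> $ i - \<mu> $ i) \<in> borel_measurable M" if "l \<in> {1..n}" for l
    using X_measurable[of l] that by (intro borel_measurable_diff) auto
  then have "(\<lambda>\<omega>. (\<Sum>l=1..n. X l \<omega> $ i - \<mu> $ i) / real n) \<in> borel_measurable M"
    by (intro borel_measurable_divide borel_measurable_sum) auto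
  then show ?thesis by (simp add: mean_error_def[abs_def])
qed

lemma leading_term_measurable [measurable]: "leading_term B n \<in> borel_measurable M"
proof -
  have "(\<lambda>\<omega>. centred_product B (X l \<omega>)) \<in> borel_measurable M" if "l \<in> {1..n}" for l
    using X_measurable[of l] that by simp
  then have "(\<lambda>\<omega>. (1 / sqrt n) *\<^sub>R (\<Sum>l=1..n. centred_product B (X l \<omega>))) \<in> borel_measurable M"
    by (intro borel_measurable_scaleR borel_measurable_sum) auto
  then show ?thesis by (simp add: leading_term_def[abs_def])
qed

lemma remainder_term_nth:
  "remainder_term B n \<omega> $ (i, j) = (if same_block B i j then sqrt n * (mean_error n i \<omega> * mean_error n j \<omega>) else 0)"
  by (simp add: remainder_term_def vectorize_def)

lemma remainder_term_measurable [measurable]: "remainder_term B n \<in> borel_measurable M"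
proof (rule borel_measurable_vecI)
  fix x :: "'p \<times> 'p"
  show "(\<lambda>\<omega>. remainder_term B n \<omega> $ x) \<in> borel_measurable M"
    by (cases x) (simp add: remainder_term_nth)
qed

lemma cov_error_measurable [measurable]: "cov_error B n \<in> borel_measurable M"
proof (cases "n = 0")
  case True
  then have "cov_error B n = (\<lambda>\<omega>. 0)" by (simp add: cov_error_def fun_eq_iff)
  then show ?thesis by simp
next
  case False
  then have "cov_error B n = (\<lambda>\<omega>. leading_term B n \<omega> - remainder_term B n \<omega>)"
    by (intro ext cov_error_decomposition) simp
  then show ?thesis by simp
qed

text \<open>The error of the mean has variance of order \<open>1/n\<close>, so \<open>sqrt n\<close> times its square vanishes in the mean.\<close>

lemma remainder_term_bound:
  assumes n: "n \<ge> 1"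
  shows "integrable M (\<lambda>\<omega>. \<bar>remainder_term B n \<omega> $ (i, j)\<bar>)"
    "(\<integral>\<omega>. \<bar>remainder_term B n \<omega> $ (i, j)\<bar> \<partial>M) \<le> (Sig $ i $ i + Sig $ j $ j) / sqrt n"
proof -
  let ?b = "\<lambda>\<omega>. sqrt n * ((mean_error n i \<omega>)\<^sup>2 + (mean_error n j \<omega>)\<^sup>2)"
  have le: "\<bar>remainder_term B n \<omega> $ (i, j)\<bar> \<le> ?b \<omega>" for \<omega>
  proof -
    have ab: "\<bar>a * b\<bar> \<le> a\<^sup>2 + b\<^sup>2" for a b :: real
    proof -
      have "0 \<le> (\<bar>a\<bar> - \<bar>b\<bar>)\<^sup>2" by simp
      then have "2 * \<bar>a * b\<bar> \<le> a\<^sup>2 + b\<^sup>2" by (simp add: power2_diff abs_mult)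
      then show ?thesis using abs_ge_zero[of "a * b"] by linarith
    qed
    show ?thesis unfolding remainder_term_nth
      using ab[of "mean_error n i \<omega>" "mean_error n j \<omega>"] by (auto simp: abs_mult intro!: mult_left_mono)
  qed
  have int: "integrable M ?b" using mean_error_second_moment(1)[OF n] by simp
  show i: "integrable M (\<lambda>\<omega>. \<bar>remainder_term B n \<omega> $ (i, j)\<bar>)"
    by (rule Bochner_Integration.integrable_bound[OF int]) (use le in \<open>auto intro: order_trans[OF _ abs_ge_self]\<close>)
  have "(\<integral>\<omega>. \<bar>remainder_term B n \<omega> $ (i, j)\<bar> \<partial>M) \<le> (\<integral>\<omega>. ?b \<omega> \<partial>M)"
    by (rule integral_mono[OF i int le])
  also have "\<dots> = sqrt n * ((Sig $ i $ i + Sig $ j $ j) / n)"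
    using mean_error_second_moment[OF n] by (simp add: add_divide_distrib)
  also have "\<dots> = (Sig $ i $ i + Sig $ j $ j) / sqrt n"
  proof -
    have "a / sqrt n = (a * sqrt n) / (sqrt n * sqrt n)" for a
      by (rule mult_divide_mult_cancel_right[symmetric]) (use n in simp)
    then show ?thesis by simp
  qed
  finally show "(\<integral>\<omega>. \<bar>remainder_term B n \<omega> $ (i, j)\<bar> \<partial>M) \<le> (Sig $ i $ i + Sig $ j $ j) / sqrt n" .
qed

lemma leading_term_bound:
  assumes n: "n \<ge> 1"
  shows "integrable M (\<lambda>\<omega>. \<bar>leading_term B n \<omega> $ x\<bar>)"
    "(\<integral>\<omega>. \<bar>leading_term B n \<omega> $ x\<bar> \<partial>M) \<le> 1 + block_wishart_cov B Sig $ x $ x"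
proof -
  have ind: "indep_vars (\<lambda>_. borel) (\<lambda>l \<omega>. centred_product B (X l \<omega>) $ x) {1..}"
    by (rule indep_function[of "\<lambda>y. centred_product B y $ x"]) simp
  note mom = centred_product_moments(3,4)[where B = B and x = x and y = x, unfolded power2_eq_square[symmetric]]
  note sm = second_moment_sum[OF ind, OF centred_product_moments(1) mom(1) centred_product_moments(2) mom(2)]
  have sq: "(leading_term B n \<omega> $ x)\<^sup>2 = (\<Sum>l=1..n. centred_product B (X l \<omega>) $ x)\<^sup>2 / n" for \<omega>
    by (simp add: leading_term_def sum_component power_divide)
  have int: "integrable M (\<lambda>\<omega>. 1 + (leading_term B n \<omega> $ x)\<^sup>2)"
    unfolding sq using sm(1)[of n] by simp
  have val: "(\<integral>\<omega>. 1 + (leading_term B n \<omega> $ x)\<^sup>2 \<partial>M) = 1 + block_wishart_cov B Sig $ x $ x"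
    unfolding sq using sm[of n] n by (simp add: prob_space)
  have le: "\<bar>a\<bar> \<le> 1 + a\<^sup>2" for a :: real
  proof -
    have "0 \<le> (\<bar>a\<bar> - 1)\<^sup>2" by simp
    then have "2 * \<bar>a\<bar> \<le> 1 + a\<^sup>2" by (simp add: power2_diff)
    then show ?thesis using abs_ge_zero[of a] by linarith
  qed
  show i: "integrable M (\<lambda>\<omega>. \<bar>leading_term B n \<omega> $ x\<bar>)"
    by (rule Bochner_Integration.integrable_bound[OF int]) (use le in auto)
  show "(\<integral>\<omega>. \<bar>leading_term B n \<omega> $ x\<bar> \<partial>M) \<le> 1 + block_wishart_cov B Sig $ x $ x"
    unfolding val[symmetric] by (rule integral_mono[OF i int le])
qed

text \<open>Both parts of the error are bounded in the mean, uniformly in \<open>n\<close>, so Markov's inequality applies.\<close>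

lemma cov_error_tight:
  assumes e: "e > 0"
  shows "\<exists>R. \<forall>n. prob (exceeds B n R) \<le> e"
proof -
  define c where "c = (\<Sum>x\<in>UNIV. (1 + block_wishart_cov B Sig $ x $ x) + (\<bar>Sig $ fst x $ fst x\<bar> + \<bar>Sig $ snd x $ snd x\<bar>))"
  define R where "R = \<bar>c\<bar> / e + 1"
  have R: "R > 0" unfolding R_def using e by (simp add: add_nonneg_pos)
  have "prob (exceeds B n R) \<le> e" for n
  proof (cases "n \<ge> 1")
    case False
    then have "cov_error B n = (\<lambda>\<omega>. 0)" by (simp add: cov_error_def fun_eq_iff)
    then show ?thesis using R e by (simp add: exceeds_def)
  next
    case n: True
    let ?u = "\<lambda>\<omega>. \<Sum>x\<in>UNIV. \<bar>leading_term B n \<omega> $ x\<bar> + \<bar>remainder_term B n \<omega> $ x\<bar>"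
    have rb: "integrable M (\<lambda>\<omega>. \<bar>remainder_term B n \<omega> $ x\<bar>)"
      "(\<integral>\<omega>. \<bar>remainder_term B n \<omega> $ x\<bar> \<partial>M) \<le> \<bar>Sig $ fst x $ fst x\<bar> + \<bar>Sig $ snd x $ snd x\<bar>" for x
    proof -
      obtain i j where x: "x = (i, j)" by (cases x)
      show "integrable M (\<lambda>\<omega>. \<bar>remainder_term B n \<omega> $ x\<bar>)" unfolding x by (rule remainder_term_bound[OF n])
      have "(Sig $ i $ i + Sig $ j $ j) / sqrt n \<le> (\<bar>Sig $ i $ i\<bar> + \<bar>Sig $ j $ j\<bar>) / 1"
        using n by (intro frac_le) auto
      then show "(\<integral>\<omega>. \<bar>remainder_term B n \<omega> $ x\<bar> \<partial>M) \<le> \<bar>Sig $ fst x $ fst x\<bar> + \<bar>Sig $ snd x $ snd x\<bar>"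
        unfolding x using remainder_term_bound(2)[OF n, of B i j] by simp
    qed
    have int: "integrable M ?u" using leading_term_bound(1)[OF n] rb(1) by simp
    have "(\<integral>\<omega>. ?u \<omega> \<partial>M) \<le> c"
      unfolding c_def using leading_term_bound[OF n] rb
      by (subst Bochner_Integration.integral_sum) (auto intro!: sum_mono add_mono)
    have "norm (cov_error B n \<omega>) \<le> ?u \<omega>" for \<omega>
      unfolding cov_error_decomposition[OF n]
      by (rule order_trans[OF norm_le_l1_cart]) (auto intro!: sum_mono abs_triangle_ineq4)
    then have "prob (exceeds B n R) \<le> prob {\<omega> \<in> space M. R \<le> ?u \<omega>}"
      unfolding exceeds_def by (intro finite_measure_mono) (auto intro: less_imp_le less_le_trans)
    also have "\<dots> \<le> (\<integral>\<omega>. ?u \<omega> \<partial>M) / R"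
      by (rule integral_Markov_inequality_measure[OF int, of "{}"]) (use R in \<open>auto intro!: sum_nonneg\<close>)
    also have "\<dots> \<le> \<bar>c\<bar> / R" using \<open>(\<integral>\<omega>. ?u \<omega> \<partial>M) \<le> c\<close> R by (intro divide_right_mono) auto
    also have "\<dots> \<le> e"
    proof -
      have "\<bar>c\<bar> \<le> e * R" unfolding R_def using e by (simp add: algebra_simps)
      then show ?thesis using R by (simp add: divide_le_eq)
    qed
    finally show ?thesis .
  qed
  then show ?thesis by blast
qed

text \<open>The projection of the leading term on \<open>t\<close> is a normalised sum of independent, identically distributed
  variables. The remainder changes the characteristic function at \<open>t\<close> by at most the mean absolute value of its projection.\<close>

lemma cov_error_char:
  "(\<lambda>n. CLINT \<omega>|M. iexp (t \<bullet> cov_error B n \<omega>)) \<longlonglongrightarrow> exp (- (t \<bullet> (block_wishart_cov B Sig *v t)) / 2)"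
proof -
  define v where "v = t \<bullet> (block_wishart_cov B Sig *v t)"
  define \<xi> where "\<xi> l \<omega> = t \<bullet> centred_product B (X l \<omega>)" for l \<omega>
  have \<xi>: "\<xi> l \<omega> = (\<Sum>x\<in>UNIV. t $ x * centred_product B (X l \<omega>) $ x)" for l \<omega>
    unfolding \<xi>_def inner_vec_def by simp
  have sq: "(\<xi> l \<omega>)\<^sup>2 = (\<Sum>x\<in>UNIV. \<Sum>y\<in>UNIV. (t $ x * t $ y) * (centred_product B (X l \<omega>) $ x * centred_product B (X l \<omega>) $ y))" for l \<omega>
    unfolding \<xi> power2_eq_square sum_product by (intro sum.cong refl) (simp add: mult_ac)
  have clt: "(\<lambda>n. CLINT \<omega>|M. iexp ((\<Sum>l=1..n. \<xi> l \<omega>) / sqrt n)) \<longlonglongrightarrow> exp (- v / 2)"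
  proof (rule clt_char[where N = "distr M borel (\<xi> 1)"])
    show "indep_vars (\<lambda>_. borel) \<xi> {1..}"
      unfolding \<xi>_def by (rule indep_function[of "\<lambda>x. t \<bullet> centred_product B x"]) simp
    fix l :: nat assume l: "l \<ge> 1"
    show "integrable M (\<xi> l)"
      unfolding \<xi>[abs_def] using centred_product_moments(1)[OF l] by simp
    show "integrable M (\<lambda>\<omega>. (\<xi> l \<omega>)\<^sup>2)"
      unfolding sq using centred_product_moments(3)[OF l] by simp
    show "(\<integral>\<omega>. \<xi> l \<omega> \<partial>M) = 0"
      unfolding \<xi> using centred_product_moments(1,2)[OF l] by simp
    have "(\<integral>\<omega>. (\<xi> l \<omega>)\<^sup>2 \<partial>M) = (\<Sum>x\<in>UNIV. \<Sum>y\<in>UNIV. (t $ x * t $ y) * block_wishart_cov B Sig $ x $ y)"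
      unfolding sq using centred_product_moments(3,4)[OF l] by simp
    also have "\<dots> = v"
      unfolding v_def inner_vec_def matrix_vector_mult_def by (simp add: sum_distrib_left mult_ac)
    finally show "(\<integral>\<omega>. (\<xi> l \<omega>)\<^sup>2 \<partial>M) = v" .
    have "continuous_on UNIV (\<lambda>x. t \<bullet> centred_product B x)"
      by (intro continuous_intros continuous_centred_product)
    from distr_function_unique[OF this l] show "distr M borel (\<xi> l) = distr M borel (\<xi> 1)"
      unfolding \<xi>_def .
  qed
  have eq: "(\<Sum>l=1..n. \<xi> l \<omega>) / sqrt n = t \<bullet> leading_term B n \<omega>" for n \<omega>
    by (simp add: leading_term_def \<xi>_def inner_sum_right)
  have lead: "(\<lambda>n. CLINT \<omega>|M. iexp (t \<bullet> leading_term B n \<omega>)) \<longlonglongrightarrow> exp (- v / 2)"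
    using clt unfolding eq .
  define k where "k = (\<Sum>x\<in>UNIV. \<bar>t $ x\<bar> * (Sig $ fst x $ fst x + Sig $ snd x $ snd x))"
  let ?c = "\<lambda>n \<omega>. iexp (t \<bullet> cov_error B n \<omega>)" and ?l = "\<lambda>n \<omega>. iexp (t \<bullet> leading_term B n \<omega>)"
  have diff: "norm ((CLINT \<omega>|M. ?c n \<omega>) - (CLINT \<omega>|M. ?l n \<omega>)) \<le> k / sqrt n" if n: "n \<ge> 1" for n
  proof -
    have i1: "integrable M (\<lambda>\<omega>. ?c n \<omega>)" "integrable M (\<lambda>\<omega>. ?l n \<omega>)"
      by (auto intro!: integrable_const_bound[of _ 1])
    let ?u = "\<lambda>\<omega>. \<Sum>x\<in>UNIV. \<bar>t $ x\<bar> * \<bar>remainder_term B n \<omega> $ x\<bar>"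
    have ri: "integrable M (\<lambda>\<omega>. \<bar>remainder_term B n \<omega> $ x\<bar>)" for x
      by (cases x) (simp only: remainder_term_bound(1)[OF n])
    have iu: "integrable M ?u" using ri by (intro Bochner_Integration.integrable_sum integrable_mult_right)
    have le: "norm (?c n \<omega> - ?l n \<omega>) \<le> ?u \<omega>" for \<omega>
    proof -
      have "norm (?c n \<omega> - ?l n \<omega>) \<le> \<bar>t \<bullet> cov_error B n \<omega> - t \<bullet> leading_term B n \<omega>\<bar>"
        by (rule norm_iexp_diff)
      also have "\<dots> = \<bar>\<Sum>x\<in>UNIV. t $ x * remainder_term B n \<omega> $ x\<bar>"
        unfolding cov_error_decomposition[OF n] inner_diff_right
        by (simp add: inner_vec_def[of t "remainder_term B n \<omega>"])
      also have "\<dots> \<le> ?u \<omega>" unfolding abs_mult[symmetric] by (rule sum_abs)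
      finally show ?thesis .
    qed
    have "norm ((CLINT \<omega>|M. ?c n \<omega>) - (CLINT \<omega>|M. ?l n \<omega>))
      = norm (CLINT \<omega>|M. ?c n \<omega> - ?l n \<omega>)"
      using i1 by simp
    also have "\<dots> \<le> (\<integral>\<omega>. norm (?c n \<omega> - ?l n \<omega>) \<partial>M)"
      by (rule integral_norm_bound)
    also have "\<dots> \<le> (\<integral>\<omega>. ?u \<omega> \<partial>M)"
      by (rule integral_mono) (use i1 iu le in auto)
    also have "\<dots> = (\<Sum>x\<in>UNIV. \<bar>t $ x\<bar> * (\<integral>\<omega>. \<bar>remainder_term B n \<omega> $ x\<bar> \<partial>M))"
      using ri by simp
    also have "\<dots> \<le> (\<Sum>x\<in>UNIV. \<bar>t $ x\<bar> * ((Sig $ fst x $ fst x + Sig $ snd x $ snd x) / sqrt n))"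
    proof (intro sum_mono mult_left_mono)
      show "(\<integral>\<omega>. \<bar>remainder_term B n \<omega> $ x\<bar> \<partial>M) \<le> (Sig $ fst x $ fst x + Sig $ snd x $ snd x) / sqrt n" for x
        using remainder_term_bound(2)[OF n, of B "fst x" "snd x"] by simp
    qed simp
    also have "\<dots> = k / sqrt n" unfolding k_def by (simp add: sum_divide_distrib)
    finally show ?thesis .
  qed
  have "(\<lambda>n. k / sqrt (real n)) \<longlonglongrightarrow> 0"
    by (rule real_tendsto_divide_at_top[OF tendsto_const filterlim_compose[OF sqrt_at_top filterlim_real_sequentially]])
  then have "(\<lambda>n. (CLINT \<omega>|M. ?c n \<omega>) - (CLINT \<omega>|M. ?l n \<omega>)) \<longlonglongrightarrow> 0"
    by (rule Lim_null_comparison[rotated]) (use diff in \<open>auto simp: eventually_sequentially intro: exI[of _ 1]\<close>)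
  from tendsto_add[OF this lead] show ?thesis unfolding v_def by simp
qed

theorem sample_cov_clt:
  assumes N: "is_normal_law 0 (block_wishart_cov B Sig) N"
  shows "converges_in_law (\<lambda>n. distr M borel (cov_error B n)) N"
proof (rule converges_in_law_of_char)
  show "prob_space (distr M borel (cov_error B n))" for n by (rule prob_space_distr) simp
  show "(\<lambda>n. CLINT x|distr M borel (cov_error B n). iexp (t \<bullet> x)) \<longlonglongrightarrow> (CLINT x|N. iexp (t \<bullet> x))" for t
  proof -
    have "(CLINT x|distr M borel (cov_error B n). iexp (t \<bullet> x)) = (CLINT \<omega>|M. iexp (t \<bullet> cov_error B n \<omega>))" for n
      by (subst integral_distr) auto
    then show ?thesis using cov_error_char[of t B] char_normal_law[OF N, of t] by simp
  qed
  show "\<exists>R. \<forall>n. measure (distr M borel (cov_error B n)) {x. R < norm x} \<le> e" if "e > 0" for e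
  proof -
    have "measure (distr M borel (cov_error B n)) {x. R < norm x} = prob (exceeds B n R)" for R n
      unfolding exceeds_def by (subst measure_distr) (auto intro!: arg_cong[where f = prob])
    then show ?thesis using cov_error_tight[OF that, of B] by simp
  qed
qed (use normal_law_prob_space[OF N] normal_law_sets[OF N] in simp_all)

end

section \<open>Ties between empirical correlations\<close>

text \<open>A non-degenerate Gaussian variable has no atom at 0. The integrand is at least 1/2 on a small interval
  and continuous, as required of a test function for convergence in law.\<close>

lemma linear_form_small_ball:
  fixes Q :: "real^'d^'d"
  assumes N: "is_normal_law 0 Q N" and pos: "t \<bullet> (Q *v t) > 0" and e: "e > 0"
  shows "\<exists>a>0. (\<integral>x. max 0 (1 - \<bar>t \<bullet> x\<bar> / a) \<partial>N) \<le> e"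
proof -
  obtain A :: "real^'d^'d" where A: "A ** transpose A = Q" "N = distr std_normal_vec borel (\<lambda>z. 0 + A *v z)"
    using N by (rule is_normal_lawE)
  define s where "s = norm (transpose A *v t)"
  have "s\<^sup>2 = t \<bullet> (Q *v t)"
    unfolding s_def power2_norm_eq_inner inner_matrix_transpose[symmetric] A(1)[symmetric]
    by (simp only: matrix_vector_mul_assoc)
  then have s: "s > 0" using pos unfolding s_def by (metis norm_ge_zero less_eq_real_def zero_power2 less_irrefl)
  define f where "f m u = max 0 (1 - \<bar>s * u\<bar> * real (Suc m))" for m u
  have "(\<integral>x. max 0 (1 - \<bar>t \<bullet> x\<bar> / (1 / real (Suc m))) \<partial>N) = (\<integral>u. f m u \<partial>std_normal_distribution)" for m
  proof -
    have "(\<integral>x. max 0 (1 - \<bar>t \<bullet> x\<bar> / (1 / real (Suc m))) \<partial>N)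
        = (\<integral>z. max 0 (1 - \<bar>t \<bullet> (0 + A *v z)\<bar> / (1 / real (Suc m))) \<partial>std_normal_vec)"
    proof -
      have m: "(\<lambda>z. 0 + A *v z) \<in> std_normal_vec \<rightarrow>\<^sub>M borel"
        unfolding measurable_std_normal_vec by (rule measurable_affine)
      show ?thesis unfolding A(2) by (rule integral_distr[OF m]) simp
    qed
    also have "\<dots> = (\<integral>z. max 0 (1 - \<bar>(transpose A *v t) \<bullet> z\<bar> * real (Suc m)) \<partial>std_normal_vec)"
      unfolding add_0_left inner_matrix_transpose by simp
    also have "\<dots> = (\<integral>x. max 0 (1 - \<bar>x\<bar> * real (Suc m)) \<partial>distr std_normal_vec borel (\<lambda>z. (transpose A *v t) \<bullet> z))"
      by (rule integral_distr[symmetric]) simp_all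
    also have "\<dots> = (\<integral>u. f m u \<partial>std_normal_distribution)"
      unfolding distr_linear_form_std_normal_vec s_def[symmetric] f_def by (rule integral_distr) simp_all
    finally show ?thesis .
  qed
  moreover have "(\<lambda>m. \<integral>u. f m u \<partial>std_normal_distribution) \<longlonglongrightarrow> (\<integral>u. 0 \<partial>std_normal_distribution)"
  proof (rule integral_dominated_convergence[where w = "\<lambda>_. 1"])
    interpret S: real_distribution std_normal_distribution by (rule real_dist_normal_dist)
    show "integrable std_normal_distribution (\<lambda>_. 1 :: real)" by simp
    show "f m \<in> borel_measurable std_normal_distribution" for m unfolding f_def by simp
    have "AE u in lborel. u \<noteq> (0::real)" by (rule AE_lborel_singleton)
    then have "AE u in std_normal_distribution. u \<noteq> 0"
      by (subst AE_density) (auto elim: eventually_mono)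
    then show "AE u in std_normal_distribution. (\<lambda>m. f m u) \<longlonglongrightarrow> 0"
    proof (rule eventually_mono)
      fix u :: real assume u: "u \<noteq> 0"
      have pos: "\<bar>s * u\<bar> > 0" using s u by simp
      obtain m0 :: nat where m0: "1 / \<bar>s * u\<bar> < real m0" using reals_Archimedean2 by blast
      have "f m u = 0" if "m \<ge> m0" for m
      proof -
        have "1 < \<bar>s * u\<bar> * real m0" using m0 pos by (simp add: divide_less_eq mult.commute)
        also have "\<dots> \<le> \<bar>s * u\<bar> * real (Suc m)" using that by (intro mult_left_mono) auto
        finally show ?thesis unfolding f_def by simp
      qed
      then show "(\<lambda>m. f m u) \<longlonglongrightarrow> 0"
        by (intro tendsto_eventually) (auto simp: eventually_sequentially)
    qed
    show "AE u in std_normal_distribution. norm (f m u) \<le> 1" for m unfolding f_def by simp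
  qed simp
  ultimately have "(\<lambda>m. \<integral>x. max 0 (1 - \<bar>t \<bullet> x\<bar> / (1 / real (Suc m))) \<partial>N) \<longlonglongrightarrow> 0" by simp
  from order_tendstoD(2)[OF this e] obtain m where "(\<integral>x. max 0 (1 - \<bar>t \<bullet> x\<bar> / (1 / real (Suc m))) \<partial>N) < e"
    unfolding eventually_sequentially by blast
  then show ?thesis by (intro exI[of _ "1 / real (Suc m)"]) (simp add: less_imp_le)
qed

text \<open>For positive diagonal entries it vanishes exactly when the correlations at \<open>(i, j)\<close> and \<open>(k, l)\<close> have the same
  absolute value; the polynomial form avoids square roots and quotients.\<close>

definition tie_polynomial :: "'p \<Rightarrow> 'p \<Rightarrow> 'p \<Rightarrow> 'p \<Rightarrow> real^'p^'p \<Rightarrow> real" where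
  "tie_polynomial i j k l S = (S $ i $ j)\<^sup>2 * S $ k $ k * S $ l $ l - (S $ k $ l)\<^sup>2 * S $ i $ i * S $ j $ j"

definition tie_derivative :: "'p \<Rightarrow> 'p \<Rightarrow> 'p \<Rightarrow> 'p \<Rightarrow> real^'p^'p \<Rightarrow> real^'p^'p \<Rightarrow> real" where
  "tie_derivative i j k l S D =
     2 * S $ i $ j * D $ i $ j * S $ k $ k * S $ l $ l + (S $ i $ j)\<^sup>2 * (D $ k $ k * S $ l $ l + S $ k $ k * D $ l $ l)
     - (2 * S $ k $ l * D $ k $ l * S $ i $ i * S $ j $ j + (S $ k $ l)\<^sup>2 * (D $ i $ i * S $ j $ j + S $ i $ i * D $ j $ j))"

lemma has_derivative_entry: "((\<lambda>S :: real^'p^'p. S $ i $ j) has_derivative (\<lambda>D. D $ i $ j)) F"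
  by (intro bounded_linear_imp_has_derivative bounded_linear_compose[OF bounded_linear_vec_nth bounded_linear_vec_nth])

lemma tie_polynomial_derivative:
  "(tie_polynomial i j k l has_derivative tie_derivative i j k l S) (at (S :: real^'p^'p))"
  unfolding tie_polynomial_def[abs_def] tie_derivative_def[abs_def]
  by (auto intro!: derivative_eq_intros has_derivative_entry simp: fun_eq_iff power2_eq_square algebra_simps)

lemma linear_eq_inner_vectorize:
  fixes f :: "real^'p^'p \<Rightarrow> real"
  assumes "linear f"
  obtains H where "\<And>D. f D = H \<bullet> vectorize D"
proof
  fix D :: "real^'p^'p"
  have D: "D = (\<Sum>i\<in>UNIV. \<Sum>j\<in>UNIV. D $ i $ j *\<^sub>R axis i (axis j 1))"
  proof -
    have "(\<Sum>i\<in>UNIV. \<Sum>j\<in>UNIV. D $ i $ j *\<^sub>R axis i (axis j 1)) $ a $ b = D $ a $ b" for a b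
    proof -
      have "(D $ i $ j *\<^sub>R axis i (axis j 1)) $ a $ b = (if j = b then if i = a then D $ i $ b else 0 else 0)" for i j
        by (simp add: axis_def)
      then show ?thesis by (simp add: sum_component)
    qed
    then show ?thesis by (simp add: vec_eq_iff)
  qed
  have "f D = (\<Sum>i\<in>UNIV. \<Sum>j\<in>UNIV. D $ i $ j * f (axis i (axis j 1)))"
    by (subst D) (simp add: linear_sum[OF assms] linear_scale[OF assms])
  then show "f D = (\<chi> ij. f (axis (fst ij) (axis (snd ij) 1))) \<bullet> vectorize D"
    by (simp add: inner_vec_def vectorize_def sum_UNIV_prod mult.commute)
qed

text \<open>The covariance has the square root \<open>R\<close> of \<open>block_wishart_root\<close>, so a degenerate direction \<open>t\<close> is annihilated
  by \<open>R\<^sup>T\<close>, hence orthogonal to the image of the covariance, which contains the block space.\<close>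

lemma block_wishart_cov_pos:
  fixes Sig A :: "real^'p^'p"
  assumes Sig: "sym_pos_def Sig" and A: "A ** transpose A = Sig"
    and B: "partition_on UNIV B" and blk: "block_restrict B Sig = Sig"
    and v: "v \<in> block_space B" and t: "t \<bullet> v \<noteq> 0"
  shows "t \<bullet> (block_wishart_cov B Sig *v t) > 0"
proof (rule ccontr)
  let ?r = "block_wishart_root B A" and ?J = "fisher_information Sig"
  assume *: "\<not> t \<bullet> (block_wishart_cov B Sig *v t) > 0"
  have rr: "block_wishart_cov B Sig *v y = ?r *v (transpose ?r *v y)" for y
    unfolding block_wishart_root_mult[OF A, symmetric] by (simp only: matrix_vector_mul_assoc)
  have "t \<bullet> (block_wishart_cov B Sig *v t) = (norm (transpose ?r *v t))\<^sup>2"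
    unfolding rr inner_matrix_transpose[of t] power2_norm_eq_inner ..
  then have z: "transpose ?r *v t = 0" using * by (metis norm_eq_zero not_less_iff_gr_or_eq zero_less_power2 not_less zero_le_power2 less_eq_real_def)
  have "t \<bullet> v = t \<bullet> (block_wishart_cov B Sig *v (?J *v v))"
    using block_wishart_cov_inverts[OF _ _ B blk v] Sig sym_pos_def_det_pos[OF Sig]
    unfolding sym_pos_def_def by simp
  also have "\<dots> = (transpose ?r *v t) \<bullet> (transpose ?r *v (?J *v v))"
    unfolding rr inner_matrix_transpose[of t] ..
  also have "\<dots> = 0" unfolding z by simp
  finally show False using t by simp
qed

context gaussian_sample
begin

definition emp_cov :: "nat \<Rightarrow> 'a \<Rightarrow> real^'p^'p" where
  "emp_cov n \<omega> = sample_cov (\<lambda>l. X l \<omega>) n"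

lemma emp_cov_entry_measurable [measurable]: "(\<lambda>\<omega>. emp_cov n \<omega> $ i $ j) \<in> borel_measurable M"
proof -
  have "(\<lambda>\<omega>. X l \<omega> $ i) \<in> borel_measurable M" if "l \<in> {1..n}" for l i
    using X_measurable[of l] that by simp
  moreover have "(\<lambda>\<omega>. sample_mean (\<lambda>l. X l \<omega>) n $ i) \<in> borel_measurable M" for i
    unfolding sample_mean_def using calculation by (simp add: sum_component) measurable
  ultimately show ?thesis
    unfolding emp_cov_def sample_cov_def vec_lambda_beta vector_minus_component
    by (intro borel_measurable_times borel_measurable_sum borel_measurable_diff) auto
qed

lemma transpose_emp_cov: "transpose (emp_cov n \<omega>) = emp_cov n \<omega>"
  by (simp add: emp_cov_def sample_cov_def transpose_def vec_eq_iff mult.commute)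

lemma cov_error_trivial_nth: "cov_error {UNIV} n \<omega> $ (i, j) = sqrt n * (emp_cov n \<omega> $ i $ j - Sig $ i $ j)"
  by (simp add: cov_error_def vectorize_def emp_cov_def)

lemma exceeds_measurable [measurable]: "exceeds B n r \<in> events"
  unfolding exceeds_def by measurable

definition deviates :: "nat \<Rightarrow> real \<Rightarrow> 'a set" where
  "deviates n e = {\<omega> \<in> space M. \<exists>i j. \<bar>emp_cov n \<omega> $ i $ j - Sig $ i $ j\<bar> > e}"

lemma deviates_measurable [measurable]: "deviates n e \<in> events"
  unfolding deviates_def by measurable

lemma cov_error_exceeds_tendsto_0:
  assumes r: "filterlim r at_top sequentially"
  shows "(\<lambda>n. prob (exceeds B n (r n))) \<longlonglongrightarrow> 0"
proof (rule LIMSEQ_I)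
  fix e :: real assume e: "e > 0"
  obtain R where R: "\<And>n. prob (exceeds B n R) \<le> e / 2"
    using cov_error_tight[of "e / 2" B] e by auto
  obtain n0 where n0: "\<And>n. n \<ge> n0 \<Longrightarrow> R \<le> r n"
    using r unfolding filterlim_at_top eventually_sequentially by blast
  show "\<exists>n0. \<forall>n\<ge>n0. norm (prob (exceeds B n (r n)) - 0) < e"
  proof (intro exI[of _ n0] allI impI)
    fix n assume "n \<ge> n0"
    then have "prob (exceeds B n (r n)) \<le> prob (exceeds B n R)"
      by (intro finite_measure_mono) (auto simp: exceeds_def dest: n0)
    then show "norm (prob (exceeds B n (r n)) - 0) < e"
      using R[of n] e by simp
  qed
qed

lemma deviates_tendsto_0:
  assumes r: "filterlim (\<lambda>n. sqrt n * e n) at_top sequentially"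
  shows "(\<lambda>n. prob (deviates n (e n))) \<longlonglongrightarrow> 0"
proof (rule tendsto_sandwich[OF _ _ tendsto_const cov_error_exceeds_tendsto_0[OF r, of "{UNIV}"]])
  show "\<forall>\<^sub>F n in sequentially. prob (deviates n (e n)) \<le> prob (exceeds {UNIV} n (sqrt n * e n))"
  proof (rule eventually_sequentiallyI[of 1])
    fix n :: nat assume n: "n \<ge> 1"
    show "prob (deviates n (e n)) \<le> prob (exceeds {UNIV} n (sqrt n * e n))"
    proof (rule finite_measure_mono)
      show "deviates n (e n) \<subseteq> exceeds {UNIV} n (sqrt n * e n)"
      proof
        fix \<omega> assume "\<omega> \<in> deviates n (e n)"
        then obtain i j where w: "\<omega> \<in> space M" "e n < \<bar>emp_cov n \<omega> $ i $ j - Sig $ i $ j\<bar>"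
          unfolding deviates_def by blast
        have "sqrt n * e n < sqrt n * \<bar>emp_cov n \<omega> $ i $ j - Sig $ i $ j\<bar>"
          using w(2) n by (intro mult_strict_left_mono) auto
        also have "\<dots> = \<bar>cov_error {UNIV} n \<omega> $ (i, j)\<bar>"
          unfolding cov_error_trivial_nth by (simp add: abs_mult)
        also have "\<dots> \<le> norm (cov_error {UNIV} n \<omega>)" by (rule component_le_norm_cart)
        finally show "\<omega> \<in> exceeds {UNIV} n (sqrt n * e n)" using w(1) by (simp add: exceeds_def)
      qed
    qed simp
  qed
qed simp

lemma emp_cov_near:
  assumes "n \<ge> 1" "norm (cov_error {UNIV} n \<omega>) \<le> R"
  shows "norm (emp_cov n \<omega> - Sig) \<le> (real CARD('p))\<^sup>2 * (R / sqrt n)"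
proof (rule norm_matrix_le_of_entries)
  fix i j
  have "sqrt n * \<bar>emp_cov n \<omega> $ i $ j - Sig $ i $ j\<bar> = \<bar>cov_error {UNIV} n \<omega> $ (i, j)\<bar>"
    unfolding cov_error_trivial_nth by (simp add: abs_mult)
  also have "\<dots> \<le> R" using component_le_norm_cart[of "cov_error {UNIV} n \<omega>" "(i, j)"] assms(2) by linarith
  finally show "\<bar>(emp_cov n \<omega> - Sig) $ i $ j\<bar> \<le> R / sqrt n" using assms(1) by (simp add: field_simps)
qed

definition tie_event :: "'p \<Rightarrow> 'p \<Rightarrow> 'p \<Rightarrow> 'p \<Rightarrow> nat \<Rightarrow> 'a set" where
  "tie_event i j k l n = {\<omega> \<in> space M. tie_polynomial i j k l (emp_cov n \<omega>) = 0}"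

lemma tie_event_measurable [measurable]: "tie_event i j k l n \<in> events"
  unfolding tie_event_def tie_polynomial_def by measurable

text \<open>If \<open>Sig\<close> itself has no tie, consistency of the empirical covariance suffices. Otherwise a tie forces the linearised polynomial,
  evaluated at \<open>sqrt n (S - Sig)\<close>, to be close to 0, while it converges to a normal law.
  That law is not degenerate: as \<open>i\<close> does not occur in the second pair, the
  derivative along the symmetric entry \<open>(i, j)\<close> is \<open>2 Sig\<^sub>i\<^sub>j Sig\<^sub>k\<^sub>k Sig\<^sub>l\<^sub>l\<close>.\<close>

lemma tie_event_tendsto_0:
  assumes Sig: "sym_pos_def Sig" and ij: "i \<noteq> j" "k \<noteq> l" "i \<notin> {k, l}" and nz: "Sig $ i $ j \<noteq> 0"
  shows "(\<lambda>n. prob (tie_event i j k l n)) \<longlonglongrightarrow> 0"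
proof (cases "tie_polynomial i j k l Sig = 0")
  case False
  have "isCont (tie_polynomial i j k l) Sig"
    by (rule has_derivative_continuous[OF tie_polynomial_derivative])
  then have lim: "(tie_polynomial i j k l \<longlongrightarrow> tie_polynomial i j k l Sig) (nhds Sig)"
    by (simp add: isCont_def tendsto_at_iff_tendsto_nhds)
  have "\<forall>\<^sub>F S in nhds Sig. tie_polynomial i j k l S \<noteq> 0"
    using tendsto_imp_eventually_ne[OF lim False] .
  then obtain e0 where e0: "e0 > 0" "\<And>M. (\<And>i j. \<bar>M $ i $ j - Sig $ i $ j\<bar> \<le> e0) \<Longrightarrow> tie_polynomial i j k l M \<noteq> 0"
    by (rule eventually_nhds_entries) blast
  have "filterlim (\<lambda>n. sqrt (real n) * e0) at_top sequentially"
    by (rule filterlim_at_top_mult_tendsto_pos[OF tendsto_const e0(1)])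
      (rule filterlim_compose[OF sqrt_at_top filterlim_real_sequentially])
  then have lim0: "(\<lambda>n. prob (deviates n e0)) \<longlonglongrightarrow> 0" by (rule deviates_tendsto_0)
  have "prob (tie_event i j k l n) \<le> prob (deviates n e0)" for n
    by (rule finite_measure_mono) (use e0(2) in \<open>force simp: tie_event_def deviates_def not_less\<close>, simp)
  then show ?thesis
    by (intro tendsto_sandwich[OF _ _ tendsto_const lim0]) auto
next
  case zero: True
  \<comment> \<open>The symmetric matrix unit at \<open>(i, j)\<close>.\<close>
  define D where "D = (axis i (axis j 1) + axis j (axis i 1) :: real^'p^'p)"
  obtain A :: "real^'p^'p" where A: "A ** transpose A = Sig"
    using law[OF order_refl] by (rule is_normal_lawE)
  obtain H where H: "\<And>D. tie_derivative i j k l Sig D = H \<bullet> vectorize D"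
    using linear_eq_inner_vectorize[OF has_derivative_linear[OF tie_polynomial_derivative]] by blast
  have "tie_derivative i j k l Sig D = 2 * Sig $ i $ j * Sig $ k $ k * Sig $ l $ l"
    using ij unfolding tie_derivative_def D_def by (auto simp: axis_def)
  then have HD: "H \<bullet> vectorize D \<noteq> 0"
    using nz sym_pos_def_diag_pos[OF Sig, of k] sym_pos_def_diag_pos[OF Sig, of l] unfolding H by simp
  have "transpose D = D" unfolding D_def by (auto simp: transpose_def vec_eq_iff axis_def)
  then have "vectorize D \<in> block_space {UNIV}" unfolding block_space_def by auto
  then have pos: "H \<bullet> (block_wishart_cov {UNIV} Sig *v H) > 0"
    using block_wishart_cov_pos[OF Sig A partition_on_trivial _ _ HD] by simp
  define N where "N = distr std_normal_vec borel (\<lambda>z. 0 + block_wishart_root {UNIV} A *v z)"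
  have N: "is_normal_law 0 (block_wishart_cov {UNIV} Sig) N"
    unfolding is_normal_law_def N_def using block_wishart_root_mult[OF A] by blast
  show ?thesis
  proof (rule LIMSEQ_I)
    fix r :: real assume r: "r > 0"
    define e where "e = r / 6"
    have e: "e > 0" unfolding e_def using r by simp
    obtain a where a: "a > 0" and fa: "(\<integral>x. max 0 (1 - \<bar>H \<bullet> x\<bar> / a) \<partial>N) \<le> e"
      using linear_form_small_ball[OF N pos e] by blast
    obtain R0 where R0: "\<And>n. prob (exceeds {UNIV} n R0) \<le> e"
      using cov_error_tight[OF e] by blast
    define R where "R = max 1 R0"
    have R: "R > 0" unfolding R_def by simp
    have RP: "prob (exceeds {UNIV} n R) \<le> e" for n
      by (rule order_trans[OF finite_measure_mono R0[of n]]) (auto simp: R_def exceeds_def)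
    define q where "q = (real CARD('p))\<^sup>2"
    have q: "q > 0" unfolding q_def by simp
    have "a / 2 / (q * R) > 0" using a q R by simp
    then obtain d where d: "d > 0" "\<And>y. norm (y - Sig) < d \<Longrightarrow>
        norm (tie_polynomial i j k l y - tie_polynomial i j k l Sig - tie_derivative i j k l Sig (y - Sig)) \<le> a / 2 / (q * R) * norm (y - Sig)"
      using tie_polynomial_derivative[of i j k l Sig] unfolding has_derivative_at_alt by metis
    \<comment> \<open>Where the normalised error is at most \<open>R\<close>, the linearisation error, multiplied by \<open>sqrt n\<close>, is at most \<open>a / 2\<close>.\<close>
    have sub: "tie_event i j k l n \<subseteq> exceeds {UNIV} n R \<union>
        {\<omega> \<in> space M. \<bar>H \<bullet> cov_error {UNIV} n \<omega>\<bar> \<le> a / 2}"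
      if n: "n \<ge> 1" "q * (R / sqrt n) < d" for n
    proof
      fix \<omega> assume w: "\<omega> \<in> tie_event i j k l n"
      show "\<omega> \<in> exceeds {UNIV} n R \<union> {\<omega> \<in> space M. \<bar>H \<bullet> cov_error {UNIV} n \<omega>\<bar> \<le> a / 2}"
      proof (cases "R < norm (cov_error {UNIV} n \<omega>)")
        case False
        have near: "norm (emp_cov n \<omega> - Sig) \<le> q * (R / sqrt n)"
          using emp_cov_near[OF n(1)] False unfolding q_def by simp
        have "\<bar>H \<bullet> vectorize (emp_cov n \<omega> - Sig)\<bar> \<le> a / 2 / (q * R) * norm (emp_cov n \<omega> - Sig)"
          using d(2)[of "emp_cov n \<omega>"] near n(2) w zero unfolding tie_event_def H by simp
        also have "\<dots> \<le> a / 2 / (q * R) * (q * (R / sqrt n))"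
          using near a q R by (intro mult_left_mono) auto
        also have "\<dots> = a / 2 / sqrt n" using q R by simp
        finally have "sqrt n * \<bar>H \<bullet> vectorize (emp_cov n \<omega> - Sig)\<bar> \<le> a / 2"
          using n(1) by (simp add: field_simps)
        moreover have "sqrt n * \<bar>H \<bullet> vectorize (emp_cov n \<omega> - Sig)\<bar> = \<bar>H \<bullet> cov_error {UNIV} n \<omega>\<bar>"
          unfolding cov_error_def emp_cov_def by (simp add: abs_mult)
        ultimately show ?thesis using w unfolding tie_event_def by simp
      qed (use w in \<open>auto simp: tie_event_def exceeds_def\<close>)
    qed
    let ?f = "\<lambda>x. max 0 (1 - \<bar>H \<bullet> x\<bar> / a)"
    have "continuous_on UNIV ?f" using a by (intro continuous_intros) auto
    moreover have "bounded (range ?f)" using a by (intro boundedI[of _ 1]) auto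
    ultimately have "(\<lambda>n. \<integral>x. ?f x \<partial>distr M borel (cov_error {UNIV} n)) \<longlonglongrightarrow> (\<integral>x. ?f x \<partial>N)"
      using sample_cov_clt[OF N] unfolding converges_in_law_def by blast
    moreover have "(\<integral>x. ?f x \<partial>N) < 2 * e" using fa e by linarith
    ultimately have ev1: "\<forall>\<^sub>F n in sequentially. (\<integral>x. ?f x \<partial>distr M borel (cov_error {UNIV} n)) < 2 * e"
      by (rule order_tendstoD(2))
    have "(\<lambda>n. q * (R / sqrt (real n))) \<longlonglongrightarrow> q * 0"
      by (intro tendsto_mult tendsto_const real_tendsto_divide_at_top[OF tendsto_const filterlim_compose[OF sqrt_at_top filterlim_real_sequentially]])
    then have "\<forall>\<^sub>F n in sequentially. q * (R / sqrt (real n)) < d"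
      using d(1) by (intro order_tendstoD(2)) auto
    then have "\<forall>\<^sub>F n in sequentially. norm (prob (tie_event i j k l n) - 0) < r"
      using ev1 eventually_ge_at_top[of 1]
    proof eventually_elim
      case (elim n)
      let ?g = "\<lambda>\<omega>. ?f (cov_error {UNIV} n \<omega>)"
      have ig: "integrable M ?g" using a by (intro integrable_const_bound[of _ 1]) auto
      have "prob (tie_event i j k l n) \<le> prob (exceeds {UNIV} n R \<union> {\<omega> \<in> space M. \<bar>H \<bullet> cov_error {UNIV} n \<omega>\<bar> \<le> a / 2})"
        by (rule finite_measure_mono[OF sub]) (use elim in auto)
      also have "\<dots> \<le> prob (exceeds {UNIV} n R) + prob {\<omega> \<in> space M. \<bar>H \<bullet> cov_error {UNIV} n \<omega>\<bar> \<le> a / 2}"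
        by (rule measure_Un_le) auto
      also have "prob {\<omega> \<in> space M. \<bar>H \<bullet> cov_error {UNIV} n \<omega>\<bar> \<le> a / 2} \<le> prob {\<omega> \<in> space M. 1 / 2 \<le> ?g \<omega>}"
        using a by (intro finite_measure_mono) (auto simp: field_simps max_def)
      also have "\<dots> \<le> (\<integral>\<omega>. ?g \<omega> \<partial>M) / (1 / 2)"
        by (rule integral_Markov_inequality_measure[OF ig, of "{}"]) auto
      also have "(\<integral>\<omega>. ?g \<omega> \<partial>M) = (\<integral>x. ?f x \<partial>distr M borel (cov_error {UNIV} n))"
        by (rule integral_distr[symmetric]) auto
      finally have "prob (tie_event i j k l n) < e + 2 * e / (1 / 2)"
        using RP[of n] elim(2) by simp
      also have "\<dots> \<le> r" unfolding e_def using r by simp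
      finally show ?case by simp
    qed
    then show "\<exists>n0. \<forall>n\<ge>n0. norm (prob (tie_event i j k l n) - 0) < r"
      unfolding eventually_sequentially .
  qed
qed

end

section \<open>Consistency of the block structure and the limit law\<close>

lemma filterlim_powr_nat_at_top:
  assumes "a > 0"
  shows "filterlim (\<lambda>n. real n powr a) at_top sequentially"
proof -
  have "((\<lambda>n. real n powr - a) \<longlongrightarrow> 0) sequentially"
    by (rule tendsto_neg_powr[OF _ filterlim_real_sequentially]) (use assms in simp)
  moreover have "\<forall>\<^sub>F n in sequentially. 0 < real n powr - a"
    using eventually_gt_at_top[of 0] by eventually_elim simp
  ultimately have "filterlim (\<lambda>n. inverse (real n powr - a)) at_top sequentially"
    by (rule filterlim_inverse_at_top)
  then show ?thesis by (simp add: powr_minus)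
qed

lemma corr_levels_card_1:
  assumes "CARD('p) = 1"
  shows "corr_levels (C :: real^'p^'p) = {}"
proof -
  have "i = j" for i j :: 'p
    using assms card_1_singletonE[of "UNIV :: 'p set"] by (metis UNIV_I singletonD)
  then show ?thesis unfolding corr_levels_def by auto
qed

context gaussian_sample
begin

definition ties :: "nat \<Rightarrow> 'a set" where
  "ties n = (\<Union>(i, j, k, l) \<in> {(i, j, k, l). i \<noteq> j \<and> k \<noteq> l \<and> i \<notin> {k, l} \<and> Sig $ i $ j \<noteq> 0}. tie_event i j k l n)"

lemma ties_measurable [measurable]: "ties n \<in> events"
  unfolding ties_def by (intro sets.finite_UN) auto

lemma ties_tendsto_0:
  assumes Sig: "sym_pos_def Sig"
  shows "(\<lambda>n. prob (ties n)) \<longlonglongrightarrow> 0"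
proof -
  let ?Q = "{(i, j, k, l). i \<noteq> j \<and> k \<noteq> l \<and> i \<notin> {k, l} \<and> Sig $ i $ j \<noteq> 0}"
  have "(\<lambda>n. \<Sum>(i, j, k, l)\<in>?Q. prob (tie_event i j k l n)) \<longlonglongrightarrow> (\<Sum>(i, j, k, l)\<in>?Q. 0)"
    by (intro tendsto_sum) (auto intro!: tie_event_tendsto_0[OF Sig])
  then have lim: "(\<lambda>n. \<Sum>(i, j, k, l)\<in>?Q. prob (tie_event i j k l n)) \<longlonglongrightarrow> 0"
    by (simp add: case_prod_beta)
  have "prob (ties n) \<le> (\<Sum>(i, j, k, l)\<in>?Q. prob (tie_event i j k l n))" for n
  proof -
    have "prob (\<Union>x\<in>?Q. (\<lambda>(i, j, k, l). tie_event i j k l n) x) \<le> (\<Sum>x\<in>?Q. prob ((\<lambda>(i, j, k, l). tie_event i j k l n) x))"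
      by (rule finite_measure_subadditive_finite) auto
    then show ?thesis unfolding ties_def by (simp add: case_prod_beta)
  qed
  then show ?thesis by (intro tendsto_sandwich[OF _ _ tendsto_const lim]) auto
qed

text \<open>The exceptional event consists of the samples with a deviation above a tolerance of the order of \<open>\<kappa>\<close>
  or with a tie between correlations. Off this event the deterministic selection result applies to both rules,
  provided that the true partition is a candidate.\<close>

lemma selection_consistent:
  fixes \<delta> :: real and \<kappa> :: "nat \<Rightarrow> real" and Bhat :: "nat \<Rightarrow> 'a \<Rightarrow> 'p set set"
  assumes Sig: "sym_pos_def Sig" and \<delta>: "0 < \<delta>" "\<delta> < 1 / 2"
    and \<kappa>: "\<And>n. \<kappa> n = 1 / (real CARD('p) * real n powr \<delta>)"
    and Bhat: "(\<forall>n. \<forall>\<omega>\<in>space M. sym_pos_def (emp_cov n \<omega>) \<longrightarrow> is_B_tot (\<kappa> n) (emp_cov n \<omega>) (Bhat n \<omega>)) \<or>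
         (\<forall>n. \<forall>\<omega>\<in>space M. sym_pos_def (emp_cov n \<omega>) \<longrightarrow> is_B_corr (\<kappa> n) (emp_cov n \<omega>) (Bhat n \<omega>)) \<and>
         (CARD('p) = 2 \<longrightarrow> finest_partition Sig \<noteq> {UNIV})"
  obtains D where "\<And>n. D n \<in> events" "(\<lambda>n. prob (D n)) \<longlonglongrightarrow> 0"
    "\<forall>\<^sub>F n in sequentially. \<forall>\<omega>\<in>space M - D n.
       block_restrict (Bhat n \<omega>) (emp_cov n \<omega>) = block_restrict (finest_partition Sig) (emp_cov n \<omega>)"
proof -
  let ?B = "finest_partition Sig"
  define p where "p = real CARD('p)"
  have p: "p > 0" unfolding p_def by simp
  obtain C e0 where C: "C > 0" and e0: "e0 > 0"
    and select: "\<And>S e \<kappa> B. (\<And>i j. \<bar>S $ i $ j - Sig $ i $ j\<bar> \<le> e) \<Longrightarrow> e \<le> e0 \<Longrightarrow>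
      C * e < \<kappa> \<Longrightarrow> \<kappa> \<le> e0 \<Longrightarrow> partition_on UNIV B \<Longrightarrow> criterion \<kappa> S B \<le> criterion \<kappa> S ?B \<Longrightarrow>
      block_restrict B S = block_restrict ?B S"
    using criterion_selects_blocks[OF Sig] by metis
  obtain e1 where e1: "e1 > 0"
    and spd: "\<And>M. transpose M = M \<Longrightarrow> (\<And>i j. \<bar>M $ i $ j - Sig $ i $ j\<bar> \<le> e1) \<Longrightarrow> sym_pos_def M"
    using sym_pos_def_open[OF Sig] by metis
  obtain e2 where e2: "e2 > 0"
    and thr: "\<And>S a b. (\<And>i j. \<bar>S $ i $ j - Sig $ i $ j\<bar> \<le> e2) \<Longrightarrow> a \<noteq> b \<Longrightarrow> Sig $ a $ b = 0 \<Longrightarrow>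
      ?B \<in> threshold_partition (corr_matrix S) ` corr_levels (corr_matrix S)"
  proof (cases "\<exists>a b. a \<noteq> b \<and> Sig $ a $ b = 0")
    case True
    then show ?thesis using threshold_at_spurious_level[OF Sig] that by metis
  next
    case False
    show ?thesis by (rule that[of 1]) (use False in auto)
  qed
  \<comment> \<open>A tolerance of the order of \<open>\<kappa>\<close>: small enough for the penalty to dominate, yet \<open>sqrt n * e n\<close> is of order \<open>n\<^sup>1\<^sup>/\<^sup>2\<^sup>-\<^sup>\<delta>\<close> and tends to infinity.\<close>
  define e where "e n = \<kappa> n / (2 * C)" for n
  define D where "D n = deviates n (e n) \<union> ties n" for n
  have \<kappa>': "\<kappa> n = (1 / p) * real n powr - \<delta>" for n
    unfolding \<kappa> p_def by (simp add: powr_minus field_simps)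
  have pw: "((\<lambda>n. real n powr - \<delta>) \<longlongrightarrow> 0) sequentially"
    by (rule tendsto_neg_powr[OF _ filterlim_real_sequentially]) (use \<delta> in simp)
  have k0: "\<kappa> \<longlonglongrightarrow> 0"
    unfolding \<kappa>'[abs_def] using tendsto_mult[OF tendsto_const[of "1 / p"] pw] by simp
  have en0: "e \<longlonglongrightarrow> 0"
    unfolding e_def[abs_def] using tendsto_divide[OF k0 tendsto_const[of "2 * C"]] C by simp
  have "filterlim (\<lambda>n. (1 / (p * (2 * C))) * real n powr (1 / 2 - \<delta>)) at_top sequentially"
    by (rule filterlim_tendsto_pos_mult_at_top[OF tendsto_const _ filterlim_powr_nat_at_top]) (use p C \<delta> in auto)
  moreover have "\<forall>\<^sub>F n in sequentially. (1 / (p * (2 * C))) * real n powr (1 / 2 - \<delta>) = sqrt n * e n"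
    using eventually_gt_at_top[of 0]
  proof eventually_elim
    case (elim n)
    then have "real n powr (1 / 2 - \<delta>) = sqrt n * real n powr - \<delta>"
      by (simp add: powr_half_sqrt[symmetric] powr_add[symmetric])
    then show ?case unfolding e_def \<kappa>' by simp
  qed
  ultimately have rate: "filterlim (\<lambda>n. sqrt n * e n) at_top sequentially"
    using filterlim_cong[OF refl refl] by fast
  have Dm: "D n \<in> events" for n unfolding D_def by simp
  have lim: "(\<lambda>n. prob (deviates n (e n)) + prob (ties n)) \<longlonglongrightarrow> 0"
    using tendsto_add[OF deviates_tendsto_0[OF rate] ties_tendsto_0[OF Sig]] by simp
  have D0: "(\<lambda>n. prob (D n)) \<longlonglongrightarrow> 0"
  proof (rule tendsto_sandwich[OF _ _ tendsto_const lim])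
    show "\<forall>\<^sub>F n in sequentially. prob (D n) \<le> prob (deviates n (e n)) + prob (ties n)"
      unfolding D_def by (intro always_eventually allI measure_Un_le) auto
  qed simp
  have "\<forall>\<^sub>F n in sequentially. e n < min e0 (min e1 e2)"
    by (rule order_tendstoD(2)[OF en0]) (use e0 e1 e2 in auto)
  moreover have "\<forall>\<^sub>F n in sequentially. \<kappa> n < e0" by (rule order_tendstoD(2)[OF k0 e0])
  ultimately have ev: "\<forall>\<^sub>F n in sequentially. \<forall>\<omega>\<in>space M - D n.
       block_restrict (Bhat n \<omega>) (emp_cov n \<omega>) = block_restrict ?B (emp_cov n \<omega>)"
    using eventually_gt_at_top[of 0]
  proof eventually_elim
    case (elim n)
    have kp: "\<kappa> n > 0" using elim(3) p unfolding \<kappa>' by simp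
    show ?case
    proof
      fix \<omega> assume w: "\<omega> \<in> space M - D n"
      let ?S = "emp_cov n \<omega>"
      have near: "\<bar>?S $ i $ j - Sig $ i $ j\<bar> \<le> e n" for i j
        using w unfolding D_def deviates_def by (auto simp: not_less)
      have pd: "sym_pos_def ?S"
        by (rule spd[OF transpose_emp_cov]) (use near elim(1) in \<open>meson less_imp_le min.strict_boundedE order_trans\<close>)
      have fin: "block_restrict (Bhat n \<omega>) ?S = block_restrict ?B ?S"
        if "partition_on UNIV (Bhat n \<omega>)" "criterion (\<kappa> n) ?S (Bhat n \<omega>) \<le> criterion (\<kappa> n) ?S ?B"
      proof (rule select[OF near _ _ _ that])
        show "C * e n < \<kappa> n" unfolding e_def using C kp by simp
      qed (use elim in auto)
      from Bhat show "block_restrict (Bhat n \<omega>) ?S = block_restrict ?B ?S"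
      proof
        assume "\<forall>n. \<forall>\<omega>\<in>space M. sym_pos_def (emp_cov n \<omega>) \<longrightarrow> is_B_tot (\<kappa> n) (emp_cov n \<omega>) (Bhat n \<omega>)"
        then have "is_B_tot (\<kappa> n) ?S (Bhat n \<omega>)" using w pd by blast
        then show ?thesis
          using partition_on_finest[of Sig] unfolding is_B_tot_def is_arg_min_def by (intro fin) (auto simp: not_less)
      next
        assume "(\<forall>n. \<forall>\<omega>\<in>space M. sym_pos_def (emp_cov n \<omega>) \<longrightarrow> is_B_corr (\<kappa> n) (emp_cov n \<omega>) (Bhat n \<omega>)) \<and>
          (CARD('p) = 2 \<longrightarrow> finest_partition Sig \<noteq> {UNIV})"
        then have corr: "is_B_corr (\<kappa> n) ?S (Bhat n \<omega>)" and two: "CARD('p) = 2 \<Longrightarrow> ?B \<noteq> {UNIV}"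
          using w pd by blast+
        have mem: "Bhat n \<omega> \<in> threshold_partition (corr_matrix ?S) ` corr_levels (corr_matrix ?S)"
          using corr unfolding is_B_corr_def is_arg_min_def by blast
        have "?B \<in> threshold_partition (corr_matrix ?S) ` corr_levels (corr_matrix ?S)"
        proof (cases "\<exists>a b. a \<noteq> b \<and> Sig $ a $ b = 0")
          case True
          then obtain a b where ab: "a \<noteq> b" "Sig $ a $ b = 0" by blast
          show ?thesis
            by (rule thr[OF _ ab]) (use near elim(1) in \<open>meson less_imp_le min.strict_boundedE order_trans\<close>)
        next
          case False
          then have full: "Sig $ i $ j \<noteq> 0" if "i \<noteq> j" for i j using that by blast
          \<comment> \<open>With a single index there is no level, hence no candidate that could be a minimiser.\<close>
          have "CARD('p) \<noteq> 1" using mem corr_levels_card_1 by fastforce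
          moreover have "CARD('p) \<noteq> 2" using two finest_partition_full[OF full] by blast
          moreover have "CARD('p) \<noteq> 0" by simp
          ultimately have three: "CARD('p) \<ge> 3" by linarith
          show ?thesis
          proof (rule threshold_at_smallest_level[OF full three pd])
            fix i j k l :: 'p assume ij: "i \<noteq> j" "k \<noteq> l" "i \<notin> {k, l}"
            have "\<omega> \<notin> ties n" using w unfolding D_def by simp
            then have "\<omega> \<notin> tie_event i j k l n" using ij full[OF ij(1)] unfolding ties_def by blast
            then show "(?S $ i $ j)\<^sup>2 * ?S $ k $ k * ?S $ l $ l \<noteq> (?S $ k $ l)\<^sup>2 * ?S $ i $ i * ?S $ j $ j"
              using w unfolding tie_event_def tie_polynomial_def by auto
          qed
        qed
        then have "criterion (\<kappa> n) ?S (Bhat n \<omega>) \<le> criterion (\<kappa> n) ?S ?B"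
          using corr unfolding is_B_corr_def is_arg_min_def by (auto simp: not_less)
        moreover have "partition_on UNIV (Bhat n \<omega>)"
          using mem unfolding threshold_partition_def by (auto intro: partition_on_finest)
        ultimately show ?thesis by (intro fin)
      qed
    qed
  qed
  show thesis by (rule that[OF Dm D0 ev])
qed

lemma converges_in_law_perturb:
  fixes Y Z :: "nat \<Rightarrow> 'a \<Rightarrow> real^'d"
  assumes Y: "converges_in_law (\<lambda>n. distr M borel (Y n)) N"
    and [measurable]: "\<And>n. Y n \<in> borel_measurable M" "\<And>n. Z n \<in> borel_measurable M"
    and D: "\<And>n. D n \<in> events" "(\<lambda>n. prob (D n)) \<longlonglongrightarrow> 0"
    and eq: "\<forall>\<^sub>F n in sequentially. \<forall>\<omega>\<in>space M - D n. Z n \<omega> = Y n \<omega>"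
  shows "converges_in_law (\<lambda>n. distr M borel (Z n)) N"
  unfolding converges_in_law_def
proof (intro allI impI)
  fix f :: "real^'d \<Rightarrow> real" assume f: "continuous_on UNIV f \<and> bounded (range f)"
  then obtain K where K: "\<And>x. \<bar>f x\<bar> \<le> K" unfolding bounded_iff by auto
  have [measurable]: "f \<in> borel_measurable borel" using f by (intro borel_measurable_continuous_onI) auto
  note [measurable] = D(1)
  have i: "integrable M (\<lambda>\<omega>. f (Y n \<omega>))" "integrable M (\<lambda>\<omega>. f (Z n \<omega>))" for n
    using K by (auto intro!: integrable_const_bound[of _ K])
  have "\<forall>\<^sub>F n in sequentially. norm ((\<integral>x. f x \<partial>distr M borel (Z n)) - (\<integral>x. f x \<partial>distr M borel (Y n))) \<le> 2 * K * prob (D n)"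
    using eq
  proof eventually_elim
    case (elim n)
    have "norm ((\<integral>x. f x \<partial>distr M borel (Z n)) - (\<integral>x. f x \<partial>distr M borel (Y n)))
        = \<bar>\<integral>\<omega>. f (Z n \<omega>) - f (Y n \<omega>) \<partial>M\<bar>"
      using i by (simp add: integral_distr)
    also have "\<dots> \<le> (\<integral>\<omega>. \<bar>f (Z n \<omega>) - f (Y n \<omega>)\<bar> \<partial>M)" by (rule integral_abs_bound)
    also have "\<dots> \<le> (\<integral>\<omega>. 2 * K * indicator (D n) \<omega> \<partial>M)"
    proof (rule integral_mono)
      fix \<omega> assume w: "\<omega> \<in> space M"
      show "\<bar>f (Z n \<omega>) - f (Y n \<omega>)\<bar> \<le> 2 * K * indicator (D n) \<omega>"
      proof (cases "\<omega> \<in> D n")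
        case True
        then show ?thesis using K[of "Z n \<omega>"] K[of "Y n \<omega>"] by simp
      next
        case False
        then show ?thesis using elim w by simp
      qed
    qed (use i D(1) in \<open>auto simp: less_top[symmetric]\<close>)
    also have "\<dots> = 2 * K * prob (D n)" using D(1)[of n] by (simp add: sets.Int_space_eq2)
    finally show ?case .
  qed
  moreover have "(\<lambda>n. 2 * K * prob (D n)) \<longlonglongrightarrow> 0"
    using tendsto_mult[OF tendsto_const D(2), of "2 * K"] by simp
  ultimately have "(\<lambda>n. (\<integral>x. f x \<partial>distr M borel (Z n)) - (\<integral>x. f x \<partial>distr M borel (Y n))) \<longlonglongrightarrow> 0"
    by (rule Lim_null_comparison)
  moreover have "(\<lambda>n. \<integral>x. f x \<partial>distr M borel (Y n)) \<longlonglongrightarrow> (\<integral>x. f x \<partial>N)"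
    using Y f unfolding converges_in_law_def by blast
  ultimately show "(\<lambda>n. \<integral>x. f x \<partial>distr M borel (Z n)) \<longlonglongrightarrow> (\<integral>x. f x \<partial>N)"
    using tendsto_add by fastforce
qed

end

theorem proposition16:
  fixes M :: "'a measure"
    and X :: "nat \<Rightarrow> 'a \<Rightarrow> real^'p"
    and \<mu> :: "real^'p"
    and Sig :: "real^'p^'p"
    and \<delta> :: real
    and \<kappa> :: "nat \<Rightarrow> real"
    and S :: "nat \<Rightarrow> 'a \<Rightarrow> real^'p^'p"
    and Bhat :: "nat \<Rightarrow> 'a \<Rightarrow> 'p set set"
  assumes "prob_space M"
    and "sym_pos_def Sig"
    and "prob_space.indep_vars M (\<lambda>_. borel) X {1..}"
    and "\<And>l. l \<ge> 1 \<Longrightarrow> is_normal_law \<mu> Sig (distr M borel (X l))"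
    and "0 < \<delta>" and "\<delta> < 1 / 2"
    and "\<And>n. \<kappa> n = 1 / (real CARD('p) * real n powr \<delta>)"
    and "\<And>n \<omega>. S n \<omega> = sample_cov (\<lambda>l. X l \<omega>) n"
    and "\<And>n. Bhat n \<in> measurable M (count_space UNIV)"
    and "(\<forall>n. \<forall>\<omega>\<in>space M. sym_pos_def (S n \<omega>) \<longrightarrow> is_B_tot (\<kappa> n) (S n \<omega>) (Bhat n \<omega>)) \<or>
         (\<forall>n. \<forall>\<omega>\<in>space M. sym_pos_def (S n \<omega>) \<longrightarrow> is_B_corr (\<kappa> n) (S n \<omega>) (Bhat n \<omega>)) \<and>
         (CARD('p) = 2 \<longrightarrow> finest_partition Sig \<noteq> {UNIV})"
  shows "\<exists>N. is_normal_law 0 (CR Sig (finest_partition Sig)) N \<and>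
           converges_in_law
             (\<lambda>n. distr M borel
                (\<lambda>\<omega>. sqrt (real n) *\<^sub>R
                   (vectorize (block_restrict (Bhat n \<omega>) (S n \<omega>)) - vectorize Sig))) N"
proof -
  interpret gaussian_sample M X \<mu> Sig
    using assms(1,3,4) by (simp add: gaussian_sample_def gaussian_sample_axioms_def)
  let ?B = "finest_partition Sig"
  have S: "gaussian_sample.emp_cov X n \<omega> = S n \<omega>" for n \<omega>
    unfolding assms(8) by (rule emp_cov_def)
  have sym: "transpose Sig = Sig" using assms(2) unfolding sym_pos_def_def by blast
  have det: "det Sig \<noteq> 0" using sym_pos_def_det_pos[OF assms(2)] by simp
  obtain A :: "real^'p^'p" where A: "A ** transpose A = Sig"
    using law[OF order_refl] by (rule is_normal_lawE)
  define N where "N = distr std_normal_vec borel (\<lambda>z. 0 + block_wishart_root ?B A *v z)"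
  have CR: "CR Sig ?B = block_wishart_cov ?B Sig"
    by (rule CR_eq_block_wishart_cov[OF sym det partition_on_finest block_restrict_finest])
  have N: "is_normal_law 0 (block_wishart_cov ?B Sig) N"
    unfolding is_normal_law_def N_def using block_wishart_root_mult[OF A] by blast
  obtain D where D: "\<And>n. D n \<in> events" "(\<lambda>n. prob (D n)) \<longlonglongrightarrow> 0"
    "\<forall>\<^sub>F n in sequentially. \<forall>\<omega>\<in>space M - D n.
       block_restrict (Bhat n \<omega>) (S n \<omega>) = block_restrict ?B (S n \<omega>)"
    using selection_consistent[OF assms(2,5,6,7), unfolded S, OF assms(10)] by blast
  define Z where "Z n \<omega> = sqrt (real n) *\<^sub>R (vectorize (block_restrict (Bhat n \<omega>) (S n \<omega>)) - vectorize Sig)" for n \<omega>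
  have Zm: "Z n \<in> borel_measurable M" for n
  proof (rule borel_measurable_vecI)
    fix x :: "'p \<times> 'p"
    obtain i j where x: "x = (i, j)" by (cases x)
    have [measurable]: "{\<omega> \<in> space M. same_block (Bhat n \<omega>) i j} \<in> events"
      using measurable_sets[OF assms(9)[of n], of "{B. same_block B i j}"] by (simp add: vimage_def Int_def conj_commute)
    have [measurable]: "(\<lambda>\<omega>. S n \<omega> $ i $ j) \<in> borel_measurable M"
      using emp_cov_entry_measurable[of n i j] unfolding S .
    have "Z n \<omega> $ x = sqrt n * ((if same_block (Bhat n \<omega>) i j then S n \<omega> $ i $ j else 0) - Sig $ i $ j)" for \<omega>
      unfolding x Z_def by (simp add: vectorize_def)
    then show "(\<lambda>\<omega>. Z n \<omega> $ x) \<in> borel_measurable M" by simp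
  qed
  have "\<forall>\<^sub>F n in sequentially. \<forall>\<omega>\<in>space M - D n. Z n \<omega> = cov_error ?B n \<omega>"
    using D(3)
  proof eventually_elim
    case (elim n)
    have "vectorize (block_restrict ?B (S n \<omega>)) - vectorize Sig = vectorize (block_restrict ?B (S n \<omega> - Sig))" for \<omega>
    proof -
      have "block_restrict ?B (S n \<omega>) - Sig = block_restrict ?B (S n \<omega>) - block_restrict ?B Sig"
        by (simp add: block_restrict_finest)
      also have "\<dots> = block_restrict ?B (S n \<omega> - Sig)" by (simp add: vec_eq_iff)
      finally show ?thesis by (simp add: vectorize_def vec_eq_iff)
    qed
    then show ?case using elim unfolding Z_def cov_error_def assms(8) by simp
  qed
  then have "converges_in_law (\<lambda>n. distr M borel (Z n)) N"
    by (rule converges_in_law_perturb[OF sample_cov_clt[OF N] cov_error_measurable Zm D(1,2)])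
  then show ?thesis unfolding Z_def[abs_def] CR using N by blast
qed

end
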